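(* Let $L\ge 1$ and let $\gamma,\theta,\zeta,\mu_1,\dots,\mu_L$ be generic complex parameters. Let $\mathcal{Z}(\lambda_1,\dots,\lambda_L)=\langle\bar 0|\,\mathcal{B}(\lambda_1)\cdots\mathcal{B}(\lambda_L)\,|0\rangle$ be the partition function of the elliptic SOS model with domain-wall boundaries and one reflecting end (defined in the context). Then for generic $\lambda_0,\lambda_1,\dots,\lambda_L\in\mathbb{C}$, \[ \sum_{\nu=0}^{L} M_\nu(\lambda_0;\boldsymbol{\lambda})\,\mathcal{Z}(\lambda_0,\dots,\widehat{\lambda_\nu},\dots,\lambda_L)=0, \] where $\boldsymbol{\lambda}=(\lambda_1,\dots,\lambda_L)$, the caret means that $\lambda_\nu$ is omitted from the list $(\lambda_0,\lambda_1,\dots,\lambda_L)$, and \[ M_0(\lambda_0;\boldsymbol{\lambda})=\bar\Lambda_{\mathcal A}(\lambda_0)-\Lambda_{\mathcal A}(\lambda_0)\prod_{j=1}^{L}\frac{[\lambda_j-\lambda_0+\gamma,\,\lambda_j+\lambda_0]}{[\lambda_j-\lambda_0,\,\lambda_j+\lambda_0+\gamma]}, \] and for $1\le i\le L$ \[ \begin{aligned} M_i(\lambda_0;\boldsymbol{\lambda})={}&\frac{[2\lambda_i,\,\gamma,\,\theta+(L-1)\gamma+\lambda_i-\lambda_0]}{[2\lambda_i+\gamma,\,\lambda_i-\lambda_0,\,\theta+(L-1)\gamma]}\,\Lambda_{\mathcal A}(\lambda_i)\prod_{j\ne i}\frac{[\lambda_j-\lambda_i+\gamma,\,\lambda_j+\lambda_i]}{[\lambda_j-\lambda_i,\,\lambda_j+\lambda_i+\gamma]}\\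 &+\frac{[\gamma,\,\theta+(L-2)\gamma-\lambda_i-\lambda_0,\,\theta-(L-1)\gamma]}{[\lambda_i+\lambda_0+\gamma,\,\theta+(L-1)\gamma,\,\theta-L\gamma]}\,\Lambda_{\tilde{\mathcal D}}(\lambda_i)\prod_{j\ne i}\frac{[\lambda_i-\lambda_j+\gamma,\,\lambda_i+\lambda_j+2\gamma]}{[\lambda_i-\lambda_j,\,\lambda_i+\lambda_j+\gamma]}, \end{aligned} \] with products over $j\in\{1,\dots,L\}$, and \[ \begin{aligned} \Lambda_{\mathcal A}(\lambda)&=[\zeta+\lambda]\frac{[\theta+\zeta-\lambda]}{[\theta+\zeta+\lambda]}\prod_{j=1}^L[\lambda-\mu_j+\gamma,\,\lambda+\mu_j+\gamma],\\ \Lambda_{\tilde{\mathcal D}}(\lambda)&=[\zeta-\lambda-\gamma]\frac{[2\lambda,\,\theta+\zeta+\lambda+\gamma,\,\theta-L\gamma]}{[2\lambda+\gamma,\,\theta+\zeta+\lambda,\,\theta-(L-1)\gamma]}\prod_{j=1}^L[\lambda-\mu_j,\,\lambda+\mu_j],\\ \bar\Lambda_{\mathcal A}(\lambda)&=[\zeta-\lambda]\frac{[\gamma,\,\theta+(L-1)\gamma-2\lambda]}{[2\lambda+\gamma,\,\theta+(L-1)\gamma]}\prod_{j=1}^L[\lambda-\mu_j+\gamma,\,\lambda+\mu_j+\gamma]\\ &\quad+[\zeta+\lambda+\gamma]\frac{[2\lambda,\,\theta+\zeta-\lambda-\gamma,\,\theta+L\gamma]}{[2\lambda+\gamma,\,\theta+\zeta+\lambda,\,\theta+(L-1)\gamma]}\prod_{j=1}^L[\lambda-\mu_j,\,\lambda+\mu_j].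 \end{aligned} \]
   Context: Fix $\tau\in\mathbb{C}$ with $\operatorname{Im}\tau>0$ and let $f(\lambda)=\sum_{n\ge0}(-1)^n e^{\mathrm{i}n(n+1)\pi\tau}\sinh((2n+1)\lambda)$ (equivalently $f(\lambda)=-\tfrac{\mathrm{i}}{2}e^{-\mathrm{i}\pi\tau/4}\vartheta_1(\mathrm{i}\lambda|\tau)$). Write $[x]:=f(x)$ and $[x_1,x_2,\dots,x_k]:=f(x_1)f(x_2)\cdots f(x_k)$. Let $V=\mathbb{C}^2$ with basis $e_+,e_-$ and $h\in\mathrm{End}(V)$, $he_\pm=\pm e_\pm$. Define $R(\lambda,\theta)\in\mathrm{End}(V\otimes V)$ by its matrix in the ordered basis $(e_+\otimes e_+,e_+\otimes e_-,e_-\otimes e_+,e_-\otimes e_-)$: $R=\begin{pmatrix}a_+&0&0&0\\0&b_+&c_+&0\\0&c_-&b_-&0\\0&0&0&a_-\end{pmatrix}$, with $a_\pm(\lambda,\theta)=[\lambda+\gamma]$, $b_\pm(\lambda,\theta)=[\lambda][\theta\mp\gamma]/[\theta]$, $c_\pm(\lambda,\theta)=[\theta\mp\lambda][\gamma]/[\theta]$. Let $V_0\cong V$ (auxiliary space) and $W=V_1\otimes\cdots\otimes V_L$ with $V_j\cong V$; subscripts denote the tensor factors on which an operator acts, $h_i$ is $h$ acting on $V_i$, and a dynamical argument of the form $\theta-\gamma\sum_{i\in S}h_i$ means that $\theta$ is replaced by this operator (diagonal in the standard basis of the factors $V_i$, $i\in S$, which commute with the rest). $R_{0j}(\lambda,\cdot)$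 is $R$ acting on $V_0\otimes V_j$ and $R_{j0}$ is $R$ acting on $V_j\otimes V_0$ with $V_j$ as first leg. Define $T_0(\lambda,\theta)=R_{01}(\lambda-\mu_1,\theta-\gamma\sum_{i=2}^Lh_i)\,R_{02}(\lambda-\mu_2,\theta-\gamma\sum_{i=3}^Lh_i)\cdots R_{0L}(\lambda-\mu_L,\theta)$, $\bar T_0(\lambda,\theta)=R_{L0}(\lambda+\mu_L,\theta)\,R_{L-1,0}(\lambda+\mu_{L-1},\theta-\gamma h_L)\cdots R_{10}(\lambda+\mu_1,\theta-\gamma\sum_{i=2}^Lh_i)$. Let $K_0(\lambda,\theta)=\mathrm{diag}(k_+(\lambda,\theta),k_-(\lambda,\theta))$ on $V_0$ with $k_+=[\zeta+\lambda][\theta+\zeta-\lambda]/[\theta+\zeta+\lambda]$, $k_-=[\zeta-\lambda]$. Let $\mathcal{T}_0(\lambda)=T_0(\lambda,\theta)K_0(\lambda,\theta)\bar T_0(\lambda,\theta)\in\mathrm{End}(V_0\otimes W)$ and define $\mathcal{A}(\lambda),\mathcal{B}(\lambda),\mathcal{C}(\lambda),\mathcal{D}(\lambda)\in\mathrm{End}(W)$ by $\mathcal{T}_0(\lambda)(e_+\otimes w)=e_+\otimes\mathcal{A}(\lambda)w+e_-\otimes\mathcal{C}(\lambda)w$ and $\mathcal{T}_0(\lambda)(e_-\otimes w)=e_+\otimes\mathcal{B}(\lambda)w+e_-\otimes\mathcal{D}(\lambda)w$. Let $|0\rangle=e_+^{\otimes L}\in W$ and, for $v\in W$, let $\langle\bar0|v$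 denote the coefficient of $e_-^{\otimes L}$ in $v$. The partition function is $\mathcal{Z}(\lambda_1,\dots,\lambda_L)=\langle\bar0|\mathcal{B}(\lambda_1)\cdots\mathcal{B}(\lambda_L)|0\rangle$. *)

theory Defs
  imports "HOL-Analysis.Analysis"
begin

definition thf :: "complex \<Rightarrow> complex \<Rightarrow> complex" where
  "thf \<tau> x = (\<Sum>n. (-1) ^ n * exp (\<i> * of_nat (n * (n + 1)) * of_real pi * \<tau>)
                      * sinh (of_nat (2 * n + 1) * x))"

text \<open>Spin True = e_+, False = e_-. Rent tau g lam th o1 o2 i1 i2 is the matrix entry of
  R(lam,th) from input basis vector e_i1 (x) e_i2 to output e_o1 (x) e_o2.\<close>

definition Rent :: "complex \<Rightarrow> complex \<Rightarrow> complex \<Rightarrow> complex \<Rightarrow> bool \<Rightarrow> bool \<Rightarrow> bool \<Rightarrow> bool \<Rightarrow> complex" where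
  "Rent \<tau> \<gamma> lam th o1 o2 i1 i2 =
    (if (o1 \<and> o2 \<and> i1 \<and> i2) \<or> (\<not>o1 \<and> \<not>o2 \<and> \<not>i1 \<and> \<not>i2) then thf \<tau> (lam + \<gamma>)
     else if o1 \<and> \<not>o2 \<and> i1 \<and> \<not>i2 then thf \<tau> lam * thf \<tau> (th - \<gamma>) / thf \<tau> th
     else if o1 \<and> \<not>o2 \<and> \<not>i1 \<and> i2 then thf \<tau> (th - lam) * thf \<tau> \<gamma> / thf \<tau> th
     else if \<not>o1 \<and> o2 \<and> i1 \<and> \<not>i2 then thf \<tau> (th + lam) * thf \<tau> \<gamma> / thf \<tau> th
     else if \<not>o1 \<and> o2 \<and> \<not>i1 \<and> i2 then thf \<tau> lam * thf \<tau> (th + \<gamma>) / thf \<tau> th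
     else 0)"

text \<open>A basis state of V_0 (x) V_1 (x) ... (x) V_L is (a, xs) with a the auxiliary spin and
  xs a list of length L, xs ! (j-1) being the spin of site j. An operator is given by its
  matrix entries O out in.\<close>

type_synonym fop = "bool \<times> bool list \<Rightarrow> bool \<times> bool list \<Rightarrow> complex"

definition fstates :: "nat \<Rightarrow> (bool \<times> bool list) set" where
  "fstates L = UNIV \<times> {xs. length xs = L}"

definition opmul :: "nat \<Rightarrow> fop \<Rightarrow> fop \<Rightarrow> fop" where
  "opmul L O1 O2 = (\<lambda>out inp. \<Sum>mid\<in>fstates L. O1 out mid * O2 mid inp)"

definition opid :: fop where
  "opid = (\<lambda>out inp. if out = inp then 1 else 0)"

text \<open>Eigenvalue of sum_{i=j+1}^L h_i on the basis state xs (sites j+1..L are list indices j..L-1).\<close>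
definition spin_sum :: "bool list \<Rightarrow> nat \<Rightarrow> complex" where
  "spin_sum xs j = (\<Sum>k\<in>{j..<length xs}. if xs ! k then 1 else -1)"

definition R0j :: "nat \<Rightarrow> complex \<Rightarrow> complex \<Rightarrow> complex \<Rightarrow> complex \<Rightarrow> nat \<Rightarrow> fop" where
  "R0j L \<tau> \<gamma> lam th j = (\<lambda>(a, xs) (b, ys).
     if (\<forall>k<L. k \<noteq> j - 1 \<longrightarrow> xs ! k = ys ! k)
     then Rent \<tau> \<gamma> lam (th - \<gamma> * spin_sum ys j) a (xs ! (j - 1)) b (ys ! (j - 1))
     else 0)"

definition Rj0 :: "nat \<Rightarrow> complex \<Rightarrow> complex \<Rightarrow> complex \<Rightarrow> complex \<Rightarrow> nat \<Rightarrow> fop" where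
  "Rj0 L \<tau> \<gamma> lam th j = (\<lambda>(a, xs) (b, ys).
     if (\<forall>k<L. k \<noteq> j - 1 \<longrightarrow> xs ! k = ys ! k)
     then Rent \<tau> \<gamma> lam (th - \<gamma> * spin_sum ys j) (xs ! (j - 1)) a (ys ! (j - 1)) b
     else 0)"

definition Tmon :: "nat \<Rightarrow> complex \<Rightarrow> complex \<Rightarrow> (nat \<Rightarrow> complex) \<Rightarrow> complex \<Rightarrow> complex \<Rightarrow> fop" where
  "Tmon L \<tau> \<gamma> \<mu> lam th =
     foldr (opmul L) (map (\<lambda>j. R0j L \<tau> \<gamma> (lam - \<mu> j) th j) [1..<Suc L]) opid"

definition Tbar :: "nat \<Rightarrow> complex \<Rightarrow> complex \<Rightarrow> (nat \<Rightarrow> complex) \<Rightarrow> complex \<Rightarrow> complex \<Rightarrow> fop" where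
  "Tbar L \<tau> \<gamma> \<mu> lam th =
     foldr (opmul L) (map (\<lambda>j. Rj0 L \<tau> \<gamma> (lam + \<mu> j) th j) (rev [1..<Suc L])) opid"

definition Kop :: "complex \<Rightarrow> complex \<Rightarrow> complex \<Rightarrow> complex \<Rightarrow> fop" where
  "Kop \<tau> \<zeta> lam th = (\<lambda>(a, xs) (b, ys).
     if a = b \<and> xs = ys then
       (if a then thf \<tau> (\<zeta> + lam) * thf \<tau> (th + \<zeta> - lam) / thf \<tau> (th + \<zeta> + lam)
        else thf \<tau> (\<zeta> - lam))
     else 0)"

definition dmon :: "nat \<Rightarrow> complex \<Rightarrow> complex \<Rightarrow> complex \<Rightarrow> complex \<Rightarrow> (nat \<Rightarrow> complex) \<Rightarrow> complex \<Rightarrow> fop" where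
  "dmon L \<tau> \<gamma> \<theta> \<zeta> \<mu> lam =
     opmul L (Tmon L \<tau> \<gamma> \<mu> lam \<theta>) (opmul L (Kop \<tau> \<zeta> lam \<theta>) (Tbar L \<tau> \<gamma> \<mu> lam \<theta>))"

definition Bop :: "nat \<Rightarrow> complex \<Rightarrow> complex \<Rightarrow> complex \<Rightarrow> complex \<Rightarrow> (nat \<Rightarrow> complex) \<Rightarrow> complex
                   \<Rightarrow> bool list \<Rightarrow> bool list \<Rightarrow> complex" where
  "Bop L \<tau> \<gamma> \<theta> \<zeta> \<mu> lam xs ys = dmon L \<tau> \<gamma> \<theta> \<zeta> \<mu> lam (True, xs) (False, ys)"

definition wmul :: "nat \<Rightarrow> (bool list \<Rightarrow> bool list \<Rightarrow> complex) \<Rightarrow> (bool list \<Rightarrow> bool list \<Rightarrow> complex)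
                    \<Rightarrow> bool list \<Rightarrow> bool list \<Rightarrow> complex" where
  "wmul L B1 B2 = (\<lambda>xs ys. \<Sum>zs\<in>{zs. length zs = L}. B1 xs zs * B2 zs ys)"

definition wid :: "bool list \<Rightarrow> bool list \<Rightarrow> complex" where
  "wid = (\<lambda>xs ys. if xs = ys then 1 else 0)"

definition Zpf :: "nat \<Rightarrow> complex \<Rightarrow> complex \<Rightarrow> complex \<Rightarrow> complex \<Rightarrow> (nat \<Rightarrow> complex)
                   \<Rightarrow> complex list \<Rightarrow> complex" where
  "Zpf L \<tau> \<gamma> \<theta> \<zeta> \<mu> lams =
     foldr (wmul L) (map (Bop L \<tau> \<gamma> \<theta> \<zeta> \<mu>) lams) wid (replicate L False) (replicate L True)"

definition LamA :: "nat \<Rightarrow> complex \<Rightarrow> complex \<Rightarrow> complex \<Rightarrow> complex \<Rightarrow> (nat \<Rightarrow> complex) \<Rightarrow> complex \<Rightarrow> complex" where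
  "LamA L \<tau> \<gamma> \<theta> \<zeta> \<mu> l =
     thf \<tau> (\<zeta> + l) * thf \<tau> (\<theta> + \<zeta> - l) / thf \<tau> (\<theta> + \<zeta> + l)
     * (\<Prod>j\<in>{1..L}. thf \<tau> (l - \<mu> j + \<gamma>) * thf \<tau> (l + \<mu> j + \<gamma>))"

definition LamD :: "nat \<Rightarrow> complex \<Rightarrow> complex \<Rightarrow> complex \<Rightarrow> complex \<Rightarrow> (nat \<Rightarrow> complex) \<Rightarrow> complex \<Rightarrow> complex" where
  "LamD L \<tau> \<gamma> \<theta> \<zeta> \<mu> l =
     thf \<tau> (\<zeta> - l - \<gamma>)
     * (thf \<tau> (2 * l) * thf \<tau> (\<theta> + \<zeta> + l + \<gamma>) * thf \<tau> (\<theta> - of_nat L * \<gamma>))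
     / (thf \<tau> (2 * l + \<gamma>) * thf \<tau> (\<theta> + \<zeta> + l) * thf \<tau> (\<theta> - (of_nat L - 1) * \<gamma>))
     * (\<Prod>j\<in>{1..L}. thf \<tau> (l - \<mu> j) * thf \<tau> (l + \<mu> j))"

definition LamAbar :: "nat \<Rightarrow> complex \<Rightarrow> complex \<Rightarrow> complex \<Rightarrow> complex \<Rightarrow> (nat \<Rightarrow> complex) \<Rightarrow> complex \<Rightarrow> complex" where
  "LamAbar L \<tau> \<gamma> \<theta> \<zeta> \<mu> l =
     thf \<tau> (\<zeta> - l)
     * (thf \<tau> \<gamma> * thf \<tau> (\<theta> + (of_nat L - 1) * \<gamma> - 2 * l))
     / (thf \<tau> (2 * l + \<gamma>) * thf \<tau> (\<theta> + (of_nat L - 1) * \<gamma>))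
     * (\<Prod>j\<in>{1..L}. thf \<tau> (l - \<mu> j + \<gamma>) * thf \<tau> (l + \<mu> j + \<gamma>))
   + thf \<tau> (\<zeta> + l + \<gamma>)
     * (thf \<tau> (2 * l) * thf \<tau> (\<theta> + \<zeta> - l - \<gamma>) * thf \<tau> (\<theta> + of_nat L * \<gamma>))
     / (thf \<tau> (2 * l + \<gamma>) * thf \<tau> (\<theta> + \<zeta> + l) * thf \<tau> (\<theta> + (of_nat L - 1) * \<gamma>))
     * (\<Prod>j\<in>{1..L}. thf \<tau> (l - \<mu> j) * thf \<tau> (l + \<mu> j))"

definition Mcoef :: "nat \<Rightarrow> complex \<Rightarrow> complex \<Rightarrow> complex \<Rightarrow> complex \<Rightarrow> (nat \<Rightarrow> complex)
                     \<Rightarrow> (nat \<Rightarrow> complex) \<Rightarrow> nat \<Rightarrow> complex" where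
  "Mcoef L \<tau> \<gamma> \<theta> \<zeta> \<mu> lam \<nu> =
    (if \<nu> = 0 then
       LamAbar L \<tau> \<gamma> \<theta> \<zeta> \<mu> (lam 0)
       - LamA L \<tau> \<gamma> \<theta> \<zeta> \<mu> (lam 0)
         * (\<Prod>j\<in>{1..L}. thf \<tau> (lam j - lam 0 + \<gamma>) * thf \<tau> (lam j + lam 0)
                        / (thf \<tau> (lam j - lam 0) * thf \<tau> (lam j + lam 0 + \<gamma>)))
     else
       (thf \<tau> (2 * lam \<nu>) * thf \<tau> \<gamma> * thf \<tau> (\<theta> + (of_nat L - 1) * \<gamma> + lam \<nu> - lam 0))
       / (thf \<tau> (2 * lam \<nu> + \<gamma>) * thf \<tau> (lam \<nu> - lam 0) * thf \<tau> (\<theta> + (of_nat L - 1) * \<gamma>))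
       * LamA L \<tau> \<gamma> \<theta> \<zeta> \<mu> (lam \<nu>)
       * (\<Prod>j\<in>{1..L} - {\<nu>}. thf \<tau> (lam j - lam \<nu> + \<gamma>) * thf \<tau> (lam j + lam \<nu>)
                            / (thf \<tau> (lam j - lam \<nu>) * thf \<tau> (lam j + lam \<nu> + \<gamma>)))
     + (thf \<tau> \<gamma> * thf \<tau> (\<theta> + (of_nat L - 2) * \<gamma> - lam \<nu> - lam 0) * thf \<tau> (\<theta> - (of_nat L - 1) * \<gamma>))
       / (thf \<tau> (lam \<nu> + lam 0 + \<gamma>) * thf \<tau> (\<theta> + (of_nat L - 1) * \<gamma>) * thf \<tau> (\<theta> - of_nat L * \<gamma>))
       * LamD L \<tau> \<gamma> \<theta> \<zeta> \<mu> (lam \<nu>)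
       * (\<Prod>j\<in>{1..L} - {\<nu>}. thf \<tau> (lam \<nu> - lam j + \<gamma>) * thf \<tau> (lam \<nu> + lam j + 2 * \<gamma>)
                            / (thf \<tau> (lam \<nu> - lam j) * thf \<tau> (lam \<nu> + lam j + \<gamma>))))"

end

theory Submission
  imports Defs "HOL-Complex_Analysis.Complex_Analysis"
begin

text \<open>
  The relation is obtained by computing \<open>\<langle>\<bar>0| A(\<lambda>\<^sub>0) B(\<lambda>\<^sub>1) \<dots> B(\<lambda>\<^sub>L) |0\<rangle>\<close> in two ways. To the left, the
  all-down covector is an eigenvector of \<open>A\<close>. To the right, \<open>A\<close> is moved through the \<open>B\<close>'s with the
  dynamical reflection algebra. Instead of the operator \<open>D\<close> we use the crossing relation, which expresses
  \<open>D(\<lambda>)\<close> by \<open>A(\<lambda>)\<close> and \<open>A(-\<lambda>-\<gamma>)\<close> and gives \<open>B(-\<lambda>-\<gamma>) \<propto> B(\<lambda>)\<close>, so that only the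
  exchange relations of \<open>A\<close> with \<open>B\<close> and of \<open>B\<close> with \<open>B\<close> are needed; the coefficients of the unwanted
  terms are then controlled, one \<open>B\<close> at a time, by a single four-term theta identity.

  The reflection equation is proved by adding one site after the other with the dynamical Yang-Baxter
  equation, and every scalar identity on the way is a consequence of the oddness of the theta function and of
  the three-term identity. Some of these steps divide by factors which the hypotheses allow to vanish, so
  the relation is first proved for generic parameters and then extended by continuity along a line of
  parameters.
\<close>

section \<open>The theta function\<close>

text \<open>The reflection lambda -> -lambda-gamma does more than remove \<open>D\<close>. The
  vacuum eigenvalue of \<open>A\<close> and the all-down eigenvalue of \<open>D\<close> contain the
  products of [lambda-mu_j+gamma, lambda+mu_j+gamma], which reflect into those of
  [lambda-mu_j, lambda+mu_j]. So, up to the factor relating B(-lambda-gamma) to B(lambda), the two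
  summands of \<open>M_i\<close> are one expression taken at lambda_i and at -lambda_i-gamma. The
  obstacle is the lower row, where R_{j0} has the site as its first leg. The Yang-Baxter equation
  for this order of legs comes from inverting an R-matrix, which requires [gamma + (lambda+mu_j)]
  and [gamma - (lambda+mu_j)] to be nonzero. The exchange relations also divide by quantities such
  as [2 lambda_j] and [lambda_i+lambda_j], and they visit heights beyond theta + k gamma with |k| <=
  L. The hypotheses of the final statement control only the denominators of the relation itself;
  this gap is what the limit along a line closes.\<close>

lemma summable_gaussian:
  fixes a b :: real
  assumes "a > 0"
  shows "summable (\<lambda>n. exp (- a * real n ^ 2 + b * real n))"
proof -
  obtain N :: nat where N: "(b + 1) / (2 * a) < real N"
    using reals_Archimedean2 by blast
  show ?thesis
  proof (rule summable_ratio_test)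
    show "exp (- 1) < (1::real)" by simp
  next
    fix n assume "N \<le> n"
    then have "b + 1 \<le> 2 * a * real n"
      using N assms by (smt (verit) divide_less_eq mult.commute mult_left_mono of_nat_mono)
    then have "- a * real (Suc n) ^ 2 + b * real (Suc n) \<le> - 1 + (- a * real n ^ 2 + b * real n)"
      using assms by (simp add: power2_eq_square algebra_simps)
    then show "norm (exp (- a * real (Suc n) ^ 2 + b * real (Suc n)))
        \<le> exp (- 1) * norm (exp (- a * real n ^ 2 + b * real n))"
      by (simp flip: exp_add)
  qed
qed

text \<open>For complex families summability is absolute summability, so the product family is
  absolutely summable and its sum may be computed iteratively.\<close>

lemma has_sum_times_complex:
  fixes f :: "'a \<Rightarrow> complex" and g :: "'b \<Rightarrow> complex"
  assumes f: "(f has_sum a) A" and g: "(g has_sum b) B"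
  shows "((\<lambda>(x, y). f x * g y) has_sum (a * b)) (A \<times> B)"
proof (rule has_sum_SigmaI)
  show "((\<lambda>y. case (x, y) of (x, y) \<Rightarrow> f x * g y) has_sum f x * b) B" for x
    using has_sum_cmult_right[OF g] by simp
  show "((\<lambda>x. f x * b) has_sum a * b) A"
    using has_sum_cmult_left[OF f] by simp
  have fs: "(\<lambda>x. norm (f x)) summable_on A" "(\<lambda>x. norm (g x)) summable_on B"
    using f g by (auto simp flip: summable_on_iff_abs_summable_on_complex simp: summable_on_def)
  have "(\<lambda>z. norm (case z of (x, y) \<Rightarrow> f x * g y)) summable_on A \<times> B"
    unfolding Infinite_Sum.abs_summable_on_Sigma_iff
    using fs by (auto simp: norm_mult infsum_cmult_right' abs_mult intro!: summable_on_cmult_right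
        summable_on_cmult_left)
  then show "(\<lambda>(x, y). f x * g y) summable_on A \<times> B"
    using summable_on_iff_abs_summable_on_complex by blast
qed

text \<open>The integers are cut at the reflection n -> -n-1, which fixes n(n+1) and so pairs the
  terms of the theta series.\<close>

lemma summable_on_int:
  fixes g :: "int \<Rightarrow> complex"
  assumes "summable (\<lambda>n. norm (g (int n)))" "summable (\<lambda>n. norm (g (- int n - 1)))"
  shows "g summable_on UNIV"
    and "infsum g UNIV = (\<Sum>n. g (int n)) + (\<Sum>n. g (- int n - 1))"
proof -
  have 1: "(g has_sum (\<Sum>n. g (int n))) (range int)"
    using norm_summable_imp_has_sum[OF assms(1)] assms(1)
    by (subst has_sum_reindex) (auto simp: o_def summable_norm_cancel summable_sums)
  have 2: "(g has_sum (\<Sum>n. g (- int n - 1))) (range (\<lambda>n. - int n - 1))"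
    using norm_summable_imp_has_sum[OF assms(2)] assms(2)
    by (subst has_sum_reindex) (auto simp: o_def summable_norm_cancel summable_sums inj_on_def)
  have U: "range int \<union> range (\<lambda>n. - int n - 1) = UNIV"
  proof -
    have "x \<in> range int \<union> range (\<lambda>n. - int n - 1)" for x
    proof (cases "x \<ge> 0")
      case True then show ?thesis by (metis UnI1 rangeI nonneg_int_cases)
    next
      case False
      then have "x = - int (nat (- x - 1)) - 1" by simp
      then show ?thesis by blast
    qed
    then show ?thesis by blast
  qed
  have "(g has_sum ((\<Sum>n. g (int n)) + (\<Sum>n. g (- int n - 1)))) UNIV"
    using has_sum_Un_disjoint[OF 1 2, unfolded U] by fastforce
  then show "g summable_on UNIV"
    "infsum g UNIV = (\<Sum>n. g (int n)) + (\<Sum>n. g (- int n - 1))"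
    by (auto simp: summable_on_def infsumI)
qed

text \<open>The bilateral form of the series. The indices n and -n-1 share n(n+1) and have opposite
  parity and opposite 2n+1, so such a pair adds up to one sinh term; the factor 1/2 is that of
  sinh.\<close>

definition thterm :: "complex \<Rightarrow> complex \<Rightarrow> int \<Rightarrow> complex" where
  "thterm \<tau> x n = (if even n then 1 else - 1) *
     exp (\<i> * of_int (n * (n + 1)) * of_real pi * \<tau> + of_int (2 * n + 1) * x) / 2"

text \<open>Summed over even s this is theta_3(2ix | 2 tau), over odd s it is theta_2(2ix | 2 tau):
  the functions of doubled modulus in the classical product formula for theta_1.\<close>

definition gauss_term :: "complex \<Rightarrow> complex \<Rightarrow> int \<Rightarrow> complex" where
  "gauss_term \<tau> x s = exp (\<i> * of_int (s\<^sup>2) * of_real pi * \<tau> / 2 + 2 * of_int s * x)"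

lemma norm_gauss_term:
  "norm (gauss_term \<tau> x s) = exp (- (pi * Im \<tau> / 2) * (real_of_int s)\<^sup>2 + 2 * Re x * real_of_int s)"
  by (simp add: gauss_term_def algebra_simps)

lemma norm_thterm:
  "norm (thterm \<tau> x n) = exp (- (pi * Im \<tau>) * (real_of_int n)\<^sup>2
     + (2 * Re x - pi * Im \<tau>) * real_of_int n + Re x) / 2"
  by (simp add: thterm_def norm_mult norm_divide algebra_simps power2_eq_square)

lemma gauss_term_summable:
  assumes "Im \<tau> > 0"
  shows "gauss_term \<tau> x summable_on UNIV"
proof (rule summable_on_int)
  show "summable (\<lambda>n. norm (gauss_term \<tau> x (int n)))"
    using summable_gaussian[of "pi * Im \<tau> / 2" "2 * Re x"] assms by (simp add: norm_gauss_term)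
  have "norm (gauss_term \<tau> x (- int n - 1)) =
      exp (- (pi * Im \<tau> / 2) - 2 * Re x) *
      exp (- (pi * Im \<tau> / 2) * real n ^ 2 + (- 2 * Re x - pi * Im \<tau>) * real n)" for n
    unfolding norm_gauss_term by (simp add: power2_eq_square algebra_simps flip: exp_add)
  then show "summable (\<lambda>n. norm (gauss_term \<tau> x (- int n - 1)))"
    using summable_gaussian[of "pi * Im \<tau> / 2" "- 2 * Re x - pi * Im \<tau>"] assms
    by (simp add: summable_mult)
qed

lemma thf_has_sum:
  assumes "Im \<tau> > 0"
  shows "(thterm \<tau> x has_sum thf \<tau> x) UNIV"
proof -
  have 1: "summable (\<lambda>n. norm (thterm \<tau> x (int n)))"
  proof -
    have "norm (thterm \<tau> x (int n)) = (exp (Re x) / 2) *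
       exp (- (pi * Im \<tau>) * real n ^ 2 + (2 * Re x - pi * Im \<tau>) * real n)" for n
      unfolding norm_thterm by (simp add: exp_add)
    then show ?thesis
      using summable_gaussian[of "pi * Im \<tau>" "2 * Re x - pi * Im \<tau>"] assms
      by (simp only: summable_mult mult_pos_pos pi_gt_zero)
  qed
  have 2: "summable (\<lambda>n. norm (thterm \<tau> x (- int n - 1)))"
  proof -
    have "norm (thterm \<tau> x (- int n - 1)) = (exp (- Re x) / 2) *
       exp (- (pi * Im \<tau>) * real n ^ 2 + (- 2 * Re x - pi * Im \<tau>) * real n)" for n
      unfolding norm_thterm by (simp add: power2_eq_square algebra_simps flip: exp_add)
    then show ?thesis
      using summable_gaussian[of "pi * Im \<tau>" "- 2 * Re x - pi * Im \<tau>"] assms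
      by (simp only: summable_mult mult_pos_pos pi_gt_zero)
  qed
  have t: "thterm \<tau> x (int n) + thterm \<tau> x (- int n - 1) =
     (-1) ^ n * exp (\<i> * of_nat (n * (n + 1)) * of_real pi * \<tau>) * sinh (of_nat (2 * n + 1) * x)"
         for n
  proof -
    have e: "(if even (int n) then 1 else - 1) = ((-1) ^ n :: complex)"
      "(if even (- int n - 1) then 1 else - 1) = (- ((-1) ^ n) :: complex)" by auto
    have a: "(- int n - 1) * (- int n - 1 + 1) = int n * (int n + 1)"
      "of_int (2 * (- int n - 1) + 1) * x = - (of_nat (2 * n + 1) * x)"
      by (simp_all add: algebra_simps)
    have b: "of_int (int n * (int n + 1)) = (of_nat (n * (n + 1)) :: complex)"
      "of_int (2 * int n + 1) = (of_nat (2 * n + 1) :: complex)" by (simp_all add: algebra_simps)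
    show ?thesis
      unfolding thterm_def e a b exp_add sinh_def scaleR_conv_of_real by (simp add: field_simps)
  qed
  have "(\<Sum>n. thterm \<tau> x (int n)) + (\<Sum>n. thterm \<tau> x (- int n - 1)) = thf \<tau> x"
    unfolding thf_def using suminf_add[OF summable_norm_cancel[OF 1] summable_norm_cancel[OF 2]] t
        by simp
  then show ?thesis
    using summable_on_int[OF 1 2] by (metis has_sum_infsum)
qed

lemma thf_odd: 
  assumes "Im \<tau> > 0"
  shows "thf \<tau> (- x) = - thf \<tau> x"
proof -
  have "((\<lambda>n. thterm \<tau> (- x) (- n - 1)) has_sum thf \<tau> (- x)) UNIV"
    using thf_has_sum[OF assms, of "- x"]
    by (subst has_sum_reindex_bij_betw[where g = "\<lambda>n. - n - 1" and f = "thterm \<tau> (- x)"])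
       (auto intro!: bij_betwI[where g = "\<lambda>n. - n - 1"])
  moreover have "thterm \<tau> (- x) (- n - 1) = - thterm \<tau> x n" for n
  proof -
    have "of_int ((- n - 1) * (- n - 1 + 1)) = (of_int (n * (n + 1)) :: complex)"
      "of_int (2 * (- n - 1) + 1) * (- x) = of_int (2 * n + 1) * x"
      by (simp_all add: algebra_simps)
    then show ?thesis unfolding thterm_def by auto
  qed
  ultimately have "((\<lambda>n. - thterm \<tau> x n) has_sum thf \<tau> (- x)) UNIV" by simp
  then show ?thesis
    using has_sum_uminus thf_has_sum[OF assms, of x] has_sum_unique by (metis minus_equation_iff)
qed

text \<open>
  In the double series of the product put \<open>s = m + n + 1\<close> and \<open>d = m - n\<close>, which have opposite parities;
  the summand then factorises.
\<close>

lemma thf_mult_split: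
  assumes "Im \<tau> > 0"
  obtains c and E O' :: "complex \<Rightarrow> complex" where
    "\<And>x y. thf \<tau> (x + y) * thf \<tau> (x - y) = c * (O' x * E y - E x * O' y)"
proof -
  define E where "E x = infsum (gauss_term \<tau> x) {s. even s}" for x
  define O' where "O' x = infsum (gauss_term \<tau> x) {s. odd s}" for x
  \<comment> \<open>The constant collects the two factors 1/2 of \<open>thterm\<close> and the -1 in
    m(m+1) + n(n+1) = ((m+n+1)^2 + (m-n)^2 - 1)/2.\<close>
  define c where "c = exp (- \<i> * of_real pi * \<tau> / 2) / 4"
  have sm: "gauss_term \<tau> x summable_on S" for x S
    using gauss_term_summable[OF assms] summable_on_subset_banach by blast
  have E: "(gauss_term \<tau> x has_sum E x) {s. even s}" for x
    unfolding E_def using sm by (rule has_sum_infsum)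
  have O: "(gauss_term \<tau> x has_sum O' x) {s. odd s}" for x
    unfolding O'_def using sm by (rule has_sum_infsum)
  have main: "thf \<tau> (x + y) * thf \<tau> (x - y) = c * (O' x * E y - E x * O' y)" for x y
  proof -
    let ?h = "\<lambda>(m, n). (m + n + 1, m - n :: int)"
    let ?X = "{s :: int. even s} \<times> {s :: int. odd s}" and ?Y =
        "{s :: int. odd s} \<times> {s :: int. even s}"
    let ?G = "\<lambda>(s, d). (if even s then - c else c) * (gauss_term \<tau> x s * gauss_term \<tau> y d)"
    have p: "((\<lambda>(m, n). thterm \<tau> (x + y) m * thterm \<tau> (x - y) n) has_sum
        thf \<tau> (x + y) * thf \<tau> (x - y)) (UNIV \<times> UNIV)"
      by (intro has_sum_times_complex thf_has_sum assms)
    have q: "thterm \<tau> (x + y) m * thterm \<tau> (x - y) n = ?G (?h (m, n))" for m n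
    proof -
      have 1: "(if even m then 1 else - 1) * (if even n then 1 else - 1) =
           (if even (m + n + 1) then - 1 else (1 :: complex))" by auto
      have 2: "(\<i> * of_int (m * (m + 1)) * of_real pi * \<tau> + of_int (2 * m + 1) * (x + y)) +
           (\<i> * of_int (n * (n + 1)) * of_real pi * \<tau> + of_int (2 * n + 1) * (x - y)) =
          - \<i> * of_real pi * \<tau> / 2 +
         ((\<i> * of_int ((m + n + 1)\<^sup>2) * of_real pi * \<tau> / 2 + 2 * of_int (m + n + 1) * x) +
          (\<i> * of_int ((m - n)\<^sup>2) * of_real pi * \<tau> / 2 + 2 * of_int (m - n) * y))"
        by (simp add: field_simps power2_eq_square)
      have "thterm \<tau> (x + y) m * thterm \<tau> (x - y) n =
         ((if even m then 1 else - 1) * (if even n then 1 else - 1)) *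
         exp ((\<i> * of_int (m * (m + 1)) * of_real pi * \<tau> + of_int (2 * m + 1) * (x + y)) +
           (\<i> * of_int (n * (n + 1)) * of_real pi * \<tau> + of_int (2 * n + 1) * (x - y))) / 4"
        unfolding thterm_def exp_add by simp
      also have "\<dots> = ?G (?h (m, n))"
        unfolding 1 2 unfolding exp_add c_def gauss_term_def by simp
      finally show ?thesis .
    qed
    have par: "odd (m - n) \<longleftrightarrow> even (m + n + 1)" for m n :: int by simp
    have bij: "bij_betw ?h (UNIV \<times> UNIV) (?X \<union> ?Y)"
    proof (rule bij_betwI[where g = "\<lambda>(s, d). ((s + d - 1) div 2, (s - d - 1) div 2)"])
      show "?h \<in> UNIV \<times> UNIV \<rightarrow> ?X \<union> ?Y" using par by auto
      show "?h ((\<lambda>(s, d). ((s + d - 1) div 2, (s - d - 1) div 2)) z) = z" if "z \<in> ?X \<union> ?Y" for z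
      proof -
        obtain s d where z: "z = (s, d)" by (cases z)
        have "even (s + d - 1)" "even (s - d - 1)" using that z by auto
        then obtain i j where "s + d - 1 = 2 * i" "s - d - 1 = 2 * j" by (elim evenE)
        then show ?thesis unfolding z by auto
      qed
    qed auto
    have "((\<lambda>z. ?G (?h z)) has_sum thf \<tau> (x + y) * thf \<tau> (x - y)) (UNIV \<times> UNIV)"
      using p by (rule has_sum_cong[THEN iffD1, rotated]) (use q in auto)
    then have r: "(?G has_sum thf \<tau> (x + y) * thf \<tau> (x - y)) (?X \<union> ?Y)"
      using has_sum_reindex_bij_betw[OF bij, of ?G] by simp
    have "(?G has_sum (- c * (E x * O' y))) ?X"
      by (rule has_sum_cong[THEN iffD1, OF _ has_sum_cmult_right[OF
          has_sum_times_complex[OF E O]]]) auto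
    moreover have "(?G has_sum (c * (O' x * E y))) ?Y"
      by (rule has_sum_cong[THEN iffD1, OF _ has_sum_cmult_right[OF
          has_sum_times_complex[OF O E]]]) auto
    ultimately have "(?G has_sum (- c * (E x * O' y) + c * (O' x * E y))) (?X \<union> ?Y)"
      by (rule has_sum_Un_disjoint) auto
    with r show ?thesis
      using has_sum_unique by (fastforce simp: algebra_simps)
  qed
  then show thesis using that by blast
qed

text \<open>Each product of two factors is a multiple of a 2x2 minor with columns (O' x, E x), (O'
  y, E y); the identity is the Pluecker relation between the six minors of a 2x4 matrix.\<close>

lemma thf_three_term:
  assumes "Im \<tau> > 0"
  shows "thf \<tau> (x + y) * thf \<tau> (x - y) * thf \<tau> (z + w) * thf \<tau> (z - w)
       - thf \<tau> (x + z) * thf \<tau> (x - z) * thf \<tau> (y + w) * thf \<tau> (y - w)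
       + thf \<tau> (x + w) * thf \<tau> (x - w) * thf \<tau> (y + z) * thf \<tau> (y - z) = 0"
proof -
  obtain c E O' where
    *: "\<And>x y. thf \<tau> (x + y) * thf \<tau> (x - y) = c * (O' x * E y - E x * O' y)"
    using thf_mult_split[OF assms] by metis
  have "thf \<tau> (x + y) * thf \<tau> (x - y) * (thf \<tau> (z + w) * thf \<tau> (z - w))
       - thf \<tau> (x + z) * thf \<tau> (x - z) * (thf \<tau> (y + w) * thf \<tau> (y - w))
       + thf \<tau> (x + w) * thf \<tau> (x - w) * (thf \<tau> (y + z) * thf \<tau> (y - z)) = 0"
    unfolding * by (simp add: algebra_simps)
  then show ?thesis by (simp add: mult.assoc)
qed

lemma thf_holomorphic:
  assumes "Im \<tau> > 0"
  shows "thf \<tau> holomorphic_on UNIV"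
proof (rule holomorphic_uniform_sequence)
  let ?t = "\<lambda>n x. (-1) ^ n * exp (\<i> * of_nat (n * (n + 1)) * of_real pi * \<tau>)
                      * sinh (of_nat (2 * n + 1) * x)"
  show "(\<lambda>x. \<Sum>i<n. ?t i x) holomorphic_on UNIV" for n
    unfolding sinh_def scaleR_conv_of_real by (intro holomorphic_intros)
  fix x0 :: complex
  define r where "r = norm x0 + 1"
  \<comment> \<open>On the unit ball |Re x| is at most r, so the sinh factor is at most exp((2n+1)
    r); the Gaussian factor exp(-pi Im(tau) n(n+1)) dominates it.\<close>
  define M where "M n = exp r * exp (- (pi * Im \<tau>) * real n ^ 2 + (2 * r - pi * Im \<tau>) * real n)"
      for n
  have "uniform_limit (cball x0 1) (\<lambda>n x. \<Sum>i<n. ?t i x) (\<lambda>x. \<Sum>i. ?t i x) sequentially"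
  proof (rule Weierstrass_m_test)
    show "summable M"
      unfolding M_def using summable_gaussian[of "pi * Im \<tau>" "2 * r - pi * Im \<tau>"] assms
      by (simp only: summable_mult mult_pos_pos pi_gt_zero)
    fix n x assume "x \<in> cball x0 1"
    then have "norm x \<le> r"
      unfolding r_def by (metis add.commute dist_commute dist_norm mem_cball norm_triangle_sub
          add_left_mono order_trans)
    have "norm (sinh (of_nat (2 * n + 1) * x)) \<le> exp (real (2 * n + 1) * r)"
    proof -
      have "Re (of_nat (2 * n + 1) * x) = real (2 * n + 1) * Re x"
        by simp
      then have 1: "norm (exp (of_nat (2 * n + 1) * x)) \<le> exp (real (2 * n + 1) * r)"
        "norm (exp (- (of_nat (2 * n + 1) * x))) \<le> exp (real (2 * n + 1) * r)"
        using mult_left_mono[of "Re x" r "real (2 * n + 1)"]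
            mult_left_mono[of "- Re x" r "real (2 * n + 1)"]
          \<open>norm x \<le> r\<close> abs_Re_le_cmod[of x] by
              (auto simp only: norm_exp_eq_Re exp_le_cancel_iff uminus_complex.sel mult_minus_right)
      have "norm (sinh (of_nat (2 * n + 1) * x)) \<le>
          (norm (exp (of_nat (2 * n + 1) * x)) + norm (exp (- (of_nat (2 * n + 1) * x)))) / 2"
        unfolding sinh_def norm_scaleR
        using norm_triangle_ineq4[of "exp (of_nat (2 * n + 1) * x)"
            "exp (- (of_nat (2 * n + 1) * x))"]
        by (simp del: norm_exp_eq_Re)
      moreover have "(a + b) / 2 \<le> c" if "a \<le> c" "b \<le> c" for a b c :: real
        using that by simp
      ultimately show ?thesis using 1 order_trans by blast
    qed
    moreover have "norm ((-1) ^ n * exp (\<i> * of_nat (n * (n + 1)) * of_real pi * \<tau>)) =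
        exp (- (pi * Im \<tau>) * real (n * (n + 1)))"
      by (simp add: norm_mult norm_power algebra_simps)
    ultimately have "norm (?t n x) \<le>
        exp (- (pi * Im \<tau>) * real (n * (n + 1))) * exp (real (2 * n + 1) * r)"
      by (simp only: norm_mult[of _ "sinh _"]) (rule mult_left_mono, auto)
    also have "\<dots> = M n"
      unfolding M_def by (simp add: power2_eq_square algebra_simps flip: exp_add)
    finally show "norm (?t n x) \<le> M n" .
  qed
  then show "\<exists>d>0. cball x0 d \<subseteq> UNIV \<and>
      uniform_limit (cball x0 d) (\<lambda>n x. \<Sum>i<n. ?t i x) (thf \<tau>) sequentially"
    by (intro exI[of _ 1]) (auto simp: thf_def[abs_def])
qed auto

section \<open>The dynamical Yang-Baxter equation\<close>

locale sos =
  fixes \<tau> \<gamma> \<theta> \<zeta> :: complex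
  assumes Im_pos: "Im \<tau> > 0"
begin

abbreviation f :: "complex \<Rightarrow> complex" where "f \<equiv> thf \<tau>"

lemma f_cong: "x = y \<Longrightarrow> f x = f y" by simp

lemma f_cong_minus: "x = - y \<Longrightarrow> f x = - f y" using thf_odd[OF Im_pos] by simp

lemma f_cong_0: "x = 0 \<Longrightarrow> f x = 0" using thf_odd[OF Im_pos, of 0] by simp

text \<open>Used with backtracking to normalise arguments: each value becomes \<open>f z\<close>,
  \<open>- f z\<close> or 0, whichever linear arithmetic can justify. Oddness thus never has to be
  invoked by hand in the scalar identities.\<close>

lemmas f_congs = f_cong f_cong_minus f_cong_0

text \<open>The symmetric form of the identity, in which no half-arguments occur.\<close>

lemma f_three_term_inst:
  assumes S: "A + B + C + D = 2 * S"
    and "f A = a" "f B = b" "f C = c" "f D = d"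
    and "f S = p1" "f (A + B - S) = p2" "f (A + C - S) = p3" "f (A + D - S) = p4"
    and "f (S - A) = q1" "f (S - B) = q2" "f (S - C) = q3" "f (S - D) = q4"
  shows "a * b * c * d = p1 * p2 * p3 * p4 + q1 * q2 * q3 * q4"
proof -
  have D: "D = 2 * S - A - B - C" using S by algebra
  have q1: "f (A - S) = - q1"
    using f_cong_minus[of "A - S" "S - A"] assms by simp
  have e: "(A + B) / 2 + (A - B) / 2 = A" "(A + B) / 2 - (A - B) / 2 = B"
    "(C + D) / 2 + (C - D) / 2 = C" "(C + D) / 2 - (C - D) / 2 = D"
    "(A + B) / 2 + (C + D) / 2 = S" "(A + B) / 2 - (C + D) / 2 = A + B - S"
    "(A - B) / 2 + (C - D) / 2 = A + C - S" "(A - B) / 2 - (C - D) / 2 = A + D - S"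
    "(A + B) / 2 + (C - D) / 2 = S - D" "(A + B) / 2 - (C - D) / 2 = S - C"
    "(A - B) / 2 + (C + D) / 2 = S - B" "(A - B) / 2 - (C + D) / 2 = A - S"
    unfolding D by (simp_all add: field_simps)
  show ?thesis
    using thf_three_term[OF Im_pos, of "(A + B) / 2" "(A - B) / 2" "(C + D) / 2" "(C - D) / 2"]
    unfolding e assms(2-) q1 by (simp add: algebra_simps)
qed

definition Ra :: "complex \<Rightarrow> complex" where "Ra l = f (l + \<gamma>)"
definition Rbp :: "complex \<Rightarrow> complex \<Rightarrow> complex" where "Rbp l t = f l * f (t - \<gamma>) / f t"
definition Rbm :: "complex \<Rightarrow> complex \<Rightarrow> complex" where "Rbm l t = f l * f (t + \<gamma>) / f t"
definition Rcp :: "complex \<Rightarrow> complex \<Rightarrow> complex" where "Rcp l t = f (t - l) * f \<gamma> / f t"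
definition Rcm :: "complex \<Rightarrow> complex \<Rightarrow> complex" where "Rcm l t = f (t + l) * f \<gamma> / f t"

abbreviation R :: "complex \<Rightarrow> complex \<Rightarrow> bool \<Rightarrow> bool \<Rightarrow> bool \<Rightarrow> bool \<Rightarrow> complex" where
  "R \<equiv> Rent \<tau> \<gamma>"

lemma R_entries:
  "R l t True True True True = Ra l" "R l t False False False False = Ra l"
  "R l t True False True False = Rbp l t" "R l t False True False True = Rbm l t"
  "R l t True False False True = Rcp l t" "R l t False True True False = Rcm l t"
  "R l t True True True False = 0" "R l t True True False b = 0"
  "R l t False False False True = 0" "R l t False False True b = 0"
  "R l t True False True True = 0" "R l t True False False False = 0"
  "R l t False True True True = 0" "R l t False True False False = 0"
  by (auto simp: Rent_def Ra_def Rbp_def Rbm_def Rcp_def Rcm_def)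

lemma entries_uminus:
  "Rbp l (- t) = Rbm l t" "Rbm l (- t) = Rbp l t" "Rcp l (- t) = Rcm l t" "Rcm l (- t) = Rcp l t"
proof -
  have 1: "f (- t) = - f t" "f (- t - \<gamma>) = - f (t + \<gamma>)" "f (- t + \<gamma>) = - f (t - \<gamma>)"
    "f (- t - l) = - f (t + l)" "f (- t + l) = - f (t - l)"
    by (auto intro!: f_cong_minus)
  show "Rbp l (- t) = Rbm l t" "Rbm l (- t) = Rbp l t" "Rcp l (- t) = Rcm l t" "Rcm l (- t) =
      Rcp l t"
    unfolding Rbp_def Rbm_def Rcp_def Rcm_def 1 by auto
qed

text \<open>Reversing all spins amounts to reversing the dynamical parameter. This symmetry halves
  the case analysis of the Yang-Baxter equation and, in the form of the entries, that of
  crossing.\<close>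

lemma R_flip: "R l (- t) (\<not> a) (\<not> b) (\<not> c) (\<not> d) = R l t a b c d"
  by (cases a; cases b; cases c; cases d) (simp_all add: R_entries entries_uminus)

text \<open>
  In the names of the scalar identities \<open>p\<close> and \<open>m\<close> stand for the spins of the outgoing and of the incoming legs.
\<close>

lemma ybe_ppm_ppm:
  assumes nz: "f t \<noteq> 0" "f (t - \<gamma>) \<noteq> 0"
  shows "Ra u * Rbp (u + v) t * Rbp v (t - \<gamma>) = Rbp v t * Rbp (u + v) (t - \<gamma>) * Ra u"
proof -
  have eqs: "f (t - \<gamma> - \<gamma>) = f (t - 2 * \<gamma>)"
    by ((rule f_congs, simp add: algebra_simps)+)
  show ?thesis using nz unfolding Ra_def Rbp_def eqs
    by (simp add: divide_simps)
qed

lemma ybe_ppm_pmp: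
  assumes nz: "f t \<noteq> 0" "f (t - \<gamma>) \<noteq> 0"
  shows "Ra u * Rbp (u + v) t * Rcp v (t - \<gamma>) = Rcp v t * Ra (u + v) * Rbp u t + Rbp v t *
      Rcp (u + v) (t - \<gamma>) * Rcm u t"
proof -
  have eqs: "f (t - \<gamma> - v) = f (t - v - \<gamma>)"
    "f (t - \<gamma> - (u + v)) = f (t - u - v - \<gamma>)"
    by ((rule f_congs, simp add: algebra_simps)+)
  have e0: "f (u + \<gamma>) * f (u + v) * f (t - v - \<gamma>) * f t
      = f (t + u) * (- f (t - u - v - \<gamma>)) * (- f v) * f \<gamma>
      + f (t - \<gamma>) * f (t - v) * f (u + v + \<gamma>) * f u"
    by (rule f_three_term_inst[of "u + \<gamma>" "u + v" "t - v - \<gamma>" "t" "t + u"])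
      ((rule f_congs | simp add: algebra_simps)+)
  show ?thesis using e0 nz unfolding Ra_def Rbp_def Rcp_def Rcm_def eqs
    by (simp add: divide_simps) algebra
qed

lemma ybe_ppm_mpp:
  assumes nz: "f t \<noteq> 0" "f (t - \<gamma>) \<noteq> 0"
  shows "Ra u * Rcp (u + v) t * Ra v = Rcp v t * Ra (u + v) * Rcp u t + Rbp v t *
      Rcp (u + v) (t - \<gamma>) * Rbm u t"
proof -
  have eqs: "f (t - (u + v)) = f (t - u - v)"
    "f (t - \<gamma> - (u + v)) = f (t - u - v - \<gamma>)"
    by ((rule f_congs, simp add: algebra_simps)+)
  have e0: "f (v + \<gamma>) * f (u + \<gamma>) * f (t - u - v) * f t
      = f (t + \<gamma>) * (- f (t - u - v - \<gamma>)) * (- f u) * f v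
      + f (t - v) * f (t - u) * f (u + v + \<gamma>) * f \<gamma>"
    by (rule f_three_term_inst[of "v + \<gamma>" "u + \<gamma>" "t - u - v" "t" "t + \<gamma>"])
      ((rule f_congs | simp add: algebra_simps)+)
  show ?thesis using e0 nz unfolding Ra_def Rcp_def Rbp_def Rbm_def eqs
    by (simp add: divide_simps) algebra
qed

lemma ybe_pmp_ppm:
  assumes nz: "f t \<noteq> 0" "f (t - \<gamma>) \<noteq> 0"
  shows "Rcp u (t - \<gamma>) * Rcm (u + v) t * Rbp v (t - \<gamma>) + Rbp u (t - \<gamma>) * Ra (u + v) *
      Rcm v (t - \<gamma>) = Rcm v t * Rbp (u + v) (t - \<gamma>) * Ra u"
proof -
  have eqs: "f (t - \<gamma> - u) = f (t - u - \<gamma>)" "f (t + (u + v)) = f (t + u + v)"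
    "f (t - \<gamma> - \<gamma>) = f (t - 2 * \<gamma>)"
    "f (t - \<gamma> + v) = f (t + v - \<gamma>)"
    by ((rule f_congs, simp add: algebra_simps)+)
  have e0: "f \<gamma> * f v * f (t - u - \<gamma>) * f (t + u + v)
      = f (t + v) * (- f (t - \<gamma>)) * (- f (u + v)) * f (u + \<gamma>)
      + f (t + v - \<gamma>) * f t * f (u + v + \<gamma>) * (- f u)"
    by (rule f_three_term_inst[of "\<gamma>" "v" "t - u - \<gamma>" "t + u + v" "t + v"])
      ((rule f_congs | simp add: algebra_simps)+)
  show ?thesis using e0 nz unfolding Rcp_def Rcm_def Rbp_def Ra_def eqs
    by (simp add: divide_simps) algebra
qed

lemma ybe_pmp_pmp:
  assumes nz: "f t \<noteq> 0" "f (t - \<gamma>) \<noteq> 0"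
  shows "Rcp u (t - \<gamma>) * Rcm (u + v) t * Rcp v (t - \<gamma>) + Rbp u (t - \<gamma>) * Ra (u + v) *
      Rbm v (t - \<gamma>) = Rbm v t * Ra (u + v) * Rbp u t + Rcm v t * Rcp (u + v) (t - \<gamma>) * Rcm u t"
proof -
  have eqs: "f (t - \<gamma> - u) = f (t - u - \<gamma>)" "f (t + (u + v)) = f (t + u + v)"
    "f (t - \<gamma> - v) = f (t - v - \<gamma>)"
    "f (t - \<gamma> - \<gamma>) = f (t - 2 * \<gamma>)" "f (t - \<gamma> + \<gamma>) = f t"
    "f (t - \<gamma> - (u + v)) = f (t - u - v - \<gamma>)"
    by ((rule f_congs, simp add: algebra_simps)+)
  have e0: "f (t - u - \<gamma>) * f (t - v - \<gamma>) * f t * f (t + u + v)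
      = f (2 * t - \<gamma>) * (- f (u + v + \<gamma>)) * (- f u) * f v
      + f (t + u) * f (t + v) * f (t - \<gamma>) * f (t - u - v - \<gamma>)"
    by (rule f_three_term_inst[of "t - u - \<gamma>" "t - v - \<gamma>" "t" "t + u + v" "2 * t - \<gamma>"])
      ((rule f_congs | simp add: algebra_simps)+)
  \<comment> \<open>The product f(2t - gamma) appears in no entry. It is common to both instances of
    the three-term identity, and multiplying \<open>e0\<close> by f(gamma)^3 and \<open>e1\<close>
    by f(u) f(v) f(u+v+gamma) makes it cancel.\<close>
  have e1: "f (t - 2 * \<gamma>) * f t * f t * f t
      = f (2 * t - \<gamma>) * (- f \<gamma>) * (- f \<gamma>) * (- f \<gamma>)
      + f (t + \<gamma>) * f (t - \<gamma>) * f (t - \<gamma>) * f (t - \<gamma>)"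
    by (rule f_three_term_inst[of "t - 2 * \<gamma>" "t" "t" "t" "2 * t - \<gamma>"])
      ((rule f_congs | simp add: algebra_simps)+)
  show ?thesis using e0 e1 nz unfolding Rcp_def Rcm_def Rbp_def Ra_def Rbm_def eqs
    by (simp add: divide_simps) algebra
qed

lemma ybe_pmp_mpp:
  assumes nz: "f t \<noteq> 0" "f (t - \<gamma>) \<noteq> 0"
  shows "Rcp u (t - \<gamma>) * Rbm (u + v) t * Ra v = Rbm v t * Ra (u + v) * Rcp u t + Rcm v t *
      Rcp (u + v) (t - \<gamma>) * Rbm u t"
proof -
  have eqs: "f (t - \<gamma> - u) = f (t - u - \<gamma>)"
    "f (t - \<gamma> - (u + v)) = f (t - u - v - \<gamma>)"
    by ((rule f_congs, simp add: algebra_simps)+)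
  have e0: "f (v + \<gamma>) * f (u + v) * f (t - u - \<gamma>) * f t
      = f (t + v) * (- f (t - u - v - \<gamma>)) * (- f u) * f \<gamma>
      + f (t - \<gamma>) * f (t - u) * f (u + v + \<gamma>) * f v"
    by (rule f_three_term_inst[of "v + \<gamma>" "u + v" "t - u - \<gamma>" "t" "t + v"])
      ((rule f_congs | simp add: algebra_simps)+)
  show ?thesis using e0 nz unfolding Rcp_def Rbm_def Ra_def Rcm_def eqs
    by (simp add: divide_simps) algebra
qed

lemma ybe_mpp_ppm:
  assumes nz: "f t \<noteq> 0" "f (t - \<gamma>) \<noteq> 0"
  shows "Rbm u (t - \<gamma>) * Rcm (u + v) t * Rbp v (t - \<gamma>) + Rcm u (t - \<gamma>) * Ra (u + v) *
      Rcm v (t - \<gamma>) = Ra v * Rcm (u + v) (t - \<gamma>) * Ra u"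
proof -
  have eqs: "f (t - \<gamma> + \<gamma>) = f t" "f (t + (u + v)) = f (t + u + v)"
    "f (t - \<gamma> - \<gamma>) = f (t - 2 * \<gamma>)"
    "f (t - \<gamma> + u) = f (t + u - \<gamma>)" "f (t - \<gamma> + v) = f (t + v - \<gamma>)"
    "f (t - \<gamma> + (u + v)) = f (t + u + v - \<gamma>)"
    by ((rule f_congs, simp add: algebra_simps)+)
  have e0: "f v * f u * f (t - 2 * \<gamma>) * f (t + u + v)
      = f (t + u + v - \<gamma>) * (- f (t - \<gamma>)) * (- f (u + \<gamma>)) * f (v + \<gamma>)
      + f (t + u - \<gamma>) * f (t + v - \<gamma>) * f (u + v + \<gamma>) * (- f \<gamma>)"
    by (rule f_three_term_inst[of "v" "u" "t - 2 * \<gamma>" "t + u + v" "t + u + v - \<gamma>"])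
      ((rule f_congs | simp add: algebra_simps)+)
  show ?thesis using e0 nz unfolding Rbm_def Rcm_def Rbp_def Ra_def eqs
    by (simp add: divide_simps) algebra
qed

lemma ybe_mpp_pmp:
  assumes nz: "f t \<noteq> 0" "f (t - \<gamma>) \<noteq> 0"
  shows "Rbm u (t - \<gamma>) * Rcm (u + v) t * Rcp v (t - \<gamma>) + Rcm u (t - \<gamma>) * Ra (u + v) *
      Rbm v (t - \<gamma>) = Ra v * Rbm (u + v) (t - \<gamma>) * Rcm u t"
proof -
  have eqs: "f (t - \<gamma> + \<gamma>) = f t" "f (t + (u + v)) = f (t + u + v)"
    "f (t - \<gamma> - v) = f (t - v - \<gamma>)" "f (t - \<gamma> + u) = f (t + u - \<gamma>)"
    by ((rule f_congs, simp add: algebra_simps)+)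
  have e0: "f \<gamma> * f u * f (t - v - \<gamma>) * f (t + u + v)
      = f (t + u) * (- f (t - \<gamma>)) * (- f (u + v)) * f (v + \<gamma>)
      + f (t + u - \<gamma>) * f t * f (u + v + \<gamma>) * (- f v)"
    by (rule f_three_term_inst[of "\<gamma>" "u" "t - v - \<gamma>" "t + u + v" "t + u"])
      ((rule f_congs | simp add: algebra_simps)+)
  show ?thesis using e0 nz unfolding Rbm_def Rcm_def Rcp_def Ra_def eqs
    by (simp add: divide_simps) algebra
qed

lemma ybe_mpp_mpp:
  assumes nz: "f t \<noteq> 0" "f (t - \<gamma>) \<noteq> 0"
  shows "Rbm u (t - \<gamma>) * Rbm (u + v) t * Ra v = Ra v * Rbm (u + v) (t - \<gamma>) * Rbm u t"
proof -
  have eqs: "f (t - \<gamma> + \<gamma>) = f t"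
    by ((rule f_congs, simp add: algebra_simps)+)
  show ?thesis using nz unfolding Rbm_def Ra_def eqs
    by (simp add: divide_simps)
qed

definition h :: "bool \<Rightarrow> int" where "h b = (if b then 1 else - 1)"

lemma h_simps [simp]: "h True = 1" "h False = - 1" by (simp_all add: h_def)

lemma h_not: "h (\<not> b) = - h b" by (simp add: h_def)

text \<open>By the ice rule both sides vanish unless the weights of outgoing and incoming spins
  agree. For positive weight this leaves the trivial all-up entry and the nine entries with one spin
  down on each side, which are the identities just proved.\<close>

lemma ybe_half:
  assumes "f t \<noteq> 0" "f (t - \<gamma>) \<noteq> 0" "f (t + \<gamma>) \<noteq> 0" and "h a + h b + h c > 0"
  shows "(\<Sum>p\<in>UNIV. \<Sum>q\<in>UNIV. \<Sum>r\<in>UNIV. R u (t - \<gamma> * of_int (h c)) a b p q * R (u + v) t p c a' r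
            * R v (t - \<gamma> * of_int (h a')) q r b' c') =
         (\<Sum>q\<in>UNIV. \<Sum>r\<in>UNIV. \<Sum>p\<in>UNIV. R v t b c q r * R (u + v) (t - \<gamma> * of_int (h q)) a r p c'
            * R u t p q a' b')"
proof -
  note y = ybe_ppm_ppm ybe_ppm_pmp ybe_ppm_mpp ybe_pmp_ppm ybe_pmp_pmp ybe_pmp_mpp ybe_mpp_ppm
      ybe_mpp_pmp ybe_mpp_mpp
  show ?thesis
    using assms(4)
    by (cases a; cases b; cases c; cases a'; cases b'; cases c')
       (simp_all add: UNIV_bool R_entries y[OF assms(1,2)])
qed

text \<open>In operator form: R12(u, t - gamma h3) R13(u+v, t) R23(v, t - gamma h1) = R23(v, t)
  R13(u+v, t - gamma h2) R12(u, t). An operator shift is read off from a spin which that R-matrix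
  leaves unchanged.\<close>

lemma dynamical_ybe:
  assumes "f t \<noteq> 0" "f (t - \<gamma>) \<noteq> 0" "f (t + \<gamma>) \<noteq> 0"
  shows "(\<Sum>p\<in>UNIV. \<Sum>q\<in>UNIV. \<Sum>r\<in>UNIV. R u (t - \<gamma> * of_int (h c)) a b p q * R (u + v) t p c a' r
            * R v (t - \<gamma> * of_int (h a')) q r b' c') =
         (\<Sum>q\<in>UNIV. \<Sum>r\<in>UNIV. \<Sum>p\<in>UNIV. R v t b c q r * R (u + v) (t - \<gamma> * of_int (h q)) a r p c'
            * R u t p q a' b')"
proof (cases "h a + h b + h c > 0")
  case True
  then show ?thesis using ybe_half assms by blast
next
  case False
  have n: "f (- t) \<noteq> 0" "f (- t - \<gamma>) \<noteq> 0" "f (- t + \<gamma>) \<noteq> 0"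
    using assms f_cong_minus[of "- t" t] f_cong_minus[of "- t - \<gamma>" "t + \<gamma>"]
      f_cong_minus[of "- t + \<gamma>" "t - \<gamma>"] by auto
  have flip: "R l (- t - \<gamma> * of_int (h (\<not> p))) (\<not> a) (\<not> b) (\<not> c) (\<not> d) =
      R l (t - \<gamma> * of_int (h p)) a b c d" for l p a b c d
    using R_flip[of l "t - \<gamma> * of_int (h p)"] by (simp add: h_not algebra_simps)
  have sum_not: "(\<Sum>p\<in>UNIV. F (\<not> p)) = (\<Sum>p\<in>UNIV. F p)" for F :: "bool \<Rightarrow> complex"
    by (simp add: UNIV_bool)
  have "h (\<not> a) + h (\<not> b) + h (\<not> c) > 0" using False by (auto simp: h_def split: if_splits)
  from ybe_half[OF n this, of u v "\<not> a'" "\<not> b'" "\<not> c'"]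
  show ?thesis
    \<comment> \<open>All six summation variables are negated, so that every entry in the flipped
      identity becomes a full spin reversal.\<close>
    apply (subst (asm) (1 2 3 4 5 6) sum_not[symmetric])
    apply (simp only: flip R_flip)
    done
qed

section \<open>Double-row monodromy and reflection equation\<close>

lemma unit_pm:
  assumes nz: "f t \<noteq> 0"
  shows "Rbp x t * Rbm (- x) t + Rcp x t * Rcp (- x) t = f (x + \<gamma>) * f (\<gamma> - x)"
proof -
  have eqs: "f (- x) = (- f x)" "f (t - (- x)) = f (t + x)"
    "f (\<gamma> - x) = (- f (x - \<gamma>))"
    by ((rule f_congs, simp add: algebra_simps)+)
  have e0: "f x * f x * f (t - \<gamma>) * f (t + \<gamma>)
      = f (t + x) * (- f (t - x)) * (- f \<gamma>) * f \<gamma>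
      + f t * f t * f (x + \<gamma>) * f (x - \<gamma>)"
    by (rule f_three_term_inst[of "x" "x" "t - \<gamma>" "t + \<gamma>" "t + x"])
      ((rule f_congs | simp add: algebra_simps)+)
  show ?thesis using e0 nz unfolding Rbp_def Rbm_def Rcp_def eqs
    by (simp add: divide_simps) algebra
qed

text \<open>Collect the terms by the factors of the boundary matrix in x. In each of the two groups
  the difference of left and right side is one instance of the three-term identity, leaving a
  multiple of f(t) f(2y); the two multiples are opposite. The same holds for the other
  component.\<close>

lemma refl_pm:
  assumes nz: "f t \<noteq> 0"
  shows "Rbp (x - y) t * f (z + x) * f (t + z - x) * Rcm (x + y) t * f (z + y) * f (t + z - y) +
      Rcp (x - y) t * f (z - x) * f (t + z + x) * Rbp (x + y) t * f (z + y) * f (t + z - y) =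
      f (z - y) * f (t + z + y) * Rbp (x + y) t * f (z + x) * f (t + z - x) * Rcm (x - y) t +
      f (z - y) * f (t + z + y) * Rcp (x + y) t * f (z - x) * f (t + z + x) * Rbp (x - y) t"
proof -
  have eqs: "f (t + (x + y)) = f (t + x + y)" "f (t - (x - y)) = f (t + y - x)"
    "f (t + (x - y)) = f (t + x - y)" "f (t - (x + y)) = f (t - x - y)"
    by ((rule f_congs, simp add: algebra_simps)+)
  have e0: "f (x - y) * f (z + y) * f (t + x + y) * f (t + z - y)
      = f (t + z + x) * (- f t) * (- f (z - x)) * (- f (2 * y))
      + f (t + z + y) * f (t + x - y) * f (z - y) * f (x + y)"
    by (rule f_three_term_inst[of "x - y" "z + y" "t + x + y" "t + z - y" "t + z + x"])
      ((rule f_congs | simp add: algebra_simps)+)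
  have e1: "f (x + y) * f (z + y) * f (t + y - x) * f (t + z - y)
      = f (t + z + y) * (- f (t - x - y)) * (- f (z - y)) * f (x - y)
      + f (t + z - x) * f t * f (z + x) * f (2 * y)"
    by (rule f_three_term_inst[of "x + y" "z + y" "t + y - x" "t + z - y" "t + z + y"])
      ((rule f_congs | simp add: algebra_simps)+)
  show ?thesis using e0 e1 nz unfolding Rbp_def Rcm_def Rcp_def eqs
    by (simp add: divide_simps) algebra
qed

lemma refl_mp:
  assumes nz: "f t \<noteq> 0"
  shows "Rbm (x - y) t * f (z - x) * f (t + z + x) * Rcp (x + y) t * f (z - y) * f (t + z + y) +
      Rcm (x - y) t * f (z + x) * f (t + z - x) * Rbm (x + y) t * f (z - y) * f (t + z + y) =
      f (z + y) * f (t + z - y) * Rbm (x + y) t * f (z - x) * f (t + z + x) * Rcp (x - y) t +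
      f (z + y) * f (t + z - y) * Rcm (x + y) t * f (z + x) * f (t + z - x) * Rbm (x - y) t"
proof -
  have eqs: "f (t - (x + y)) = f (t - x - y)" "f (t + (x - y)) = f (t + x - y)"
    "f (t - (x - y)) = f (t + y - x)" "f (t + (x + y)) = f (t + x + y)"
    by ((rule f_congs, simp add: algebra_simps)+)
  have e0: "f (x - y) * f (z - y) * f (t - x - y) * f (t + z + y)
      = f (t + z - y) * (- f (t + y - x)) * (- f (z + y)) * f (x + y)
      + f (t + z - x) * f t * f (z + x) * (- f (2 * y))"
    by (rule f_three_term_inst[of "x - y" "z - y" "t - x - y" "t + z + y" "t + z - y"])
      ((rule f_congs | simp add: algebra_simps)+)
  have e1: "f (x + y) * f (z - y) * f (t + x - y) * f (t + z + y)
      = f (t + z + x) * (- f t) * (- f (z - x)) * f (2 * y)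
      + f (t + z - y) * f (t + x + y) * f (z + y) * f (x - y)"
    by (rule f_three_term_inst[of "x + y" "z - y" "t + x - y" "t + z + y" "t + z + x"])
      ((rule f_congs | simp add: algebra_simps)+)
  show ?thesis using e0 e1 nz unfolding Rbm_def Rcp_def Rcm_def eqs
    by (simp add: divide_simps) algebra
qed

lemma R_ice: "h a + h b \<noteq> h c + h d \<Longrightarrow> R l t a b c d = 0"
  by (cases a; cases b; cases c; cases d) (simp_all add: R_entries)

lemma R_ice_cong:
  "(h a + h b = h c + h d \<Longrightarrow> x = y) \<Longrightarrow> R l t a b c d * x = R l t a b c d * y"
  using R_ice by (metis mult_zero_left)

lemma R_unitary:
  assumes "f t \<noteq> 0"
  shows "(\<Sum>p\<in>UNIV. \<Sum>q\<in>UNIV. R x t a b p q * R (- x) t q p b' a') =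
    (if a' = a \<and> b' = b then f (\<gamma> + x) * f (\<gamma> - x) else 0)"
proof -
  have n: "f (- t) \<noteq> 0" using assms f_cong_minus[of "- t" t] by auto
  have 1: "Ra x * Ra (- x) = f (\<gamma> + x) * f (\<gamma> - x)" by (simp add: Ra_def algebra_simps)
  have 2: "Rcp x t * Rcp (- x) t + Rbp x t * Rbm (- x) t = f (\<gamma> + x) * f (\<gamma> - x)"
    using unit_pm[OF assms, of x] by (simp add: algebra_simps)
  have 3: "Rbm x t * Rbp (- x) t + Rcm x t * Rcm (- x) t = f (\<gamma> + x) * f (\<gamma> - x)"
    using unit_pm[OF n, of x] unfolding entries_uminus by (simp add: algebra_simps)
  have 4: "Rcp x t * Rbp (- x) t + Rbp x t * Rcm (- x) t = 0"
    "Rbm x t * Rcp (- x) t + Rcm x t * Rbm (- x) t = 0"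
    using f_cong_minus[of "- x" x] by (simp_all add: Rbp_def Rcp_def Rcm_def Rbm_def algebra_simps)
  show ?thesis
    using 1 2 3 4 by (cases a; cases b; cases a'; cases b') (simp_all add: UNIV_bool R_entries)
qed

definition wt :: "bool list \<Rightarrow> int" where "wt xs = sum_list (map h xs)"

lemma wt_simps [simp]: "wt [] = 0" "wt (x # xs) = h x + wt xs" by (simp_all add: wt_def)

abbreviation height :: "bool list \<Rightarrow> complex" where "height xs \<equiv> \<theta> - \<gamma> * of_int (wt xs)"

lemma abs_wt_le: "\<bar>wt xs\<bar> \<le> int (length xs)"
proof (induction xs)
  case (Cons x xs)
  then show ?case by (cases x) auto
qed simp

text \<open>The boundary matrix multiplied by \<open>[\<theta> + \<zeta> + \<lambda>]\<close>, which makes it entire and compatible with crossing.\<close>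

definition kk :: "complex \<Rightarrow> bool \<Rightarrow> complex" where
  "kk l a = (if a then f (\<zeta> + l) * f (\<theta> + \<zeta> - l) else f (\<zeta> - l) * f (\<theta> + \<zeta> + l))"

text \<open>
  The double-row monodromy matrix with inhomogeneities \<open>ms\<close>, acting on functions; the recursion peels off
  the first site, i.e. the outermost pair of R-matrices. It vanishes on lists of the wrong length.
\<close>

fun mon :: "complex list \<Rightarrow> complex \<Rightarrow> (bool \<Rightarrow> bool list \<Rightarrow> complex) \<Rightarrow> bool \<Rightarrow> bool list \<Rightarrow> complex"
    where
  "mon [] l \<psi> a xs = (if xs = [] then kk l a * \<psi> a [] else 0)"
| "mon (m # ms) l \<psi> a [] = 0"
| "mon (m # ms) l \<psi> a (x # xs) =
    (\<Sum>c\<in>UNIV. \<Sum>u\<in>UNIV. R (l - m) (height xs) a x c u *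
       mon ms l (\<lambda>d ys. \<Sum>y\<in>UNIV. \<Sum>b\<in>UNIV.
         R (l + m) (height ys) u d y b * \<psi> b (y # ys)) c xs)"

lemma mon_add: "mon ms l (\<lambda>b ys. \<psi> b ys + \<phi> b ys) a xs = mon ms l \<psi> a xs + mon ms l \<phi> a xs"
proof (induction ms arbitrary: \<psi> \<phi> a xs)
  case Nil
  then show ?case by (simp add: algebra_simps)
next
  case (Cons m ms)
  show ?case by (cases xs) (simp_all add: distrib_left sum.distrib Cons.IH)
qed

text \<open>The R-matrices obey the ice rule and the boundary matrix is diagonal, so the total spin
  of auxiliary space and sites is conserved, as is the number of sites. Functions of these pass
  through the monodromy; all later shifts of the dynamical parameter are computed in this
  way.\<close>

lemma mon_weight:
  "mon ms l (\<lambda>b ys. F (h b + wt ys) (length ys) * \<psi> b ys) a xs =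
     F (h a + wt xs) (length xs) * mon ms l \<psi> a xs"
proof (induction ms arbitrary: F \<psi> a xs)
  case Nil
  then show ?case by simp
next
  case (Cons m ms)
  show ?case
  proof (cases xs)
    case Nil
    then show ?thesis by simp
  next
    case xs: (Cons x xs')
    have 1: "(\<Sum>y\<in>UNIV. \<Sum>b\<in>UNIV. R (l + m) (height ys) u d y b *
          (F (h b + wt (y # ys)) (length (y # ys)) * \<psi> b (y # ys))) =
        F (h u + (h d + wt ys)) (Suc (length ys)) *
          (\<Sum>y\<in>UNIV. \<Sum>b\<in>UNIV. R (l + m) (height ys) u d y b * \<psi> b (y # ys))" for u d ys
      unfolding sum_distrib_left
    proof (intro sum.cong refl)
      fix y b
      have "R (l + m) (height ys) u d y b *
          (F (h b + wt (y # ys)) (length (y # ys)) * \<psi> b (y # ys)) =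
        R (l + m) (height ys) u d y b *
          (F (h u + (h d + wt ys)) (Suc (length ys)) * \<psi> b (y # ys))"
      proof (rule R_ice_cong)
        assume "h u + h d = h y + h b"
        then have "h b + wt (y # ys) = h u + (h d + wt ys)" by simp
        then show "F (h b + wt (y # ys)) (length (y # ys)) * \<psi> b (y # ys) =
          F (h u + (h d + wt ys)) (Suc (length ys)) * \<psi> b (y # ys)"
              by (simp only: list.size add_0_right add_Suc_right)
      qed
      then show "R (l + m) (height ys) u d y b *
          (F (h b + wt (y # ys)) (length (y # ys)) * \<psi> b (y # ys)) =
         F (h u + (h d + wt ys)) (Suc (length ys)) *
          (R (l + m) (height ys) u d y b * \<psi> b (y # ys))" by (simp add: mult.left_commute)
    qed
    define M where "M c u = mon ms l (\<lambda>d ys. \<Sum>y\<in>UNIV. \<Sum>b\<in>UNIV.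
      R (l + m) (height ys) u d y b * \<psi> b (y # ys)) c xs'" for c u
    \<comment> \<open>The split-off site also counts in the total, so the induction hypothesis is
      needed for the shifted function sending w and k to F (h u + w) (Suc k).\<close>
    have 2: "mon ms l (\<lambda>d ys. \<Sum>y\<in>UNIV. \<Sum>b\<in>UNIV. R (l + m) (height ys) u d y b *
          (F (h b + wt (y # ys)) (length (y # ys)) * \<psi> b (y # ys))) c xs' =
        F (h u + (h c + wt xs')) (Suc (length xs')) * M c u" for c u
      unfolding 1 M_def by (rule Cons.IH)
    have 3: "mon (m # ms) l \<psi> a xs = (\<Sum>c\<in>UNIV. \<Sum>u\<in>UNIV. R (l - m) (height xs') a x c u * M c u)"
      unfolding xs mon.simps M_def ..
    show ?thesis
      unfolding 3 sum_distrib_left unfolding xs mon.simps 2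
    proof (intro sum.cong refl)
      fix c u
      have "R (l - m) (height xs') a x c u * (F (h u + (h c + wt xs')) (Suc (length xs')) * M c u) =
        R (l - m) (height xs') a x c u * (F (h a + wt (x # xs')) (length (x # xs')) * M c u)"
      proof (rule R_ice_cong)
        assume "h a + h x = h c + h u"
        then have "h a + wt (x # xs') = h u + (h c + wt xs')" by simp
        then show "F (h u + (h c + wt xs')) (Suc (length xs')) * M c u =
          F (h a + wt (x # xs')) (length (x # xs')) * M c u"
              by (simp only: list.size add_0_right add_Suc_right)
      qed
      then show "R (l - m) (height xs') a x c u *
          (F (h u + (h c + wt xs')) (Suc (length xs')) * M c u) =
        F (h a + wt (x # xs')) (length (x # xs')) * (R (l - m) (height xs') a x c u * M c u)"
        by (simp add: mult.left_commute)
    qed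
  qed
qed

lemma mon_sum_bool:
  "mon ms l (\<lambda>b ys. \<Sum>p\<in>(UNIV :: bool set). \<psi> p b ys) a xs = (\<Sum>p\<in>UNIV. mon ms l (\<psi> p) a xs)"
  by (simp add: UNIV_bool mon_add)

lemma mon_length: "length xs \<noteq> length ms \<Longrightarrow> mon ms l \<psi> a xs = 0"
proof (induction ms arbitrary: \<psi> a xs)
  case (Cons m ms)
  then show ?case by (cases xs) simp_all
qed simp

text \<open>Allows identities that hold only for lists of the right length to be used under
  \<open>mon\<close>.\<close>

lemma mon_guard:
  "n = length ms \<Longrightarrow> mon ms l (\<lambda>b ys. if length ys = n then \<psi> b ys else 0) a xs = mon ms l \<psi> a xs"
  using mon_weight[of ms l "\<lambda>_ k. of_bool (k = n)" \<psi> a xs] mon_length[of xs ms l \<psi> a]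
  by (simp add: of_bool_def if_distrib[of "\<lambda>z. z * _"] cong: if_cong split: if_splits)

text \<open>
  Two-dimensional tensor factors are called legs and numbered: 1 and 2 are auxiliary spaces, 3 is a site that
  has been split off the list. In \<open>R_leg n i j l S\<close> the legs in \<open>S\<close> shift the dynamical parameter. The result
  is cut off on lists of length other than \<open>n\<close>, because the identities need bounded weights.
\<close>

type_synonym ket = "(nat \<Rightarrow> bool) \<Rightarrow> bool list \<Rightarrow> complex"

definition dyn :: "nat set \<Rightarrow> (nat \<Rightarrow> bool) \<Rightarrow> bool list \<Rightarrow> complex" where
  "dyn S \<sigma> xs = \<theta> - \<gamma> * of_int (wt xs + (\<Sum>k\<in>S. h (\<sigma> k)))"

definition R_leg :: "nat \<Rightarrow> nat \<Rightarrow> nat \<Rightarrow> complex \<Rightarrow> nat set \<Rightarrow> ket \<Rightarrow> ket" where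
  "R_leg n i j l S \<Psi> \<sigma> xs = (if length xs = n then
     \<Sum>p\<in>UNIV. \<Sum>q\<in>UNIV. R l (dyn S \<sigma> xs) (\<sigma> i) (\<sigma> j) p q * \<Psi> (\<sigma>(i := p, j := q)) xs else 0)"

definition mon_leg :: "complex list \<Rightarrow> complex \<Rightarrow> nat \<Rightarrow> ket \<Rightarrow> ket" where
  "mon_leg ms l i \<Psi> \<sigma> xs = mon ms l (\<lambda>b ys. \<Psi> (\<sigma>(i := b)) ys) (\<sigma> i) xs"

text \<open>Moves the three internal sums of a triple product of R-matrices innermost, where they
  form the coefficient to which the Yang-Baxter equation applies.\<close>

lemma sum_regroup_left:
  fixes F :: "bool \<Rightarrow> bool \<Rightarrow> complex"
  shows "(\<Sum>p\<in>UNIV. \<Sum>q\<in>UNIV. F p q * (\<Sum>a\<in>(UNIV::bool set). \<Sum>r\<in>(UNIV::bool set). G p a r *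
     (\<Sum>b\<in>(UNIV::bool set). \<Sum>c\<in>(UNIV::bool set). H a q r b c * X a b c))) =
   (\<Sum>a\<in>UNIV. \<Sum>b\<in>UNIV. \<Sum>c\<in>UNIV. (\<Sum>p\<in>UNIV. \<Sum>q\<in>UNIV. \<Sum>r\<in>UNIV. F p q * G p a r * H a q r b c) *
       X a b c)"
  unfolding sum_distrib_left sum_distrib_right sum.cartesian_product
  by (rule sum.reindex_bij_witness[where i = "\<lambda>(a, b, c, p, q, r). (p, q, a, r, b, c)"
        and j = "\<lambda>(p, q, a, r, b, c). (a, b, c, p, q, r)"]) (auto simp: mult.assoc)

lemma sum_regroup_right:
  fixes F :: "bool \<Rightarrow> bool \<Rightarrow> complex"
  shows "(\<Sum>q\<in>UNIV. \<Sum>r\<in>UNIV. F q r * (\<Sum>p\<in>(UNIV::bool set). \<Sum>c\<in>(UNIV::bool set). G q r p c *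
     (\<Sum>a\<in>(UNIV::bool set). \<Sum>b\<in>(UNIV::bool set). H p q a b * X a b c))) =
   (\<Sum>a\<in>UNIV. \<Sum>b\<in>UNIV. \<Sum>c\<in>UNIV. (\<Sum>q\<in>UNIV. \<Sum>r\<in>UNIV. \<Sum>p\<in>UNIV. F q r * G q r p c * H p q a b) *
       X a b c)"
  unfolding sum_distrib_left sum_distrib_right sum.cartesian_product
  by (rule sum.reindex_bij_witness[where i = "\<lambda>(a, b, c, q, r, p). (q, r, p, c, a, b)"
        and j = "\<lambda>(q, r, p, c, a, b). (a, b, c, q, r, p)"]) (auto simp: mult.assoc)

text \<open>For a list of length n the height is theta - gamma wt with |wt| <= n, and the
  Yang-Baxter equation also divides by the values at the two neighbouring heights; this gives the
  bound n + 1.\<close>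

lemma R_leg_ybe:
  assumes nz: "\<And>k. \<bar>k\<bar> \<le> int (Suc n) \<Longrightarrow> f (\<theta> + of_int k * \<gamma>) \<noteq> 0"
    and d: "i \<noteq> j" "i \<noteq> k" "j \<noteq> k" and uv: "w = u + v"
  shows "R_leg n i j u {k} (R_leg n i k w {} (R_leg n j k v {i} \<Psi>)) =
         R_leg n j k v {} (R_leg n i k w {j} (R_leg n i j u {} \<Psi>))"
proof (intro ext)
  fix \<sigma> xs
  show "R_leg n i j u {k} (R_leg n i k w {} (R_leg n j k v {i} \<Psi>)) \<sigma> xs =
         R_leg n j k v {} (R_leg n i k w {j} (R_leg n i j u {} \<Psi>)) \<sigma> xs"
  proof (cases "length xs = n")
    case True
    define t where "t = \<theta> - \<gamma> * of_int (wt xs)"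
    define X where "X a b c = \<Psi> (\<sigma>(i := a, j := b, k := c)) xs" for a b c
    have upd: "\<sigma>(k := c, i := a, j := b) = \<sigma>(i := a, j := b, k := c)" for a b c
      using d by (auto simp: fun_eq_iff)
    have dyn: "dyn {} \<sigma>' xs = t" "dyn {x} \<sigma>' xs = t - \<gamma> * of_int (h (\<sigma>' x))" for \<sigma>' x
      by (simp_all add: dyn_def t_def algebra_simps)
    have nz': "f t \<noteq> 0" "f (t - \<gamma>) \<noteq> 0" "f (t + \<gamma>) \<noteq> 0"
      using nz[of "- wt xs"] nz[of "- wt xs - 1"] nz[of "- wt xs + 1"] abs_wt_le[of xs] True
      by (auto simp: t_def algebra_simps)
    have "R_leg n i j u {k} (R_leg n i k w {} (R_leg n j k v {i} \<Psi>)) \<sigma> xs =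
      (\<Sum>p\<in>UNIV. \<Sum>q\<in>UNIV. R u (t - \<gamma> * of_int (h (\<sigma> k))) (\<sigma> i) (\<sigma> j) p q *
         (\<Sum>a\<in>UNIV. \<Sum>r\<in>UNIV. R (u + v) t p (\<sigma> k) a r *
           (\<Sum>b\<in>UNIV. \<Sum>c\<in>UNIV. R v (t - \<gamma> * of_int (h a)) q r b c * X a b c)))"
      using d True by (simp add: R_leg_def dyn upd X_def uv)
    also have "\<dots> = (\<Sum>a\<in>UNIV. \<Sum>b\<in>UNIV. \<Sum>c\<in>UNIV. (\<Sum>p\<in>UNIV. \<Sum>q\<in>UNIV. \<Sum>r\<in>UNIV.
        R u (t - \<gamma> * of_int (h (\<sigma> k))) (\<sigma> i) (\<sigma> j) p q * R (u + v) t p (\<sigma> k) a r *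
        R v (t - \<gamma> * of_int (h a)) q r b c) * X a b c)"
      by (rule sum_regroup_left)
    also have "\<dots> = (\<Sum>a\<in>UNIV. \<Sum>b\<in>UNIV. \<Sum>c\<in>UNIV. (\<Sum>q\<in>UNIV. \<Sum>r\<in>UNIV. \<Sum>p\<in>UNIV.
        R v t (\<sigma> j) (\<sigma> k) q r * R (u + v) (t - \<gamma> * of_int (h q)) (\<sigma> i) r p c *
        R u t p q a b) * X a b c)"
      unfolding dynamical_ybe[OF nz'] ..
    also have "\<dots> = (\<Sum>q\<in>UNIV. \<Sum>r\<in>UNIV. R v t (\<sigma> j) (\<sigma> k) q r *
         (\<Sum>p\<in>UNIV. \<Sum>c\<in>UNIV. R (u + v) (t - \<gamma> * of_int (h q)) (\<sigma> i) r p c *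
           (\<Sum>a\<in>UNIV. \<Sum>b\<in>UNIV. R u t p q a b * X a b c)))"
      by (rule sum_regroup_right[symmetric])
    also have "\<dots> = R_leg n j k v {} (R_leg n i k w {j} (R_leg n i j u {} \<Psi>)) \<sigma> xs"
      using d True by (simp add: R_leg_def dyn upd X_def uv)
    finally show ?thesis .
  qed (simp add: R_leg_def)
qed

lemma R_leg_unitary:
  assumes nz: "\<And>k. \<bar>k\<bar> \<le> int (Suc n) \<Longrightarrow> f (\<theta> + of_int k * \<gamma>) \<noteq> 0"
    and d: "i \<noteq> j" "S \<subseteq> {k}" "i \<noteq> k" "j \<noteq> k"
  shows "R_leg n i j x S (R_leg n j i (- x) S \<Psi>) \<sigma> xs =
     (if length xs = n then f (\<gamma> + x) * f (\<gamma> - x) * \<Psi> \<sigma> xs else 0)"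
proof (cases "length xs = n")
  case True
  define t where "t = dyn S \<sigma> xs"
  have S: "S = {} \<or> S = {k}" using d by auto
  have dyn: "dyn S (\<sigma>(i := p, j := q)) xs = t" for p q
    using d(1,3,4) S by (elim disjE) (simp_all add: t_def dyn_def)
  have nz': "f t \<noteq> 0"
    using S nz[of "- wt xs"] nz[of "- wt xs - h (\<sigma> k)"] abs_wt_le[of xs] True
    by (cases "\<sigma> k") (auto simp: t_def dyn_def algebra_simps)
  have upd: "\<sigma>(j := b, i := a) = \<sigma>(i := a, j := b)" for a b
    using d by (auto simp: fun_eq_iff)
  have "R_leg n i j x S (R_leg n j i (- x) S \<Psi>) \<sigma> xs =
      (\<Sum>p\<in>UNIV. \<Sum>q\<in>UNIV. R x t (\<sigma> i) (\<sigma> j) p q *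
         (\<Sum>b\<in>UNIV. \<Sum>a\<in>UNIV. R (- x) t q p b a * \<Psi> (\<sigma>(i := a, j := b)) xs))"
    using d True by (simp add: R_leg_def dyn upd flip: t_def)
  also have "\<dots> = (\<Sum>a\<in>UNIV. \<Sum>b\<in>UNIV. (\<Sum>p\<in>UNIV. \<Sum>q\<in>UNIV. R x t (\<sigma> i) (\<sigma> j) p q * R (- x) t q p b a)
      * \<Psi> (\<sigma>(i := a, j := b)) xs)"
    by (simp add: UNIV_bool distrib_left distrib_right mult.assoc add_ac)
  also have "\<dots> = f (\<gamma> + x) * f (\<gamma> - x) * \<Psi> (\<sigma>(i := \<sigma> i, j := \<sigma> j)) xs"
    unfolding R_unitary[OF nz'] by (cases "\<sigma> i"; cases "\<sigma> j") (simp_all add: UNIV_bool)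
  finally show ?thesis using True by simp
qed (simp add: R_leg_def)

lemma R_leg_cmult:
  "R_leg n i j x S (\<lambda>\<sigma> xs. if length xs = n then c * \<Psi> \<sigma> xs else 0) =
     (\<lambda>\<sigma> xs. if length xs = n then c * R_leg n i j x S \<Psi> \<sigma> xs else 0)"
  by (intro ext) (simp add: R_leg_def sum_distrib_left mult.left_commute)

text \<open>The mixed order of legs met in the double row. It follows from the ordinary equation by
  multiplying with R_ki(x) on both ends: R_ki(x) and R_ik(-x) are inverse up to a scalar, which is
  why that scalar must not vanish.\<close>

lemma R_leg_ybe':
  assumes nz: "\<And>k. \<bar>k\<bar> \<le> int (Suc n) \<Longrightarrow> f (\<theta> + of_int k * \<gamma>) \<noteq> 0"
    and d: "i \<noteq> j" "i \<noteq> k" "j \<noteq> k" and x: "x = y - z" and n0: "f (\<gamma> + x) \<noteq> 0" "f (\<gamma> - x) \<noteq> 0"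
  shows "R_leg n k i x {} (R_leg n j i y {k} (R_leg n j k z {} \<Psi>)) =
         R_leg n j k z {i} (R_leg n j i y {} (R_leg n k i x {j} \<Psi>))"
proof -
  let ?c = "f (\<gamma> + x) * f (\<gamma> - x)"
  have un: "R_leg n k i x {} (R_leg n i k (- x) {} \<Phi>) =
      (\<lambda>\<sigma> xs. if length xs = n then ?c * \<Phi> \<sigma> xs else 0)" for \<Phi>
    by (intro ext, rule R_leg_unitary[OF nz, where k = j]) (use d in auto)
  have un': "R_leg n i k (- x) {j} (R_leg n k i x {j} \<Phi>) =
      (\<lambda>\<sigma> xs. if length xs = n then ?c * \<Phi> \<sigma> xs else 0)" for \<Phi>
    using R_leg_unitary[OF nz, where i = i and j = k and S = "{j}" and k = j and x = "- x" and \<Psi> =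
        \<Phi>] d by (intro ext) (simp add: mult.commute)
  have "R_leg n j i y {k} (R_leg n j k z {} (R_leg n i k (- x) {j} (R_leg n k i x {j} \<Psi>))) =
    R_leg n i k (- x) {} (R_leg n j k z {i} (R_leg n j i y {} (R_leg n k i x {j} \<Psi>)))"
    by (rule R_leg_ybe[OF nz]) (use d x in auto)
  then have "R_leg n k i x {} (R_leg n j i y {k}
      (R_leg n j k z {} (R_leg n i k (- x) {j} (R_leg n k i x {j} \<Psi>)))) =
    R_leg n k i x {} (R_leg n i k (- x) {} (R_leg n j k z {i}
        (R_leg n j i y {} (R_leg n k i x {j} \<Psi>))))"
    by simp
  then have e: "(\<lambda>\<sigma> xs. if length xs = n then ?c *
      R_leg n k i x {} (R_leg n j i y {k} (R_leg n j k z {} \<Psi>)) \<sigma> xs else 0) =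
    (\<lambda>\<sigma> xs. if length xs = n then ?c * R_leg n j k z {i} (R_leg n j i y {} (R_leg n k i x {j} \<Psi>))
        \<sigma> xs else 0)"
    unfolding un un' R_leg_cmult .
  show ?thesis
  proof (intro ext)
    fix \<sigma> xs
    show "R_leg n k i x {} (R_leg n j i y {k} (R_leg n j k z {} \<Psi>)) \<sigma> xs =
         R_leg n j k z {i} (R_leg n j i y {} (R_leg n k i x {j} \<Psi>)) \<sigma> xs"
    proof (cases "length xs = n")
      case True
      then show ?thesis using fun_cong[OF fun_cong[OF e, of \<sigma>], of xs] n0 by auto
    qed (simp add: R_leg_def)
  qed
qed

text \<open>The R-matrix on the two other legs sees leg i and the sites only through their total
  spin, which the monodromy on leg i conserves. Without the shift by leg i this would fail.\<close>

lemma mon_leg_R_leg_commute: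
  assumes "i \<noteq> j" "i \<noteq> k"
  shows "mon_leg ms l i (R_leg n j k x {i} \<Psi>) = R_leg n j k x {i} (mon_leg ms l i \<Psi>)"
proof (intro ext)
  fix \<sigma> xs
  define F where "F p q w len = (if len = n then R x (\<theta> - \<gamma> * of_int w) (\<sigma> j) (\<sigma> k) p q else 0)"
    for p q and w :: int and len :: nat
  have e: "(\<lambda>b ys. R_leg n j k x {i} \<Psi> (\<sigma>(i := b)) ys) =
     (\<lambda>b ys. \<Sum>p\<in>UNIV. \<Sum>q\<in>UNIV. F p q (h b + wt ys) (length ys) * \<Psi> (\<sigma>(j := p, k := q, i := b)) ys)"
    using assms by (intro ext) (auto simp: F_def R_leg_def dyn_def fun_upd_twist add.commute)
  have "mon_leg ms l i (R_leg n j k x {i} \<Psi>) \<sigma> xs =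
      (\<Sum>p\<in>UNIV. \<Sum>q\<in>UNIV. F p q (h (\<sigma> i) + wt xs) (length xs)
        * mon ms l (\<lambda>b ys. \<Psi> (\<sigma>(j := p, k := q, i := b)) ys) (\<sigma> i) xs)"
    unfolding mon_leg_def e mon_sum_bool mon_weight[where F = "F p q" for p q] ..
  also have "\<dots> = R_leg n j k x {i} (mon_leg ms l i \<Psi>) \<sigma> xs"
    using assms by (auto simp: F_def R_leg_def mon_leg_def dyn_def add.commute)
  finally show "mon_leg ms l i (R_leg n j k x {i} \<Psi>) \<sigma> xs =
      R_leg n j k x {i} (mon_leg ms l i \<Psi>) \<sigma> xs" .
qed

text \<open>Exactly what is needed to invert the R-matrices \<open>R(l + m)\<close> by unitarity.\<close>

definition nonres :: "complex list \<Rightarrow> complex \<Rightarrow> bool" where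
  "nonres ms l \<longleftrightarrow> (\<forall>m\<in>set ms. f (\<gamma> + (l + m)) \<noteq> 0 \<and> f (\<gamma> - (l + m)) \<noteq> 0)"

definition indep :: "nat \<Rightarrow> ket \<Rightarrow> bool" where
  "indep k \<Psi> \<longleftrightarrow> (\<forall>\<sigma> b xs. \<Psi> (\<sigma>(k := b)) xs = \<Psi> \<sigma> xs)"

lemma indep_R_leg:
  assumes "indep k \<Psi>" "i \<noteq> k" "j \<noteq> k"
  shows "indep k (R_leg n i j l {} \<Psi>)"
proof -
  have "\<Psi> (\<sigma>(k := b, i := p, j := q)) xs = \<Psi> (\<sigma>(i := p, j := q)) xs" for \<sigma> b p q xs
    using assms by (metis indep_def fun_upd_twist)
  then show ?thesis using assms unfolding indep_def R_leg_def dyn_def by simp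
qed

lemma indep_mon_leg:
  assumes "indep k \<Psi>" "i \<noteq> k"
  shows "indep k (mon_leg ms l i \<Psi>)"
proof -
  have "(\<lambda>p. \<Psi> (\<sigma>(k := b, i := p))) = (\<lambda>p. \<Psi> (\<sigma>(i := p)))" for \<sigma> b
    using assms by (intro ext) (metis indep_def fun_upd_twist)
  then show ?thesis using assms unfolding indep_def mon_leg_def by simp
qed

text \<open>Hands the first site over to leg 3, turning an identity on n + 1 sites into one on n
  sites with a third leg. It is meant for kets that do not otherwise depend on leg 3.\<close>

definition attach :: "ket \<Rightarrow> ket" where
  "attach \<Psi> \<sigma> ys = \<Psi> \<sigma> (\<sigma> 3 # ys)"

lemma attach_R_leg:
  "i \<noteq> 3 \<Longrightarrow> j \<noteq> 3 \<Longrightarrow> attach (R_leg (Suc n) i j l {} \<Psi>) = R_leg n i j l {3} (attach \<Psi>)"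
  by (intro ext) (simp add: attach_def R_leg_def dyn_def add.commute)

text \<open>The recursion of \<open>mon\<close> in the language of legs: the first site appears as
  leg 3 in one R-matrix of each row.\<close>

lemma attach_mon_leg:
  assumes "indep 3 \<Psi>" "i \<noteq> 3" and n: "n = length ms"
  shows "attach (mon_leg (m # ms) l i \<Psi>) =
     R_leg n i 3 (l - m) {} (mon_leg ms l i (R_leg n 3 i (l + m) {} (attach \<Psi>)))"
proof (intro ext)
  fix \<sigma> ys
  have *: "\<Psi> (\<sigma>(i := p, 3 := u, i := d, 3 := y, i := b)) zs = \<Psi> (\<sigma>(i := b)) zs" for p u d y b zs
    using assms by (metis indep_def fun_upd_twist fun_upd_upd)
  have **: "mon ms l (\<lambda>d ys. R_leg n 3 i (l + m) {} (attach \<Psi>) (\<sigma>(i := c, 3 := u, i := d)) ys) c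
      ys =
     mon ms l (\<lambda>d ys. \<Sum>y\<in>UNIV. \<Sum>b\<in>UNIV.
         R (l + m) (height ys) u d y b * \<Psi> (\<sigma>(i := b)) (y # ys)) c ys" for c u
  proof -
    have "(\<lambda>d ys. R_leg n 3 i (l + m) {} (attach \<Psi>) (\<sigma>(i := c, 3 := u, i := d)) ys) =
      (\<lambda>d ys. if length ys = n then \<Sum>y\<in>UNIV. \<Sum>b\<in>UNIV.
         R (l + m) (height ys) u d y b * \<Psi> (\<sigma>(i := b)) (y # ys) else 0)"
      unfolding R_leg_def attach_def * using assms(2) by (intro ext) (simp add: dyn_def)
    then show ?thesis by (simp only: mon_guard[OF n])
  qed
  show "attach (mon_leg (m # ms) l i \<Psi>) \<sigma> ys =
     R_leg n i 3 (l - m) {} (mon_leg ms l i (R_leg n 3 i (l + m) {} (attach \<Psi>))) \<sigma> ys"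
  proof (cases "length ys = n")
    case True
    then show ?thesis
      unfolding attach_def[of "mon_leg _ _ _ _"] mon_leg_def R_leg_def[of n i 3] mon.simps
          **[symmetric]
      using assms(2) by (simp add: dyn_def)
  next
    case False
    then show ?thesis
      using mon_length[of "\<sigma> 3 # ys" "m # ms" l] n
          by (simp add: attach_def mon_leg_def R_leg_def del: mon.simps)
  qed
qed

section \<open>The dynamical reflection equation\<close>

definition refl_lhs where
  "refl_lhs ms l1 l2 \<Psi> = R_leg (length ms) 1 2 (l1 - l2) {} (mon_leg ms l1 1
     (R_leg (length ms) 2 1 (l1 + l2) {} (mon_leg ms l2 2 \<Psi>)))"

definition refl_rhs where
  "refl_rhs ms l1 l2 \<Psi> = mon_leg ms l2 2 (R_leg (length ms) 1 2 (l1 + l2) {} (mon_leg ms l1 1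
     (R_leg (length ms) 2 1 (l1 - l2) {} \<Psi>)))"

definition fix3 :: "bool \<Rightarrow> ket \<Rightarrow> ket" where "fix3 c \<Psi> \<sigma> xs = \<Psi> (\<sigma>(3 := c)) xs"

lemma fix3_R_leg: "i \<noteq> 3 \<Longrightarrow> j \<noteq> 3 \<Longrightarrow> R_leg n i j l {} (fix3 c \<Psi>) = fix3 c (R_leg n i j l {} \<Psi>)"
  by (intro ext) (simp add: fix3_def R_leg_def dyn_def fun_upd_twist)

lemma fix3_mon_leg: "i \<noteq> 3 \<Longrightarrow> mon_leg ms l i (fix3 c \<Psi>) = fix3 c (mon_leg ms l i \<Psi>)"
  by (intro ext) (simp add: fix3_def mon_leg_def fun_upd_twist)

lemma reflection_nil:
  assumes nz: "f \<theta> \<noteq> 0"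
  shows "refl_lhs [] l1 l2 \<Psi> \<sigma> xs = refl_rhs [] l1 l2 \<Psi> \<sigma> xs"
proof (cases "xs = []")
  case True
  define X where "X a b = \<Psi> (\<sigma>(Suc 0 := a, 2 := b)) []" for a b
  have X: "\<Psi> (\<sigma>(Suc 0 := a, 2 := b)) [] = X a b" "\<Psi> (\<sigma>(2 := b, Suc 0 := a)) [] = X a b" for a b
    by (simp_all add: X_def fun_upd_twist)
  have pm: "(Rbp (l1 - l2) \<theta> * kk l1 True * Rcm (l1 + l2) \<theta> * kk l2 True + Rcp (l1 - l2) \<theta> *
      kk l1 False * Rbp (l1 + l2) \<theta> * kk l2 True) =
    kk l2 False * Rbp (l1 + l2) \<theta> * kk l1 True * Rcm (l1 - l2) \<theta> + kk l2 False * Rcp (l1 + l2) \<theta> *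
        kk l1 False * Rbp (l1 - l2) \<theta>"
    using refl_pm[OF nz, of l1 l2 \<zeta>] by (simp add: kk_def mult_ac)
  have mp: "(Rbm (l1 - l2) \<theta> * kk l1 False * Rcp (l1 + l2) \<theta> * kk l2 False + Rcm (l1 - l2) \<theta> *
      kk l1 True * Rbm (l1 + l2) \<theta> * kk l2 False) =
    kk l2 True * Rbm (l1 + l2) \<theta> * kk l1 False * Rcp (l1 - l2) \<theta> + kk l2 True * Rcm (l1 + l2) \<theta> *
        kk l1 True * Rbm (l1 - l2) \<theta>"
    using refl_mp[OF nz, of l1 l2 \<zeta>] by (simp add: kk_def mult_ac)
  have bb: "Rbm (l1 + l2) \<theta> * Rbp (l1 - l2) \<theta> = Rbm (l1 - l2) \<theta> * Rbp (l1 + l2) \<theta>"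
    by (simp add: Rbp_def Rbm_def)
  \<comment> \<open>Both sides are linear in two values of the ket. The coefficients of the value
    with unchanged spins agree by commutativity and \<open>bb\<close>; those of the value with
    exchanged spins agree by \<open>pm\<close> or \<open>mp\<close>.\<close>
  have fin: "L = M" if "a * y + b * z = L" "a' * y + b' * z = M" "a = a'" "b = b'"
      for L M a b a' b' y z :: complex
    using that by simp
  show ?thesis
  proof (cases "\<sigma> 1"; cases "\<sigma> 2")
    assume s: "\<sigma> 1" "\<not> \<sigma> 2"
    show ?thesis
      by (rule fin[OF _ _ _ pm, where y = "X True False" and z = "X False True" and
         a = "Rbp (l1 - l2) \<theta> * Rbm (l1 + l2) \<theta> * kk l1 True * kk l2 False + Rcp (l1 - l2) \<theta> *
             Rcp (l1 + l2) \<theta> * kk l1 False * kk l2 False"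
         and a' = "Rbp (l1 + l2) \<theta> * Rbm (l1 - l2) \<theta> * kk l1 True * kk l2 False +
             Rcp (l1 - l2) \<theta> * Rcp (l1 + l2) \<theta> * kk l1 False * kk l2 False"])
        (use s True in \<open>simp_all add: refl_lhs_def refl_rhs_def R_leg_def mon_leg_def dyn_def
            UNIV_bool R_entries X algebra_simps bb\<close>)
  next
    assume s: "\<not> \<sigma> 1" "\<sigma> 2"
    show ?thesis
      by (rule fin[OF _ _ _ mp, where y = "X False True" and z = "X True False" and
         a = "Rbp (l1 + l2) \<theta> * Rbm (l1 - l2) \<theta> * kk l1 False * kk l2 True + Rcm (l1 - l2) \<theta> *
             Rcm (l1 + l2) \<theta> * kk l1 True * kk l2 True"
         and a' = "Rbp (l1 - l2) \<theta> * Rbm (l1 + l2) \<theta> * kk l1 False * kk l2 True +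
             Rcm (l1 - l2) \<theta> * Rcm (l1 + l2) \<theta> * kk l1 True * kk l2 True"])
        (use s True in \<open>simp_all add: refl_lhs_def refl_rhs_def R_leg_def mon_leg_def dyn_def
            UNIV_bool R_entries X algebra_simps bb\<close>)
  qed (use True in \<open>simp_all add: refl_lhs_def refl_rhs_def R_leg_def mon_leg_def dyn_def
      UNIV_bool R_entries X algebra_simps\<close>)
qed (simp add: refl_lhs_def refl_rhs_def R_leg_def mon_leg_def)

text \<open>Sklyanin's dressing argument: the first site becomes leg 3, its four R-matrices are
  moved outwards around the inner equation, which is the induction hypothesis, and are then moved
  back. The bound for \<open>m # ms\<close> is exactly the bound n + 1 that the Yang-Baxter equation
  requires over the n sites of \<open>ms\<close>.\<close>

theorem reflection_equation:
  assumes "\<And>k. \<bar>k\<bar> \<le> int (length ms) \<Longrightarrow> f (\<theta> + of_int k * \<gamma>) \<noteq> 0"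
    and "nonres ms l1" "nonres ms l2"
  shows "refl_lhs ms l1 l2 \<Psi> = refl_rhs ms l1 l2 \<Psi>"
  using assms
proof (induction ms arbitrary: \<Psi>)
  case Nil
  then show ?case using reflection_nil[of l1 l2 \<Psi>] Nil(1)[of 0] by (intro ext) auto
next
  case (Cons m ms)
  define n where "n = length ms"
  have nz: "f (\<theta> + of_int k * \<gamma>) \<noteq> 0" if "\<bar>k\<bar> \<le> int (Suc n)" for k
    using Cons.prems(1)[of k] that by (simp add: n_def)
  have m: "f (\<gamma> + (l1 + m)) \<noteq> 0" "f (\<gamma> - (l1 + m)) \<noteq> 0" "f (\<gamma> + (l2 + m)) \<noteq> 0"
      "f (\<gamma> - (l2 + m)) \<noteq> 0"
    using Cons.prems by (auto simp: nonres_def)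
  have "nonres ms l1" "nonres ms l2" using Cons.prems by (auto simp: nonres_def)
  then have IH: "refl_lhs ms l1 l2 \<Phi> = refl_rhs ms l1 l2 \<Phi>" for \<Phi>
    using Cons.prems by (intro Cons.IH) auto
  have step: "attach (refl_lhs (m # ms) l1 l2 \<Phi>) = attach (refl_rhs (m # ms) l1 l2 \<Phi>)"
      if i: "indep 3 \<Phi>" for \<Phi>
  proof -
    define \<Omega> where "\<Omega> = attach \<Phi>"
    have "attach (refl_lhs (m # ms) l1 l2 \<Phi>) =
      R_leg n 1 2 (l1 - l2) {3} (R_leg n 1 3 (l1 - m) {} (mon_leg ms l1 1 (R_leg n 3 1 (l1 + m) {}
        (R_leg n 2 1 (l1 + l2) {3} (R_leg n 2 3 (l2 - m) {}
            (mon_leg ms l2 2 (R_leg n 3 2 (l2 + m) {} \<Omega>)))))))"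
      unfolding refl_lhs_def \<Omega>_def using i
      by (simp add: attach_R_leg attach_mon_leg indep_R_leg indep_mon_leg n_def)
    \<comment> \<open>The mixed equation with i = 1, j = 2, k = 3 applies because l1 + m = (l1 + l2)
      - (l2 - m). Afterwards R_23 carries the shift {1} and R_31 the shift {2}, so they can cross
      the monodromies on legs 1 and 2.\<close>
    also have "\<dots> = R_leg n 1 2 (l1 - l2) {3} (R_leg n 1 3 (l1 - m) {}
        (mon_leg ms l1 1 (R_leg n 2 3 (l2 - m) {1}
        (R_leg n 2 1 (l1 + l2) {} (R_leg n 3 1 (l1 + m) {2}
            (mon_leg ms l2 2 (R_leg n 3 2 (l2 + m) {} \<Omega>)))))))"
      by (subst R_leg_ybe'[OF nz]) (use m in auto)
    also have "\<dots> = R_leg n 1 2 (l1 - l2) {3} (R_leg n 1 3 (l1 - m) {}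
        (R_leg n 2 3 (l2 - m) {1} (mon_leg ms l1 1
        (R_leg n 2 1 (l1 + l2) {} (mon_leg ms l2 2
            (R_leg n 3 1 (l1 + m) {2} (R_leg n 3 2 (l2 + m) {} \<Omega>)))))))"
      by (simp add: mon_leg_R_leg_commute)
    also have "\<dots> = R_leg n 2 3 (l2 - m) {} (R_leg n 1 3 (l1 - m) {2} (refl_lhs ms l1 l2
        (R_leg n 3 1 (l1 + m) {2} (R_leg n 3 2 (l2 + m) {} \<Omega>))))"
      unfolding refl_lhs_def n_def[symmetric] by (rule R_leg_ybe[OF nz]) auto
    also have "\<dots> = R_leg n 2 3 (l2 - m) {} (R_leg n 1 3 (l1 - m) {2}
        (mon_leg ms l2 2 (R_leg n 1 2 (l1 + l2) {} (mon_leg ms l1 1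
        (R_leg n 2 1 (l1 - l2) {} (R_leg n 3 1 (l1 + m) {2} (R_leg n 3 2 (l2 + m) {} \<Omega>)))))))"
      unfolding IH refl_rhs_def n_def[symmetric] ..
    also have "\<dots> = R_leg n 2 3 (l2 - m) {} (R_leg n 1 3 (l1 - m) {2}
        (mon_leg ms l2 2 (R_leg n 1 2 (l1 + l2) {} (mon_leg ms l1 1
        (R_leg n 3 2 (l2 + m) {1} (R_leg n 3 1 (l1 + m) {} (R_leg n 2 1 (l1 - l2) {3} \<Omega>)))))))"
      by (subst R_leg_ybe[OF nz, where i = 3 and j = 2 and k = 1]) auto
    also have "\<dots> = R_leg n 2 3 (l2 - m) {} (mon_leg ms l2 2
        (R_leg n 1 3 (l1 - m) {2} (R_leg n 1 2 (l1 + l2) {} 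
        (R_leg n 3 2 (l2 + m) {1} (mon_leg ms l1 1
            (R_leg n 3 1 (l1 + m) {} (R_leg n 2 1 (l1 - l2) {3} \<Omega>)))))))"
      by (simp add: mon_leg_R_leg_commute)
    \<comment> \<open>The mixed equation with the roles of legs 1 and 2 exchanged, read backwards:
      l2 + m = (l1 + l2) - (l1 - m).\<close>
    also have "\<dots> = R_leg n 2 3 (l2 - m) {} (mon_leg ms l2 2
        (R_leg n 3 2 (l2 + m) {} (R_leg n 1 2 (l1 + l2) {3} 
        (R_leg n 1 3 (l1 - m) {} (mon_leg ms l1 1
            (R_leg n 3 1 (l1 + m) {} (R_leg n 2 1 (l1 - l2) {3} \<Omega>)))))))"
      by (subst R_leg_ybe'[OF nz, symmetric]) (use m in auto)
    also have "\<dots> = attach (refl_rhs (m # ms) l1 l2 \<Phi>)"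
      unfolding refl_rhs_def \<Omega>_def using i
      by (simp add: attach_R_leg attach_mon_leg indep_R_leg indep_mon_leg n_def)
    finally show ?thesis .
  qed
  show ?case
  proof (intro ext)
    fix \<sigma> :: "nat \<Rightarrow> bool" and xs
    define c where "c = \<sigma> 3"
    have c: "refl_lhs (m # ms) l1 l2 \<Psi> \<sigma> xs = refl_lhs (m # ms) l1 l2 (fix3 c \<Psi>) \<sigma> xs"
      "refl_rhs (m # ms) l1 l2 \<Psi> \<sigma> xs = refl_rhs (m # ms) l1 l2 (fix3 c \<Psi>) \<sigma> xs"
      by (simp_all add: refl_lhs_def refl_rhs_def fix3_R_leg fix3_mon_leg)
          (simp_all add: fix3_def c_def)
    have i: "indep 3 (fix3 c \<Psi>)" by (simp add: indep_def fix3_def)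
    have i': "indep 3 (refl_lhs (m # ms) l1 l2 (fix3 c \<Psi>))"
        "indep 3 (refl_rhs (m # ms) l1 l2 (fix3 c \<Psi>))"
      unfolding refl_lhs_def refl_rhs_def by (intro indep_R_leg indep_mon_leg i; simp)+
    show "refl_lhs (m # ms) l1 l2 \<Psi> \<sigma> xs = refl_rhs (m # ms) l1 l2 \<Psi> \<sigma> xs"
    proof (cases xs)
      case Nil
      then show ?thesis by (simp add: refl_lhs_def refl_rhs_def R_leg_def mon_leg_def)
    next
      case (Cons x ys)
      have e: "F \<sigma> xs = attach F (\<sigma>(3 := x)) ys" if "indep 3 F" for F
        using that Cons by (simp add: attach_def indep_def)
      show ?thesis by (simp only: c e[OF i'(1)] e[OF i'(2)] step[OF i])
    qed
  qed
qed

section \<open>Crossing\<close>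

text \<open>Crossing coefficients. The final letter is the spin of the diagonal block taken at
  -l-gamma; \<open>Kd\<close> multiplies the opposite diagonal block at l, \<open>Ka\<close> the
  same one with a minus sign. \<open>Kb\<close> belongs to the off-diagonal blocks. The argument t
  is the height of the outgoing sites.\<close>

definition Kdp :: "complex \<Rightarrow> complex \<Rightarrow> complex" where
  "Kdp t l = f (t + \<gamma>) * f (2 * l + \<gamma>) / (f t * f (2 * l))"
definition Kap :: "complex \<Rightarrow> complex \<Rightarrow> complex" where
  "Kap t l = f (t + (2 * l + \<gamma>)) * f \<gamma> / (f t * f (2 * l))"
definition Kdm :: "complex \<Rightarrow> complex \<Rightarrow> complex" where
  "Kdm t l = f (t - \<gamma>) * f (2 * l + \<gamma>) / (f t * f (2 * l))"
definition Kam :: "complex \<Rightarrow> complex \<Rightarrow> complex" where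
  "Kam t l = f (t - (2 * l + \<gamma>)) * f \<gamma> / (f t * f (2 * l))"
definition Kb :: "complex \<Rightarrow> complex" where
  "Kb l = f (2 * l + 2 * \<gamma>) / f (2 * l)"

lemma cross_uminus:
  "f (- x) = - f x" "- x \<noteq> 0 \<longleftrightarrow> x \<noteq> (0 :: complex)"
  "- t - \<gamma> = - (t + \<gamma>)" "- t + \<gamma> = - (t - \<gamma>)"
  "- t - 2 * \<gamma> = - (t + 2 * \<gamma>)" "- t + 2 * \<gamma> = - (t - 2 * \<gamma>)"
  "Kdp (- t) l = Kdm t l" "Kap (- t) l = Kam t l" "Kdm (- t) l = Kdp t l" "Kam (- t) l = Kap t l"
proof -
  have 1: "f (- t) = - f t" "f (- t + \<gamma>) = - f (t - \<gamma>)" "f (- t + (2 * l + \<gamma>)) = -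
      f (t - (2 * l + \<gamma>))"
    "f (- t - \<gamma>) = - f (t + \<gamma>)" "f (- t - (2 * l + \<gamma>)) = - f (t + (2 * l + \<gamma>))"
    by (auto intro!: f_cong_minus)
  show "Kdp (- t) l = Kdm t l" "Kap (- t) l = Kam t l" "Kdm (- t) l = Kdp t l" "Kam (- t) l =
      Kap t l"
    unfolding Kdp_def Kap_def Kdm_def Kam_def 1 by simp_all
qed (auto intro!: f_cong_minus)

text \<open>
  \<open>cross_abxy_cd\<close> compares the coefficients of the block \<open>c d\<close> of the shorter chain in the block \<open>a b\<close> of the
  longer chain, with \<open>x\<close> and \<open>y\<close> the outgoing and incoming spin of the added site.
\<close>

lemma cross_pppp_pp:
  assumes nz: "f t \<noteq> 0" "f (t - \<gamma>) \<noteq> 0" "f (2 * l) \<noteq> 0"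
  shows "- (Ra (- l - m - \<gamma>) * Ra (m - l - \<gamma>) * Kap t l) = Kdp (t - \<gamma>) l * Rcm (l - m) t *
      Rcm (l + m) t - Kap (t - \<gamma>) l * Ra (l - m) * Ra (l + m)"
proof -
  have eqs: "f (- l - m - \<gamma> + \<gamma>) = (- f (l + m))"
    "f (m - l - \<gamma> + \<gamma>) = (- f (l - m))"
    "f (t + (2 * l + \<gamma>)) = f (t + 2 * l + \<gamma>)" "f (t - \<gamma> + \<gamma>) = f t"
    "f (t + (l - m)) = f (t + l - m)" "f (t + (l + m)) = f (t + l + m)"
    "f (t - \<gamma> + (2 * l + \<gamma>)) = f (t + 2 * l)"
    "f (l - m + \<gamma>) = f (l + \<gamma> - m)"
    by ((rule f_congs, simp add: algebra_simps)+)
  have e0: "f (l - m) * f (l + m) * f (t - \<gamma>) * f (t + 2 * l + \<gamma>)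
      = f (t + 2 * l) * (- f t) * (- f (l + m + \<gamma>)) * f (l + \<gamma> - m)
      + f (t + l + m) * f (t + l - m) * f (2 * l + \<gamma>) * (- f \<gamma>)"
    by (rule f_three_term_inst[of "l - m" "l + m" "t - \<gamma>" "t + 2 * l + \<gamma>" "t + 2 * l"])
      ((rule f_congs | simp add: algebra_simps)+)
  show ?thesis using e0 nz unfolding Ra_def Kap_def Kdp_def Rcm_def eqs
    by (simp add: divide_simps) algebra
qed

lemma cross_pppp_mm:
  assumes nz: "f t \<noteq> 0" "f (t - \<gamma>) \<noteq> 0" "f (2 * l) \<noteq> 0"
  shows "Ra (- l - m - \<gamma>) * Ra (m - l - \<gamma>) * Kdp t l = Kdp (t - \<gamma>) l * Rbm (l - m) t *
      Rbp (l + m) t"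
proof -
  have eqs: "f (- l - m - \<gamma> + \<gamma>) = (- f (l + m))"
    "f (m - l - \<gamma> + \<gamma>) = (- f (l - m))" "f (t - \<gamma> + \<gamma>) = f t"
    by ((rule f_congs, simp add: algebra_simps)+)
  show ?thesis using nz unfolding Ra_def Kdp_def Rbm_def Rbp_def eqs
    by (simp add: divide_simps)
qed

lemma cross_pppm_pm:
  assumes nz: "f t \<noteq> 0" "f (t - \<gamma>) \<noteq> 0" "f (t - 2 * \<gamma>) \<noteq> 0" "f (2 * l) \<noteq> 0"
  shows "- (Ra (- l - m - \<gamma>) * Rcp (m - l - \<gamma>) (t - 2 * \<gamma>) * Kb l) = Kdp (t - \<gamma>) l *
      Rcm (l - m) t * Ra (l + m) - Kap (t - \<gamma>) l * Ra (l - m) * Rcp (l + m) (t - 2 * \<gamma>)"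
proof -
  have eqs: "f (- l - m - \<gamma> + \<gamma>) = (- f (l + m))"
    "f (t - 2 * \<gamma> - (m - l - \<gamma>)) = f (t + l - m - \<gamma>)"
    "f (t - \<gamma> + \<gamma>) = f t" "f (t + (l - m)) = f (t + l - m)"
    "f (t - \<gamma> + (2 * l + \<gamma>)) = f (t + 2 * l)"
    "f (l - m + \<gamma>) = f (l + \<gamma> - m)"
    "f (t - 2 * \<gamma> - (l + m)) = f (t - l - m - 2 * \<gamma>)"
    by ((rule f_congs, simp add: algebra_simps)+)
  have e0: "f (l + m) * f (2 * l + 2 * \<gamma>) * f (t - \<gamma>) * f (t + l - m - \<gamma>)
      = f (t + 2 * l) * (- f (t - l - m - 2 * \<gamma>)) * (- f (l + \<gamma> - m)) * (- f \<gamma>)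
      + f (t + l - m) * f (t - 2 * \<gamma>) * f (2 * l + \<gamma>) * f (l + m + \<gamma>)"
    by (rule f_three_term_inst[of "l + m" "2 * l + 2 * \<gamma>" "t - \<gamma>" "t + l - m - \<gamma>" "t + 2 * l"])
      ((rule f_congs | simp add: algebra_simps)+)
  show ?thesis using e0 nz unfolding Ra_def Rcp_def Kb_def Kdp_def Rcm_def Kap_def eqs
    by (simp add: divide_simps) algebra
qed

lemma cross_ppmp_mp:
  assumes nz: "f (t + 2 * \<gamma>) \<noteq> 0" "f (t + \<gamma>) \<noteq> 0" "f t \<noteq> 0" "f (2 * l) \<noteq> 0"
  shows "- (Rcp (- l - m - \<gamma>) t * Ra (m - l - \<gamma>) * Kb l) = Kdp (t + \<gamma>) l * Ra (l - m) *
      Rcm (l + m) (t + 2 * \<gamma>) - Kap (t + \<gamma>) l * Rcp (l - m) t * Ra (l + m)"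
proof -
  have eqs: "f (t - (- l - m - \<gamma>)) = f (t + l + m + \<gamma>)"
    "f (m - l - \<gamma> + \<gamma>) = (- f (l - m))"
    "f (t + \<gamma> + \<gamma>) = f (t + 2 * \<gamma>)"
    "f (l - m + \<gamma>) = f (l + \<gamma> - m)"
    "f (t + 2 * \<gamma> + (l + m)) = f (t + l + m + 2 * \<gamma>)"
    "f (t + \<gamma> + (2 * l + \<gamma>)) = f (t + 2 * l + 2 * \<gamma>)"
    "f (t - (l - m)) = f (t + m - l)"
    by ((rule f_congs, simp add: algebra_simps)+)
  have e0: "f (l - m) * f (2 * l + 2 * \<gamma>) * f (t + \<gamma>) * f (t + l + m + \<gamma>)
      = f (t + 2 * l + 2 * \<gamma>) * (- f (t + m - l)) * (- f (l + m + \<gamma>)) * (- f \<gamma>)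
      + f (t + l + m + 2 * \<gamma>) * f t * f (2 * l + \<gamma>) * f (l + \<gamma> - m)"
    by (rule f_three_term_inst[of "l - m" "2 * l + 2 * \<gamma>" "t + \<gamma>" "t + l + m + \<gamma>" "t + 2 * l + 2 *
        \<gamma>"])
      ((rule f_congs | simp add: algebra_simps)+)
  show ?thesis using e0 nz unfolding Rcp_def Ra_def Kb_def Kdp_def Rcm_def Kap_def eqs
    by (simp add: divide_simps) algebra
qed

lemma cross_ppmm_pp:
  assumes nz: "f (t + \<gamma>) \<noteq> 0" "f t \<noteq> 0" "f (2 * l) \<noteq> 0"
  shows "- (Rbp (- l - m - \<gamma>) t * Rbm (m - l - \<gamma>) t * Kap t l) + Rcp (- l - m - \<gamma>) t *
      Rcp (m - l - \<gamma>) t * Kdm t l = - (Kap (t + \<gamma>) l * Rbp (l - m) t * Rbm (l + m) t)"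
proof -
  have eqs: "f (- l - m - \<gamma>) = (- f (l + m + \<gamma>))"
    "f (m - l - \<gamma>) = (- f (l + \<gamma> - m))"
    "f (t + (2 * l + \<gamma>)) = f (t + 2 * l + \<gamma>)"
    "f (t - (- l - m - \<gamma>)) = f (t + l + m + \<gamma>)"
    "f (t - (m - l - \<gamma>)) = f (t + l + \<gamma> - m)"
    "f (t + \<gamma> + (2 * l + \<gamma>)) = f (t + 2 * l + 2 * \<gamma>)"
    by ((rule f_congs, simp add: algebra_simps)+)
  have e0: "f (l + \<gamma> - m) * f (l + m + \<gamma>) * f (t + \<gamma>) * f (t + 2 * l + \<gamma>)
      = f (t + 2 * l + 2 * \<gamma>) * (- f t) * (- f (l + m)) * f (l - m)
      + f (t + l + m + \<gamma>) * f (t + l + \<gamma> - m) * f (2 * l + \<gamma>) * f \<gamma>"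
    by (rule f_three_term_inst[of "l + \<gamma> - m" "l + m + \<gamma>" "t + \<gamma>" "t + 2 * l + \<gamma>" "t + 2 * l + 2 *
        \<gamma>"])
      ((rule f_congs | simp add: algebra_simps)+)
  show ?thesis using e0 nz unfolding Rbp_def Rbm_def Kap_def Rcp_def Kdm_def eqs
    by (simp add: divide_simps) algebra
qed

lemma cross_ppmm_mm:
  assumes nz: "f (t + \<gamma>) \<noteq> 0" "f t \<noteq> 0" "f (2 * l) \<noteq> 0"
  shows "Rbp (- l - m - \<gamma>) t * Rbm (m - l - \<gamma>) t * Kdp t l - Rcp (- l - m - \<gamma>) t *
      Rcp (m - l - \<gamma>) t * Kam t l = Kdp (t + \<gamma>) l * Ra (l - m) * Ra (l + m) - Kap (t + \<gamma>) l *
      Rcp (l - m) t * Rcp (l + m) t"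
proof -
  have eqs: "f (- l - m - \<gamma>) = (- f (l + m + \<gamma>))"
    "f (m - l - \<gamma>) = (- f (l + \<gamma> - m))"
    "f (t - (- l - m - \<gamma>)) = f (t + l + m + \<gamma>)"
    "f (t - (m - l - \<gamma>)) = f (t + l + \<gamma> - m)"
    "f (t - (2 * l + \<gamma>)) = f (t - 2 * l - \<gamma>)"
    "f (t + \<gamma> + \<gamma>) = f (t + 2 * \<gamma>)"
    "f (l - m + \<gamma>) = f (l + \<gamma> - m)"
    "f (t + \<gamma> + (2 * l + \<gamma>)) = f (t + 2 * l + 2 * \<gamma>)"
    "f (t - (l - m)) = f (t + m - l)" "f (t - (l + m)) = f (t - l - m)"
    by ((rule f_congs, simp add: algebra_simps)+)
  have e0: "f (t - \<gamma>) * f (t + \<gamma>) * f (t + \<gamma>) * f (t + \<gamma>)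
      = f (2 * t + \<gamma>) * (- f \<gamma>) * (- f \<gamma>) * (- f \<gamma>)
      + f (t + 2 * \<gamma>) * f t * f t * f t"
    by (rule f_three_term_inst[of "t - \<gamma>" "t + \<gamma>" "t + \<gamma>" "t + \<gamma>" "2 * t + \<gamma>"])
      ((rule f_congs | simp add: algebra_simps)+)
  have e1: "f (t - 2 * l - \<gamma>) * f (t + \<gamma>) * f (t + l + \<gamma> - m) * f (t + l + m + \<gamma>)
      = f (2 * t + \<gamma>) * (- f (2 * l + \<gamma>)) * (- f (l + m + \<gamma>)) * (- f (l + \<gamma> - m))
      + f (t + 2 * l + 2 * \<gamma>) * f t * f (t + m - l) * f (t - l - m)"
    by (rule f_three_term_inst[of "t - 2 * l - \<gamma>" "t + \<gamma>" "t + l + \<gamma> - m" "t + l + m + \<gamma>" "2 * t +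
        \<gamma>"])
      ((rule f_congs | simp add: algebra_simps)+)
  show ?thesis using e0 e1 nz unfolding Rbp_def Rbm_def Kdp_def Rcp_def Kam_def Ra_def Kap_def eqs
    by (simp add: divide_simps) algebra
qed

lemma cross_pmpp_pm:
  assumes nz: "f (t - 2 * \<gamma>) \<noteq> 0" "f (2 * l) \<noteq> 0"
  shows "- (Ra (- l - m - \<gamma>) * Rbp (m - l - \<gamma>) (t - 2 * \<gamma>) * Kb l) = -
      (Kb l * Ra (l - m) * Rbp (l + m) (t - 2 * \<gamma>))"
proof -
  have eqs: "f (- l - m - \<gamma> + \<gamma>) = (- f (l + m))"
    "f (m - l - \<gamma>) = (- f (l + \<gamma> - m))"
    "f (t - 2 * \<gamma> - \<gamma>) = f (t - 3 * \<gamma>)"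
    "f (l - m + \<gamma>) = f (l + \<gamma> - m)"
    by ((rule f_congs, simp add: algebra_simps)+)
  show ?thesis using nz unfolding Ra_def Rbp_def Kb_def eqs
    by (simp add: divide_simps)
qed

lemma cross_pmmp_pp:
  assumes nz: "f t \<noteq> 0" "f (2 * l) \<noteq> 0"
  shows "- (Rbp (- l - m - \<gamma>) t * Rcm (m - l - \<gamma>) t * Kap t l) + Rcp (- l - m - \<gamma>) t *
      Rbp (m - l - \<gamma>) t * Kdm t l = - (Kb l * Rbp (l - m) t * Rcm (l + m) t)"
proof -
  have eqs: "f (- l - m - \<gamma>) = (- f (l + m + \<gamma>))"
    "f (t + (m - l - \<gamma>)) = f (t + m - l - \<gamma>)"
    "f (t + (2 * l + \<gamma>)) = f (t + 2 * l + \<gamma>)"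
    "f (t - (- l - m - \<gamma>)) = f (t + l + m + \<gamma>)"
    "f (m - l - \<gamma>) = (- f (l + \<gamma> - m))" "f (t + (l + m)) = f (t + l + m)"
    by ((rule f_congs, simp add: algebra_simps)+)
  have e0: "f \<gamma> * f (l + m + \<gamma>) * f (t + m - l - \<gamma>) * f (t + 2 * l + \<gamma>)
      = f (t + l + m + \<gamma>) * (- f (t - \<gamma>)) * (- f (2 * l + \<gamma>)) * f (l + \<gamma> - m)
      + f (t + l + m) * f t * f (2 * l + 2 * \<gamma>) * (- f (l - m))"
    by (rule f_three_term_inst[of "\<gamma>" "l + m + \<gamma>" "t + m - l - \<gamma>" "t + 2 * l + \<gamma>" "t + l + m + \<gamma>"])
      ((rule f_congs | simp add: algebra_simps)+)
  show ?thesis using e0 nz unfolding Rbp_def Rcm_def Kap_def Rcp_def Kdm_def Kb_def eqs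
    by (simp add: divide_simps) algebra
qed

lemma cross_pmmp_mm:
  assumes nz: "f t \<noteq> 0" "f (2 * l) \<noteq> 0"
  shows "Rbp (- l - m - \<gamma>) t * Rcm (m - l - \<gamma>) t * Kdp t l - Rcp (- l - m - \<gamma>) t *
      Rbp (m - l - \<gamma>) t * Kam t l = - (Kb l * Rcp (l - m) t * Rbp (l + m) t)"
proof -
  have eqs: "f (- l - m - \<gamma>) = (- f (l + m + \<gamma>))"
    "f (t + (m - l - \<gamma>)) = f (t + m - l - \<gamma>)"
    "f (t - (- l - m - \<gamma>)) = f (t + l + m + \<gamma>)"
    "f (m - l - \<gamma>) = (- f (l + \<gamma> - m))"
    "f (t - (2 * l + \<gamma>)) = f (t - 2 * l - \<gamma>)" "f (t - (l - m)) = f (t + m - l)"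
    by ((rule f_congs, simp add: algebra_simps)+)
  have e0: "f (l + m + \<gamma>) * f (2 * l + \<gamma>) * f (t + m - l - \<gamma>) * f (t + \<gamma>)
      = f (t + l + m + \<gamma>) * (- f (t - 2 * l - \<gamma>)) * (- f (l + \<gamma> - m)) * f \<gamma>
      + f t * f (t + m - l) * f (2 * l + 2 * \<gamma>) * f (l + m)"
    by (rule f_three_term_inst[of "l + m + \<gamma>" "2 * l + \<gamma>" "t + m - l - \<gamma>" "t + \<gamma>" "t + l + m + \<gamma>"])
      ((rule f_congs | simp add: algebra_simps)+)
  show ?thesis using e0 nz unfolding Rbp_def Rcm_def Kdp_def Rcp_def Kam_def Kb_def eqs
    by (simp add: divide_simps) algebra
qed

lemma cross_pmmm_pm:
  assumes nz: "f t \<noteq> 0" "f (2 * l) \<noteq> 0"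
  shows "- (Rbp (- l - m - \<gamma>) t * Ra (m - l - \<gamma>) * Kb l) = - (Kb l * Rbp (l - m) t * Ra (l + m))"
proof -
  have eqs: "f (- l - m - \<gamma>) = (- f (l + m + \<gamma>))"
    "f (m - l - \<gamma> + \<gamma>) = (- f (l - m))"
    by ((rule f_congs, simp add: algebra_simps)+)
  show ?thesis using nz unfolding Rbp_def Ra_def Kb_def eqs
    by (simp add: divide_simps)
qed

text \<open>Spin reversal is the substitution t -> -t, so the entries of the opposite weight need no
  new theta identity.\<close>

lemmas cross_mppp_mp =
  cross_pmmm_pm[where t = "- t" for t, unfolded cross_uminus entries_uminus]

lemmas cross_mppm_pp =
  cross_pmmp_mm[where t = "- t" for t, unfolded cross_uminus entries_uminus]

lemmas cross_mppm_mm =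
  cross_pmmp_pp[where t = "- t" for t, unfolded cross_uminus entries_uminus]

lemmas cross_mpmm_mp =
  cross_pmpp_pm[where t = "- t" for t, unfolded cross_uminus entries_uminus]

lemmas cross_mmpp_pp =
  cross_ppmm_mm[where t = "- t" for t, unfolded cross_uminus entries_uminus]

lemmas cross_mmpp_mm =
  cross_ppmm_pp[where t = "- t" for t, unfolded cross_uminus entries_uminus]

lemmas cross_mmpm_pm =
  cross_ppmp_mp[where t = "- t" for t, unfolded cross_uminus entries_uminus]

lemmas cross_mmmp_mp =
  cross_pppm_pm[where t = "- t" for t, unfolded cross_uminus entries_uminus]

lemmas cross_mmmm_pp =
  cross_pppp_mm[where t = "- t" for t, unfolded cross_uminus entries_uminus]

lemmas cross_mmmm_mm =
  cross_pppp_pp[where t = "- t" for t, unfolded cross_uminus entries_uminus]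

text \<open>Crossing for the chain without sites, with t = theta and z = zeta: the boundary matrix
  already obeys the relation that the sites will preserve.\<close>

lemma K_cross_p:
  assumes nz: "f t \<noteq> 0" "f (2 * l) \<noteq> 0"
  shows "f (z - l - \<gamma>) * f (t + z + l + \<gamma>) = Kdp t l * f (z - l) * f (t + z + l) - Kap t l *
      f (z + l) * f (t + z - l)"
proof -
  have eqs: "f (t + (2 * l + \<gamma>)) = f (t + 2 * l + \<gamma>)"
    by ((rule f_congs, simp add: algebra_simps)+)
  have e0: "f (2 * l) * f (z - l - \<gamma>) * f t * f (t + z + l + \<gamma>)
      = f (t + z + l) * (- f (t + \<gamma>)) * (- f (z - l)) * f (2 * l + \<gamma>)
      + f (t + z - l) * f (t + 2 * l + \<gamma>) * f (z + l) * (- f \<gamma>)"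
    by (rule f_three_term_inst[of "2 * l" "z - l - \<gamma>" "t" "t + z + l + \<gamma>" "t + z + l"])
      ((rule f_congs | simp add: algebra_simps)+)
  show ?thesis using e0 nz unfolding Kdp_def Kap_def eqs
    by (simp add: divide_simps) algebra
qed

lemma K_cross_m:
  assumes nz: "f t \<noteq> 0" "f (2 * l) \<noteq> 0"
  shows "f (z + l + \<gamma>) * f (t + z - l - \<gamma>) = Kdm t l * f (z + l) * f (t + z - l) - Kam t l *
      f (z - l) * f (t + z + l)"
proof -
  have eqs: "f (t - (2 * l + \<gamma>)) = f (t - 2 * l - \<gamma>)"
    by ((rule f_congs, simp add: algebra_simps)+)
  have e0: "f (2 * l) * f (z + l + \<gamma>) * f t * f (t + z - l - \<gamma>)
      = f (t + z + l) * (- f (t - 2 * l - \<gamma>)) * (- f (z - l)) * (- f \<gamma>)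
      + f (t + z - l) * f (t - \<gamma>) * f (z + l) * f (2 * l + \<gamma>)"
    by (rule f_three_term_inst[of "2 * l" "z + l + \<gamma>" "t" "t + z - l - \<gamma>" "t + z + l"])
      ((rule f_congs | simp add: algebra_simps)+)
  show ?thesis using e0 nz unfolding Kdm_def Kam_def eqs
    by (simp add: divide_simps) algebra
qed

section \<open>The blocks A, B, C, D of the monodromy (spin pairs TT, TF, FT, FF) and their
  crossing\<close>

definition blk :: "complex list \<Rightarrow> complex \<Rightarrow> bool \<Rightarrow> bool \<Rightarrow> (bool list \<Rightarrow> complex) \<Rightarrow> bool list \<Rightarrow>
    complex" where
  "blk ms l a b \<phi> xs = mon ms l (\<lambda>d ys. if d = b then \<phi> ys else 0) a xs"

lemma mon_blk: "mon ms l \<psi> a xs = blk ms l a True (\<psi> True) xs + blk ms l a False (\<psi> False) xs"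
proof -
  have "\<psi> = (\<lambda>d ys. (if d = True then \<psi> True ys else 0) + (if d = False then \<psi> False ys else 0))"
    by (intro ext) auto
  then show ?thesis unfolding blk_def mon_add[symmetric] by simp
qed

lemma blk_add: "blk ms l a b (\<lambda>ys. \<phi> ys + \<xi> ys) xs = blk ms l a b \<phi> xs + blk ms l a b \<xi> xs"
  unfolding blk_def mon_add[symmetric] by (rule arg_cong[of _ _ "\<lambda>\<psi>. mon ms l \<psi> a xs"])
      (auto simp: fun_eq_iff)

text \<open>With both auxiliary spins fixed, conservation of the total spin determines the incoming
  weight of the sites from the outgoing one.\<close>

lemma blk_weight:
  "blk ms l a b (\<lambda>ys. F (wt ys) * \<phi> ys) xs = F (wt xs + h a - h b) * blk ms l a b \<phi> xs"
proof -
  have "(\<lambda>d ys. if d = b then F (wt ys) * \<phi> ys else 0) =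
     (\<lambda>d ys. (\<lambda>w n. F (w - h b)) (h d + wt ys) (length ys) * (if d = b then \<phi> ys else 0))"
    by (auto simp: fun_eq_iff)
  then have "blk ms l a b (\<lambda>ys. F (wt ys) * \<phi> ys) xs =
      (\<lambda>w n. F (w - h b)) (h a + wt xs) (length xs) * blk ms l a b \<phi> xs"
    unfolding blk_def by (simp only: mon_weight[where F = "\<lambda>w n. F (w - h b)"])
  then show ?thesis by (simp add: algebra_simps)
qed

lemma blk_cmult: "blk ms l a b (\<lambda>ys. c * \<phi> ys) xs = c * blk ms l a b \<phi> xs"
  using blk_weight[of ms l a b "\<lambda>_. c"] by simp

lemma blk_zero [simp]: "blk ms l a b (\<lambda>ys. 0) xs = 0"
  using blk_cmult[of ms l a b 0] by simp

lemma blk_sum_bool: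
  "blk ms l a b (\<lambda>ys. \<Sum>p\<in>(UNIV :: bool set). \<phi> p ys) xs = (\<Sum>p\<in>UNIV. blk ms l a b (\<phi> p) xs)"
  by (simp add: UNIV_bool blk_add)

lemma blk_guard:
  "n = length ms \<Longrightarrow> blk ms l a b (\<lambda>ys. if length ys = n then \<phi> ys else 0) xs = blk ms l a b \<phi> xs"
proof -
  assume "n = length ms"
  then have "blk ms l a b \<phi> xs = mon ms l (\<lambda>d ys. if length ys =
      n then (if d = b then \<phi> ys else 0) else 0) a xs"
    unfolding blk_def by (simp only: mon_guard)
  also have "(\<lambda>d ys. if length ys = n then (if d = b then \<phi> ys else 0) else 0) =
    (\<lambda>d ys. if d = b then (if length ys = n then \<phi> ys else 0) else 0)" by (auto simp: fun_eq_iff)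
  finally show ?thesis by (simp only: blk_def)
qed

lemma blk_Nil: "blk [] l a b \<phi> [] = (if a = b then kk l a * \<phi> [] else 0)"
  by (simp add: blk_def)

lemma blk_Cons:
  "blk (m # ms) l a b \<phi> (x # xs) =
    (\<Sum>c\<in>UNIV. \<Sum>u\<in>UNIV. \<Sum>d\<in>UNIV. \<Sum>y\<in>UNIV. R (l - m) (height xs) a x c u *
       R (l + m) (\<theta> - \<gamma> * of_int (wt xs + h c - h d)) u d y b * blk ms l c d (\<lambda>ys. \<phi> (y # ys)) xs)"
proof -
  have 1: "(\<lambda>d ys. \<Sum>y\<in>UNIV. \<Sum>b'\<in>UNIV. R (l + m) (height ys) u d y b' *
      (if b' = b then \<phi> (y # ys) else 0)) =
    (\<lambda>d ys. \<Sum>y\<in>UNIV. R (l + m) (height ys) u d y b * \<phi> (y # ys))" for u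
    by (auto simp: fun_eq_iff if_distrib[of "\<lambda>z. _ * z"] cong: if_cong)
  have 2: "blk ms l c d (\<lambda>ys. R (l + m) (height ys) u d y b * \<phi> (y # ys)) xs =
    R (l + m) (\<theta> - \<gamma> * of_int (wt xs + h c - h d)) u d y b * blk ms l c d (\<lambda>ys. \<phi> (y # ys)) xs"
        for c d u y
    by (rule blk_weight[where F = "\<lambda>w. R (l + m) (\<theta> - \<gamma> * of_int w) u d y b"])
  have 3: "mon ms l (\<lambda>d ys. \<Sum>y\<in>UNIV. R (l + m) (height ys) u d y b * \<phi> (y # ys)) c xs =
    (\<Sum>d\<in>UNIV. \<Sum>y\<in>UNIV. R (l + m) (\<theta> - \<gamma> * of_int (wt xs + h c - h d)) u d y b *
        blk ms l c d (\<lambda>ys. \<phi> (y # ys)) xs)" for c u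
    unfolding mon_blk blk_sum_bool 2 by (simp add: UNIV_bool)
  show ?thesis unfolding blk_def[of "m # ms"] mon.simps 1 3
      by (simp add: sum_distrib_left mult.assoc)
qed

lemma kk_crossing:
  assumes "f \<theta> \<noteq> 0" "f (2 * l) \<noteq> 0"
  shows "kk (- l - \<gamma>) True = Kdp \<theta> l * kk l False - Kap \<theta> l * kk l True"
    and "kk (- l - \<gamma>) False = Kdm \<theta> l * kk l True - Kam \<theta> l * kk l False"
  using K_cross_p[of \<theta> l \<zeta>] K_cross_m[of \<theta> l \<zeta>] assms unfolding kk_def
      by (simp_all add: algebra_simps)

text \<open>The recursion mixes the blocks of the shorter chain, so the four relations are carried
  through one induction. At each step the claim is compared coefficient by coefficient in the values
  \<open>Y c d y\<close> of the shorter chain.\<close>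

lemma crossing_all:
  assumes "\<And>k. \<bar>k\<bar> \<le> int (Suc (length ms)) \<Longrightarrow> f (\<theta> + of_int k * \<gamma>) \<noteq> 0" and l: "f (2 * l) \<noteq> 0"
    and "length xs = length ms"
  shows "blk ms (- l - \<gamma>) True True \<phi> xs =
      Kdp (height xs) l * blk ms l False False \<phi> xs
      - Kap (height xs) l * blk ms l True True \<phi> xs \<and>
    blk ms (- l - \<gamma>) False False \<phi> xs =
      Kdm (height xs) l * blk ms l True True \<phi> xs
      - Kam (height xs) l * blk ms l False False \<phi> xs \<and>
    blk ms (- l - \<gamma>) True False \<phi> xs = - (Kb l * blk ms l True False \<phi> xs) \<and>
    blk ms (- l - \<gamma>) False True \<phi> xs = - (Kb l * blk ms l False True \<phi> xs)"
  using assms(1,3)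
proof (induction ms arbitrary: xs \<phi>)
  case Nil
  then show ?case using kk_crossing[OF _ l] Nil(1)[of 0] by (simp add: blk_Nil left_diff_distrib)
next
  case (Cons m ms)
  note nz = Cons.prems(1)
  obtain x ys where xs: "xs = x # ys" "length ys = length ms"
    using Cons.prems(2) by (cases xs) auto
  define t where "t = \<theta> - \<gamma> * of_int (wt ys)"
  \<comment> \<open>Heights t - 2 gamma and t + 2 gamma arise when the inner block changes the spin.
    The bound for \<open>m # ms\<close> exceeds the length of \<open>ms\<close> by two, which just
    covers them.\<close>
  have nz': "f t \<noteq> 0" "f (t + \<gamma>) \<noteq> 0" "f (t - \<gamma>) \<noteq> 0" "f (t + 2 * \<gamma>) \<noteq> 0" "f (t - 2 * \<gamma>) \<noteq> 0"
    using nz[of "- wt ys"] nz[of "- wt ys - 1"] nz[of "- wt ys + 1"] nz[of "- wt ys - 2"]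
        nz[of "- wt ys + 2"]
      abs_wt_le[of ys] xs(2) by (auto simp: t_def algebra_simps)
  have dyn: "\<theta> - \<gamma> * of_int (wt ys + h c - h d) =
      (if c = d then t else if c then t - 2 * \<gamma> else t + 2 * \<gamma>)" for c d
    by (auto simp: t_def h_def algebra_simps)
  have eta: "\<theta> - \<gamma> * of_int (wt (x # ys)) = (if x then t - \<gamma> else t + \<gamma>)" for x
    by (auto simp: t_def h_def algebra_simps)
  define Y where "Y c d y = blk ms l c d (\<lambda>zs. \<phi> (y # zs)) ys" for c d y
  have IH: "blk ms (- l - \<gamma>) True True (\<lambda>zs. \<phi> (y # zs)) ys = Kdp t l * Y False False y -
      Kap t l * Y True True y"
    "blk ms (- l - \<gamma>) False False (\<lambda>zs. \<phi> (y # zs)) ys = Kdm t l * Y True True y - Kam t l *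
        Y False False y"
    "blk ms (- l - \<gamma>) True False (\<lambda>zs. \<phi> (y # zs)) ys = - (Kb l * Y True False y)"
    "blk ms (- l - \<gamma>) False True (\<lambda>zs. \<phi> (y # zs)) ys = - (Kb l * Y False True y)" for y
    unfolding t_def Y_def using Cons.IH[of ys "\<lambda>zs. \<phi> (y # zs)"] nz xs(2) by simp_all
  have Cl: "blk (m # ms) l a b \<phi> (x # ys) = (\<Sum>c\<in>UNIV. \<Sum>u\<in>UNIV. \<Sum>d\<in>UNIV. \<Sum>y\<in>UNIV. R (l - m) t a x c
      u *
       R (l + m) (if c = d then t else if c then t - 2 * \<gamma> else t + 2 * \<gamma>) u d y b * Y c d y)"
           for a b
    unfolding blk_Cons dyn Y_def t_def[symmetric] ..
  have Cm: "blk (m # ms) (- l - \<gamma>) a b \<phi> (x # ys) =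
      (\<Sum>c\<in>UNIV. \<Sum>u\<in>UNIV. \<Sum>d\<in>UNIV. \<Sum>y\<in>UNIV. R (- l - \<gamma> - m) t a x c u *
       R (- l - \<gamma> + m) (if c = d then t else if c then t - 2 * \<gamma> else t + 2 * \<gamma>) u d y b *
           blk ms (- l - \<gamma>) c d (\<lambda>zs. \<phi> (y # zs)) ys)" for a b
    unfolding blk_Cons dyn t_def[symmetric] ..
  have args: "- l - \<gamma> - m = - l - m - \<gamma>" "- l - \<gamma> + m = m - l - \<gamma>" by simp_all
  note Cm = Cm[unfolded args]
  show ?case
  proof (cases x)
    case True
    have pp: "blk (m # ms) (- l - \<gamma>) True True \<phi> (x # ys) =
        Kdp (t - \<gamma>) l * blk (m # ms) l False False \<phi> (x # ys) - Kap (t - \<gamma>) l *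
            blk (m # ms) l True True \<phi> (x # ys)"
      unfolding Cl Cm using cross_pppp_pp[of t l m] cross_pppp_mm[of t l m]
          cross_pppm_pm[of t l m] nz' l
      by (simp add: IH UNIV_bool R_entries True del: mult_cancel_left mult_cancel_right
          neg_equal_iff_equal) algebra
    have pm: "blk (m # ms) (- l - \<gamma>) True False \<phi> (x # ys) =
        - (Kb l * blk (m # ms) l True False \<phi> (x # ys))"
      unfolding Cl Cm using cross_pmpp_pm[of t l m] nz' l
      by (simp add: IH UNIV_bool R_entries True del: mult_cancel_left mult_cancel_right
          neg_equal_iff_equal) algebra
    have mp: "blk (m # ms) (- l - \<gamma>) False True \<phi> (x # ys) =
        - (Kb l * blk (m # ms) l False True \<phi> (x # ys))"
      unfolding Cl Cm using cross_mppp_mp[of t l m] cross_mppm_pp[of t l m]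
          cross_mppm_mm[of t l m] nz' l
      by (simp add: IH UNIV_bool R_entries True del: mult_cancel_left mult_cancel_right
          neg_equal_iff_equal) algebra
    have mm: "blk (m # ms) (- l - \<gamma>) False False \<phi> (x # ys) =
        Kdm (t - \<gamma>) l * blk (m # ms) l True True \<phi> (x # ys) - Kam (t - \<gamma>) l *
            blk (m # ms) l False False \<phi> (x # ys)"
      unfolding Cl Cm using cross_mmpp_pp[of t l m] cross_mmpp_mm[of t l m]
          cross_mmpm_pm[of t l m] nz' l
      by (simp add: IH UNIV_bool R_entries True del: mult_cancel_left mult_cancel_right
          neg_equal_iff_equal) algebra
    show ?thesis unfolding xs(1) eta using pp mm pm mp True by simp
  next
    case False
    have pp: "blk (m # ms) (- l - \<gamma>) True True \<phi> (x # ys) =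
        Kdp (t + \<gamma>) l * blk (m # ms) l False False \<phi> (x # ys) - Kap (t + \<gamma>) l *
            blk (m # ms) l True True \<phi> (x # ys)"
      unfolding Cl Cm using cross_ppmp_mp[of t l m] cross_ppmm_pp[of t l m]
          cross_ppmm_mm[of t l m] nz' l
      by (simp add: IH UNIV_bool R_entries False del: mult_cancel_left mult_cancel_right
          neg_equal_iff_equal) algebra
    have pm: "blk (m # ms) (- l - \<gamma>) True False \<phi> (x # ys) =
        - (Kb l * blk (m # ms) l True False \<phi> (x # ys))"
      unfolding Cl Cm using cross_pmmp_pp[of t l m] cross_pmmp_mm[of t l m]
          cross_pmmm_pm[of t l m] nz' l
      by (simp add: IH UNIV_bool R_entries False del: mult_cancel_left mult_cancel_right
          neg_equal_iff_equal) algebra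
    have mp: "blk (m # ms) (- l - \<gamma>) False True \<phi> (x # ys) =
        - (Kb l * blk (m # ms) l False True \<phi> (x # ys))"
      unfolding Cl Cm using cross_mpmm_mp[of t l m] nz' l
      by (simp add: IH UNIV_bool R_entries False del: mult_cancel_left mult_cancel_right
          neg_equal_iff_equal) algebra
    have mm: "blk (m # ms) (- l - \<gamma>) False False \<phi> (x # ys) =
        Kdm (t + \<gamma>) l * blk (m # ms) l True True \<phi> (x # ys) - Kam (t + \<gamma>) l *
            blk (m # ms) l False False \<phi> (x # ys)"
      unfolding Cl Cm using cross_mmmp_mp[of t l m] cross_mmmm_pp[of t l m]
          cross_mmmm_mm[of t l m] nz' l
      by (simp add: IH UNIV_bool R_entries False del: mult_cancel_left mult_cancel_right
          neg_equal_iff_equal) algebra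
    show ?thesis unfolding xs(1) eta using pp mm pm mp False by simp
  qed
qed

section \<open>Exchange relations\<close>

text \<open>Coefficients of A(u)B(v) = al B(v)A(u) - be1 B(u)A(v) - be2 B(u)A(-v-gamma). The last
  two are tied by crossing: where f(2v) is nonzero, be1 at -v-gamma equals - Kb v times be2 at v, in
  accordance with B(-v-gamma) = - Kb v B(v).\<close>

definition al :: "complex \<Rightarrow> complex \<Rightarrow> complex" where
  "al u v = f (v - u + \<gamma>) * f (v + u) / (f (v - u) * f (v + u + \<gamma>))"
definition be1 :: "complex \<Rightarrow> complex \<Rightarrow> complex \<Rightarrow> complex" where
  "be1 e u v = f (2 * v) * f \<gamma> * f (e + \<gamma> + v - u) / (f (2 * v + \<gamma>) * f (v - u) * f (e + \<gamma>))"
definition be2 :: "complex \<Rightarrow> complex \<Rightarrow> complex \<Rightarrow> complex" where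
  "be2 e u v = f (2 * v) * f \<gamma> * f (e - v - u) / (f (2 * v + \<gamma>) * f (v + u + \<gamma>) * f (e + \<gamma>))"

text \<open>This and the next two identities match the raw relation with \<open>al\<close>,
  \<open>be1\<close>, \<open>be2\<close> once crossing has eliminated D(v). The common factor
  Ra(v+u) Rbp(v-u) is the coefficient of A(u)B(v).\<close>

lemma ab_A:
  assumes nz: "f e \<noteq> 0" "f (v + u + \<gamma>) \<noteq> 0" "f (v - u) \<noteq> 0"
  shows "Ra (v - u) * Rbp (v + u) e = Ra (v + u) * Rbp (v - u) e * al u v"
proof -
  have eqs: "f (v - u + \<gamma>) = f (v + \<gamma> - u)"
    by ((rule f_congs, simp add: algebra_simps)+)
  show ?thesis using nz unfolding Ra_def Rbp_def al_def eqs
    by (simp add: divide_simps)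
qed

lemma ab_B:
  assumes nz: "f (e + \<gamma>) \<noteq> 0" "f e \<noteq> 0" "f (2 * v + \<gamma>) \<noteq> 0" "f (2 * v) \<noteq> 0" "f (v - u) \<noteq> 0"
  shows "Rbp (v + u) e * Rcm (v - u) e * Kdp e v + Rcp (v + u) e * Rbp (v - u) e * Kap e v =
      Ra (v + u) * Rbp (v - u) e * be1 e u v * Kdp e v"
proof -
  have eqs: "f (e + (v - u)) = f (e + v - u)" "f (e - (v + u)) = f (e - v - u)"
    "f (e + (2 * v + \<gamma>)) = f (e + 2 * v + \<gamma>)"
    "f (e + \<gamma> + v - u) = f (e + v + \<gamma> - u)"
    by ((rule f_congs, simp add: algebra_simps)+)
  have e0: "f (v + u) * f (2 * v + \<gamma>) * f (e + \<gamma>) * f (e + v - u)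
      = f (e + 2 * v + \<gamma>) * (- f (e - v - u)) * (- f (v - u)) * (- f \<gamma>)
      + f (e + v + \<gamma> - u) * f e * f (2 * v) * f (v + u + \<gamma>)"
    by (rule f_three_term_inst[of "v + u" "2 * v + \<gamma>" "e + \<gamma>" "e + v - u" "e + 2 * v + \<gamma>"])
      ((rule f_congs | simp add: algebra_simps)+)
  show ?thesis using e0 nz unfolding Rbp_def Rcm_def Kdp_def Rcp_def Kap_def Ra_def be1_def eqs
    by (simp add: divide_simps) algebra
qed

lemma ab_C:
  assumes nz: "f (e + \<gamma>) \<noteq> 0" "f e \<noteq> 0" "f (2 * v + \<gamma>) \<noteq> 0" "f (2 * v) \<noteq> 0" "f (v + u + \<gamma>) \<noteq> 0"
  shows "Rcp (v + u) e * Rbp (v - u) e = Ra (v + u) * Rbp (v - u) e * be2 e u v * Kdp e v"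
proof -
  have eqs: "f (e - (v + u)) = f (e - v - u)"
    by ((rule f_congs, simp add: algebra_simps)+)
  show ?thesis using nz unfolding Rcp_def Rbp_def Ra_def be2_def Kdp_def eqs
    by (simp add: divide_simps)
qed

text \<open>
  The two expansions that arise from swapping adjacent \<open>B\<close>'s agree: this makes the coefficients of the
  unwanted terms independent of the order in which \<open>A\<close> meets the \<open>B\<close>'s.
\<close>

lemma exch_1:
  assumes nz: "f (e + \<gamma>) \<noteq> 0" "f e \<noteq> 0" "f (e - \<gamma>) \<noteq> 0" "f (2 * v + \<gamma>) \<noteq> 0" "f (2 * v) \<noteq> 0"
      "f (v + u + \<gamma>) \<noteq> 0" "f (v + w + \<gamma>) \<noteq> 0" "f (v - w) \<noteq> 0" "f (v - u) \<noteq> 0" "f (u - w) \<noteq> 0"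
      "f (2 * w + \<gamma>) \<noteq> 0"
  shows "al u v * be1 (e - 2 * \<gamma>) u w - be1 e u v * be1 (e - 2 * \<gamma>) v w + Kb v * be2 e u v *
      be1 (e - 2 * \<gamma>) (- v - \<gamma>) w = be1 e u w * al w v"
proof -
  have eqs: "f (v - u + \<gamma>) = f (v + \<gamma> - u)"
    "f (e - 2 * \<gamma> + \<gamma> + w - u) = f (e + w - u - \<gamma>)"
    "f (w - u) = (- f (u - w))" "f (e - 2 * \<gamma> + \<gamma>) = f (e - \<gamma>)"
    "f (e + \<gamma> + v - u) = f (e + v + \<gamma> - u)"
    "f (e - 2 * \<gamma> + \<gamma> + w - v) = f (e + w - v - \<gamma>)"
    "f (w - v) = (- f (v - w))"
    "f (e - 2 * \<gamma> + \<gamma> + w - (- v - \<gamma>)) = f (e + v + w)"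
    "f (w - (- v - \<gamma>)) = f (v + w + \<gamma>)"
    "f (e + \<gamma> + w - u) = f (e + w + \<gamma> - u)"
    "f (v - w + \<gamma>) = f (v + \<gamma> - w)"
    by ((rule f_congs, simp add: algebra_simps)+)
  have e0: "f (v + w + \<gamma>) * f (v + u) * f (e + w - u - \<gamma>) * f e
      = f (e + v + w) * (- f (e - v - u - \<gamma>)) * (- f (u - w)) * f \<gamma>
      + f (e - \<gamma>) * f (e + w - u) * f (v + u + \<gamma>) * f (v + w)"
    by (rule f_three_term_inst[of "v + w + \<gamma>" "v + u" "e + w - u - \<gamma>" "e" "e + v + w"])
      ((rule f_congs | simp add: algebra_simps)+)
  have e1: "f (v + w + \<gamma>) * f (2 * v) * f (e + w - v - \<gamma>) * f e
      = f (e + v + w) * (- f (e - 2 * v - \<gamma>)) * (- f (v - w)) * f \<gamma>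
      + f (e - \<gamma>) * f (e + w - v) * f (2 * v + \<gamma>) * f (v + w)"
    by (rule f_three_term_inst[of "v + w + \<gamma>" "2 * v" "e + w - v - \<gamma>" "e" "e + v + w"])
      ((rule f_congs | simp add: algebra_simps)+)
  have e2: "f (v - u) * f (2 * v + 2 * \<gamma>) * f (e - v - u) * f e
      = f (e + v + \<gamma> - u) * (- f (e - 2 * v - \<gamma>)) * (- f (v + u + \<gamma>)) * (- f \<gamma>)
      + f (e + \<gamma>) * f (e - v - u - \<gamma>) * f (2 * v + \<gamma>) * f (v + \<gamma> - u)"
    by (rule f_three_term_inst[of "v - u" "2 * v + 2 * \<gamma>" "e - v - u" "e" "e + v + \<gamma> - u"])
      ((rule f_congs | simp add: algebra_simps)+)
  have e3: "f (v - u) * f (v + \<gamma> - w) * f (e + w + \<gamma> - u) * f e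
      = f (e + v + \<gamma> - u) * (- f (e + w - v)) * (- f (u - w)) * (- f \<gamma>)
      + f (e + \<gamma>) * f (e + w - u) * f (v - w) * f (v + \<gamma> - u)"
    by (rule f_three_term_inst[of "v - u" "v + \<gamma> - w" "e + w + \<gamma> - u" "e" "e + v + \<gamma> - u"])
      ((rule f_congs | simp add: algebra_simps)+)
  show ?thesis using e0 e1 e2 e3 nz unfolding al_def be1_def Kb_def be2_def eqs
    by (simp add: divide_simps) algebra
qed

lemma exch_2:
  assumes nz: "f (e + \<gamma>) \<noteq> 0" "f e \<noteq> 0" "f (e - \<gamma>) \<noteq> 0" "f (2 * v + \<gamma>) \<noteq> 0" "f (2 * v) \<noteq> 0"
      "f (v + u + \<gamma>) \<noteq> 0" "f (v + w + \<gamma>) \<noteq> 0" "f (v - w) \<noteq> 0" "f (v - u) \<noteq> 0" "f (u + w + \<gamma>) \<noteq> 0"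
      "f (2 * w + \<gamma>) \<noteq> 0"
  shows "al u v * be2 (e - 2 * \<gamma>) u w - be1 e u v * be2 (e - 2 * \<gamma>) v w + Kb v * be2 e u v *
      be2 (e - 2 * \<gamma>) (- v - \<gamma>) w = be2 e u w * al (- w - \<gamma>) v"
proof -
  have eqs: "f (v - u + \<gamma>) = f (v + \<gamma> - u)"
    "f (e - 2 * \<gamma> - w - u) = f (e - u - w - 2 * \<gamma>)"
    "f (w + u + \<gamma>) = f (u + w + \<gamma>)"
    "f (e - 2 * \<gamma> + \<gamma>) = f (e - \<gamma>)"
    "f (e + \<gamma> + v - u) = f (e + v + \<gamma> - u)"
    "f (e - 2 * \<gamma> - w - v) = f (e - v - w - 2 * \<gamma>)"
    "f (w + v + \<gamma>) = f (v + w + \<gamma>)"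
    "f (e - 2 * \<gamma> - w - (- v - \<gamma>)) = f (e + v - w - \<gamma>)"
    "f (w + (- v - \<gamma>) + \<gamma>) = (- f (v - w))" "f (e - w - u) = f (e - u - w)"
    "f (v - (- w - \<gamma>) + \<gamma>) = f (v + w + 2 * \<gamma>)"
    "f (v + (- w - \<gamma>)) = f (v - w - \<gamma>)"
    "f (v - (- w - \<gamma>)) = f (v + w + \<gamma>)"
    "f (v + (- w - \<gamma>) + \<gamma>) = f (v - w)"
    by ((rule f_congs, simp add: algebra_simps)+)
  have e0: "f (v - w) * f (v + u) * f (e - u - w - 2 * \<gamma>) * f e
      = f (e + v - w - \<gamma>) * (- f (e - v - u - \<gamma>)) * (- f (u + w + \<gamma>)) * f \<gamma>
      + f (e - \<gamma>) * f (e - u - w - \<gamma>) * f (v + u + \<gamma>) * f (v - w - \<gamma>)"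
    by (rule f_three_term_inst[of "v - w" "v + u" "e - u - w - 2 * \<gamma>" "e" "e + v - w - \<gamma>"])
      ((rule f_congs | simp add: algebra_simps)+)
  have e1: "f (v - w) * f (2 * v) * f (e - v - w - 2 * \<gamma>) * f e
      = f (e + v - w - \<gamma>) * (- f (e - 2 * v - \<gamma>)) * (- f (v + w + \<gamma>)) * f \<gamma>
      + f (e - \<gamma>) * f (e - v - w - \<gamma>) * f (2 * v + \<gamma>) * f (v - w - \<gamma>)"
    by (rule f_three_term_inst[of "v - w" "2 * v" "e - v - w - 2 * \<gamma>" "e" "e + v - w - \<gamma>"])
      ((rule f_congs | simp add: algebra_simps)+)
  have e2: "f (v - u) * f (2 * v + 2 * \<gamma>) * f (e - v - u) * f e
      = f (e + v + \<gamma> - u) * (- f (e - 2 * v - \<gamma>)) * (- f (v + u + \<gamma>)) * (- f \<gamma>)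
      + f (e + \<gamma>) * f (e - v - u - \<gamma>) * f (2 * v + \<gamma>) * f (v + \<gamma> - u)"
    by (rule f_three_term_inst[of "v - u" "2 * v + 2 * \<gamma>" "e - v - u" "e" "e + v + \<gamma> - u"])
      ((rule f_congs | simp add: algebra_simps)+)
  have e3: "f (v - u) * f (v + w + 2 * \<gamma>) * f (e - u - w) * f e
      = f (e + v + \<gamma> - u) * (- f (e - v - w - \<gamma>)) * (- f (u + w + \<gamma>)) * (- f \<gamma>)
      + f (e + \<gamma>) * f (e - u - w - \<gamma>) * f (v + w + \<gamma>) * f (v + \<gamma> - u)"
    by (rule f_three_term_inst[of "v - u" "v + w + 2 * \<gamma>" "e - u - w" "e" "e + v + \<gamma> - u"])
      ((rule f_congs | simp add: algebra_simps)+)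
  show ?thesis using e0 e1 e2 e3 nz unfolding al_def be2_def be1_def Kb_def eqs
    by (simp add: divide_simps) algebra
qed

lemma blk_cong:
  assumes "\<And>ys. length ys = length ms \<Longrightarrow> \<phi> ys = \<xi> ys"
  shows "blk ms l a b \<phi> xs = blk ms l a b \<xi> xs"
proof -
  have "blk ms l a b \<phi> xs = blk ms l a b (\<lambda>ys. if length ys = length ms then \<phi> ys else 0) xs"
    by (simp only: blk_guard[OF refl])
  also have "(\<lambda>ys. if length ys = length ms then \<phi> ys else 0) =
      (\<lambda>ys. if length ys = length ms then \<xi> ys else 0)"
    using assms by auto
  also have "blk ms l a b \<dots> xs = blk ms l a b \<xi> xs" by (simp only: blk_guard[OF refl])
  finally show ?thesis .
qed

lemma blk_diff: "blk ms l a b (\<lambda>ys. \<phi> ys - \<xi> ys) xs = blk ms l a b \<phi> xs - blk ms l a b \<xi> xs"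
  using blk_add[of ms l a b \<phi> "\<lambda>ys. - 1 * \<xi> ys"] blk_cmult[of ms l a b "- 1" \<xi>] by simp

lemma blk_sum:
  "finite I \<Longrightarrow> blk ms l a b (\<lambda>ys. \<Sum>i\<in>I. \<phi> i ys) xs = (\<Sum>i\<in>I. blk ms l a b (\<phi> i) xs)"
  by (induction I rule: finite_induct) (simp_all add: blk_add)

definition Bs :: "complex list \<Rightarrow> complex list \<Rightarrow> (bool list \<Rightarrow> complex) \<Rightarrow> bool list \<Rightarrow> complex" where
  "Bs ms vs \<phi> = foldr (\<lambda>v \<phi>. blk ms v True False \<phi>) vs \<phi>"

lemma Bs_simps [simp]: "Bs ms [] \<phi> = \<phi>" "Bs ms (v # vs) \<phi> = blk ms v True False (Bs ms vs \<phi>)"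
  by (simp_all add: Bs_def)

text \<open>An auxiliary basis vector with a function of the sites: inserting it selects one column
  of the reflection equation.\<close>

definition ket2 :: "bool \<Rightarrow> bool \<Rightarrow> (bool list \<Rightarrow> complex) \<Rightarrow> ket" where
  "ket2 i j \<phi> \<sigma> xs = (if \<sigma> 1 = i \<and> \<sigma> 2 = j then \<phi> xs else 0)"

text \<open>Row (+,+) and column (-,-) of the reflection equation. The height e is that of the input
  of one \<open>B\<close>, since \<open>B\<close> takes the weight wt xs + 2 to wt xs.\<close>

lemma BB_raw:
  assumes "\<And>k. \<bar>k\<bar> \<le> int (length ms) \<Longrightarrow> f (\<theta> + of_int k * \<gamma>) \<noteq> 0"
    and "nonres ms l1" "nonres ms l2" and n: "length xs = length ms"
  defines "e \<equiv> \<theta> - \<gamma> * of_int (wt xs + 2)"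
  shows "Ra (l1 - l2) * Rbp (l1 + l2) e * blk ms l1 True False (blk ms l2 True False \<phi>) xs =
         Ra (l1 - l2) * Rbp (l1 + l2) e * blk ms l2 True False (blk ms l1 True False \<phi>) xs"
proof -
  let ?\<sigma> = "\<lambda>_ :: nat. True"
  have w: "blk ms l True False (\<lambda>ys. Rbp s (height ys) * \<xi> ys) xs = Rbp s e *
      blk ms l True False \<xi> xs" for l s \<xi>
    using blk_weight[of ms l True False "\<lambda>w. Rbp s (\<theta> - \<gamma> * of_int w)"]
        by (simp add: e_def add.commute)
  have "refl_lhs ms l1 l2 (ket2 False False \<phi>) ?\<sigma> xs =
     Ra (l1 - l2) * blk ms l1 True False (\<lambda>ys. Rbp (l1 + l2) (height ys) *
         blk ms l2 True False \<phi> ys) xs"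
    using n by (simp add: refl_lhs_def R_leg_def mon_leg_def ket2_def UNIV_bool R_entries mon_blk
        dyn_def blk_guard)
  moreover have "refl_rhs ms l1 l2 (ket2 False False \<phi>) ?\<sigma> xs =
      blk ms l2 True False (\<lambda>ys. Rbp (l1 + l2) (height ys) *
          (Ra (l1 - l2) * blk ms l1 True False \<phi> ys)) xs"
    using n by (simp add: refl_rhs_def R_leg_def mon_leg_def ket2_def UNIV_bool R_entries mon_blk
        dyn_def blk_guard blk_cmult)
  ultimately show ?thesis
    using reflection_equation[OF assms(1-3)] by (simp only: w) (auto simp: blk_cmult mult_ac)
qed

text \<open>Row (+,+) and column (-,+) of the reflection equation; its last term still contains
  D(v).\<close>

lemma AB_raw:
  assumes "\<And>k. \<bar>k\<bar> \<le> int (length ms) \<Longrightarrow> f (\<theta> + of_int k * \<gamma>) \<noteq> 0"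
    and "nonres ms v" "nonres ms u" and n: "length xs = length ms"
  defines "e \<equiv> \<theta> - \<gamma> * of_int (wt xs + 2)"
  shows "Ra (v - u) * Rbp (v + u) e * blk ms v True False (blk ms u True True \<phi>) xs =
    Rbp (v + u) e * Rcm (v - u) e * blk ms u True False (blk ms v True True \<phi>) xs +
    Ra (v + u) * Rbp (v - u) e * blk ms u True True (blk ms v True False \<phi>) xs +
    Rcp (v + u) e * Rbp (v - u) e * blk ms u True False (blk ms v False False \<phi>) xs"
proof -
  let ?\<sigma> = "\<lambda>_ :: nat. True"
  have w: "blk ms l True False (\<lambda>ys. F (height ys) * \<xi> ys) xs = F e * blk ms l True False \<xi> xs"
      for l F \<xi>
    using blk_weight[of ms l True False "\<lambda>w. F (\<theta> - \<gamma> * of_int w)"] by (simp add: e_def add.commute)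
  have 1: "refl_lhs ms v u (ket2 False True \<phi>) ?\<sigma> xs =
     Ra (v - u) * blk ms v True False (\<lambda>ys. Rbp (v + u) (height ys) * blk ms u True True \<phi> ys) xs"
    using n by (simp add: refl_lhs_def R_leg_def mon_leg_def ket2_def UNIV_bool R_entries mon_blk
        dyn_def blk_guard)
  have 2: "refl_rhs ms v u (ket2 False True \<phi>) ?\<sigma> xs =
      blk ms u True True (\<lambda>ys. Ra (v + u) * blk ms v True False
          (\<lambda>zs. Rbp (v - u) (height zs) * \<phi> zs) ys) xs +
      blk ms u True False (\<lambda>ys. Rcp (v + u) (height ys) *
         blk ms v False False (\<lambda>zs. Rbp (v - u) (height zs) * \<phi> zs) ys +
         Rbp (v + u) (height ys) *
         blk ms v True True (\<lambda>zs. Rcm (v - u) (height zs) * \<phi> zs) ys) xs"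
    using n by (simp add: refl_rhs_def R_leg_def mon_leg_def ket2_def UNIV_bool R_entries mon_blk
        dyn_def blk_guard)
  have 3: "blk ms v a a (\<lambda>zs. F (height zs) * \<phi> zs) = (\<lambda>ys. F (height ys) * blk ms v a a \<phi> ys)"
      for a F
    using blk_weight[of ms v a a "\<lambda>w. F (\<theta> - \<gamma> * of_int w)"] by (intro ext) simp
  have 4: "blk ms u True True (\<lambda>ys. Ra (v + u) *
      blk ms v True False (\<lambda>zs. Rbp (v - u) (height zs) * \<phi> zs) ys) xs =
      Ra (v + u) * (Rbp (v - u) e * blk ms u True True (blk ms v True False \<phi>) xs)"
    using blk_weight[of ms v True False "\<lambda>w. Rbp (v - u) (\<theta> - \<gamma> * of_int w)"]
      blk_weight[of ms u True True "\<lambda>w. Rbp (v - u) (\<theta> - \<gamma> * of_int (w + 2))"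
          "blk ms v True False \<phi>"]
    by (simp add: blk_cmult e_def add.commute)
  have 5: "blk ms u True False (\<lambda>ys. Rcp (v + u) (height ys) *
         (Rbp (v - u) (height ys) * blk ms v False False \<phi> ys)) xs =
       Rcp (v + u) e * (Rbp (v - u) e * blk ms u True False (blk ms v False False \<phi>) xs)"
    "blk ms u True False (\<lambda>ys. Rbp (v + u) (height ys) *
         (Rcm (v - u) (height ys) * blk ms v True True \<phi> ys)) xs =
       Rbp (v + u) e * (Rcm (v - u) e * blk ms u True False (blk ms v True True \<phi>) xs)"
    using w[of u "\<lambda>t. Rcp (v + u) t * Rbp (v - u) t" "blk ms v False False \<phi>"]
      w[of u "\<lambda>t. Rbp (v + u) t * Rcm (v - u) t" "blk ms v True True \<phi>"]
          by (simp_all add: mult.assoc)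
  have "refl_rhs ms v u (ket2 False True \<phi>) ?\<sigma> xs =
      Ra (v + u) * (Rbp (v - u) e * blk ms u True True (blk ms v True False \<phi>) xs) +
      (Rcp (v + u) e * (Rbp (v - u) e * blk ms u True False (blk ms v False False \<phi>) xs) +
       Rbp (v + u) e * (Rcm (v - u) e * blk ms u True False (blk ms v True True \<phi>) xs))"
    unfolding 2 4 3[where F = "Rbp (v - u)"] 3[where F = "Rcm (v - u)"] blk_add 5 ..
  moreover have "refl_lhs ms v u (ket2 False True \<phi>) ?\<sigma> xs =
     Ra (v - u) * (Rbp (v + u) e * blk ms v True False (blk ms u True True \<phi>) xs)"
    unfolding 1 w[where F = "Rbp (v + u)"] ..
  ultimately show ?thesis
    using reflection_equation[OF assms(1-3), of "ket2 False True \<phi>"] by (simp add: algebra_simps)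
qed

text \<open>Collects what the exchange relations divide by: the inversion of R-matrices, the
  denominators of \<open>al\<close>, \<open>be1\<close>, \<open>be2\<close> and of crossing, and the
  common factor Ra(v-u) Rbp(v+u) cancelled when two B's are swapped.\<close>

definition gen :: "complex list \<Rightarrow> complex \<Rightarrow> complex \<Rightarrow> bool" where
  "gen ms u v \<longleftrightarrow> nonres ms u \<and> nonres ms v \<and> f (v - u) \<noteq> 0 \<and> f (v + u + \<gamma>) \<noteq> 0 \<and>
     f (v + u) \<noteq> 0 \<and> f (v - u + \<gamma>) \<noteq> 0 \<and> f (2 * v) \<noteq> 0 \<and> f (2 * v + \<gamma>) \<noteq> 0"

definition del_nth :: "nat \<Rightarrow> 'a list \<Rightarrow> 'a list" where
  "del_nth i vs = take i vs @ drop (Suc i) vs"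

lemma del_nth_simps [simp]:
  "del_nth 0 (v # vs) = vs" "del_nth (Suc i) (v # vs) = v # del_nth i vs"
  by (simp_all add: del_nth_def)

text \<open>Coefficient of the unwanted vector in which u replaces w: after the exchange with B(w),
  the operator A carries w or -w-gamma past the remaining B's down to its eigenvalue.\<close>

definition bethe_coef :: "(complex \<Rightarrow> complex) \<Rightarrow> complex \<Rightarrow> complex \<Rightarrow> complex \<Rightarrow> complex list \<Rightarrow>
    complex" where
  "bethe_coef \<Lambda> e u w ws = be1 e u w * (\<Lambda> w * prod_list (map (al w) ws))
     + be2 e u w * (\<Lambda> (- w - \<gamma>) * prod_list (map (al (- w - \<gamma>)) ws))"

context
  fixes ms :: "complex list"
  assumes nz: "\<And>k. \<bar>k\<bar> \<le> int (length ms) + 5 \<Longrightarrow> f (\<theta> + of_int k * \<gamma>) \<noteq> 0"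
begin

lemma nz_wt:
  assumes "length xs = length ms" "\<bar>k\<bar> \<le> 5" "e = \<theta> - \<gamma> * of_int (wt xs + k)"
  shows "f e \<noteq> 0"
proof -
  have "e = \<theta> + of_int (- (wt xs + k)) * \<gamma>" unfolding assms(3) by (simp add: algebra_simps)
  then show ?thesis using nz[of "- (wt xs + k)"] abs_wt_le[of xs] assms(1,2) by simp
qed

lemma BB:
  assumes "gen ms u v" "length xs = length ms"
  shows "blk ms v True False (blk ms u True False \<phi>) xs =
      blk ms u True False (blk ms v True False \<phi>) xs"
proof -
  let ?e = "\<theta> - \<gamma> * of_int (wt xs + 2)"
  have "f ?e \<noteq> 0" "f (?e - \<gamma>) \<noteq> 0"
    by (rule nz_wt[OF assms(2), of 2] nz_wt[OF assms(2), of 3]; simp add: algebra_simps)+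
  then have "Ra (v - u) * Rbp (v + u) ?e \<noteq> 0"
    using assms(1) by (simp add: gen_def Ra_def Rbp_def)
  moreover have "Ra (v - u) * Rbp (v + u) ?e * blk ms v True False (blk ms u True False \<phi>) xs =
     Ra (v - u) * Rbp (v + u) ?e * blk ms u True False (blk ms v True False \<phi>) xs"
    using assms nz by (intro BB_raw) (auto simp: gen_def)
  ultimately show ?thesis by (metis mult_left_cancel)
qed

lemma AB:
  assumes g: "gen ms u v" and n: "length xs = length ms"
  defines "e \<equiv> \<theta> - \<gamma> * of_int (wt xs + 2)"
  shows "blk ms u True True (blk ms v True False \<phi>) xs =
    al u v * blk ms v True False (blk ms u True True \<phi>) xs
    - be1 e u v * blk ms u True False (blk ms v True True \<phi>) xs
    - be2 e u v * blk ms u True False (blk ms (- v - \<gamma>) True True \<phi>) xs"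
proof -
  define X1 where "X1 = blk ms v True False (blk ms u True True \<phi>) xs"
  define X2 where "X2 = blk ms u True False (blk ms v True True \<phi>) xs"
  define X3 where "X3 = blk ms u True True (blk ms v True False \<phi>) xs"
  define X4 where "X4 = blk ms u True False (blk ms v False False \<phi>) xs"
  define X5 where "X5 = blk ms u True False (blk ms (- v - \<gamma>) True True \<phi>) xs"
  have e: "f e \<noteq> 0" "f (e - \<gamma>) \<noteq> 0" "f (e + \<gamma>) \<noteq> 0"
    unfolding e_def
    by (rule nz_wt[OF n, of 2] nz_wt[OF n, of 3] nz_wt[OF n, of 1]; simp add: algebra_simps)+
  have g': "f (v - u) \<noteq> 0" "f (v + u + \<gamma>) \<noteq> 0" "f (2 * v) \<noteq> 0" "f (2 * v + \<gamma>) \<noteq> 0"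
    using g by (auto simp: gen_def)
  define c where "c = Ra (v + u) * Rbp (v - u) e"
  have c: "c \<noteq> 0" using e g' by (simp add: c_def Ra_def Rbp_def)
  have K: "Kdp e v \<noteq> 0" using e g' by (simp add: Kdp_def)
  have raw: "Ra (v - u) * Rbp (v + u) e * X1 =
     Rbp (v + u) e * Rcm (v - u) e * X2 + c * X3 + Rcp (v + u) e * Rbp (v - u) e * X4"
    unfolding X1_def X2_def X3_def X4_def e_def c_def using g n nz
        by (intro AB_raw) (auto simp: gen_def)
  have "X5 = blk ms u True False (\<lambda>ys. Kdp (height ys) v * blk ms v False False \<phi> ys
      - Kap (height ys) v * blk ms v True True \<phi> ys) xs"
    unfolding X5_def by (rule blk_cong) (use crossing_all[of ms v] nz g' in simp)
  also have "\<dots> = Kdp e v * X4 - Kap e v * X2"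
    using blk_weight[of ms u True False "\<lambda>w. Kdp (\<theta> - \<gamma> * of_int w) v"]
      blk_weight[of ms u True False "\<lambda>w. Kap (\<theta> - \<gamma> * of_int w) v"]
    by (simp add: blk_diff X4_def X2_def e_def add.commute)
  finally have X5: "Kdp e v * X4 = X5 + Kap e v * X2" by simp
  have A: "Ra (v - u) * Rbp (v + u) e = c * al u v"
    unfolding c_def using ab_A e g' by auto
  have C: "Rcp (v + u) e * Rbp (v - u) e = c * be2 e u v * Kdp e v"
    unfolding c_def using ab_C e g' by auto
  have "(Rbp (v + u) e * Rcm (v - u) e) * Kdp e v = (c * be1 e u v - c * be2 e u v * Kap e v) *
      Kdp e v"
    using ab_B[of e v u] e g' unfolding C c_def[symmetric] by (simp add: algebra_simps)
  then have B: "Rbp (v + u) e * Rcm (v - u) e = c * be1 e u v - c * be2 e u v * Kap e v"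
    using K by simp
  have "c * X3 = c * al u v * X1 - (c * be1 e u v - c * be2 e u v * Kap e v) * X2 - c *
      be2 e u v * (Kdp e v * X4)"
    using raw unfolding A B C by (simp add: algebra_simps)
  also have "\<dots> = c * (al u v * X1 - be1 e u v * X2 - be2 e u v * X5)"
    unfolding X5 by (simp add: algebra_simps)
  finally show ?thesis using c unfolding X1_def X2_def X3_def X5_def by simp
qed

text \<open>The coefficient of every unwanted vector is propagated explicitly when a further
  \<open>B\<close> is put in front. The eigenvalue is required at every spectral parameter because A
  also arrives with the reflected arguments -w-gamma.\<close>

lemma bethe_expansion:
  assumes eig: "\<And>u xs. length xs = length ms \<Longrightarrow> blk ms u True True \<phi> xs = \<Lambda> u * \<phi> xs"
    and "\<forall>w\<in>set vs. gen ms u w" "sorted_wrt (\<lambda>v w. gen ms v w \<and> gen ms (- v - \<gamma>) w) vs"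
    and "length xs = length ms"
  shows "blk ms u True True (Bs ms vs \<phi>) xs =
     \<Lambda> u * prod_list (map (al u) vs) * Bs ms vs \<phi> xs
     - (\<Sum>i<length vs. bethe_coef \<Lambda> (\<theta> - \<gamma> * of_int (wt xs + 2)) u (vs ! i) (del_nth i vs)
          * Bs ms (u # del_nth i vs) \<phi> xs)"
  using assms(2-)
proof (induction vs arbitrary: u xs)
  case Nil
  then show ?case using eig by simp
next
  case (Cons v vs)
  define e where "e = \<theta> - \<gamma> * of_int (wt xs + 2)"
  have n: "length xs = length ms" using Cons.prems by simp
  have gv: "gen ms u v" "\<And>w. w \<in> set vs \<Longrightarrow> gen ms u w" "\<And>w. w \<in> set vs \<Longrightarrow> gen ms v w"
    "\<And>w. w \<in> set vs \<Longrightarrow> gen ms (- v - \<gamma>) w" "sorted_wrt (\<lambda>v w. gen ms v w \<and> gen ms (- v - \<gamma>) w) vs"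
    using Cons.prems by auto
  have e0: "f e \<noteq> 0" "f (e - \<gamma>) \<noteq> 0" "f (e + \<gamma>) \<noteq> 0"
    unfolding e_def
    by (rule nz_wt[OF n, of 2] nz_wt[OF n, of 3] nz_wt[OF n, of 1]; simp add: algebra_simps)+
  define X where "X i = Bs ms (del_nth i vs) \<phi>" for i
  define Cf where "Cf a i = bethe_coef \<Lambda> (e - 2 * \<gamma>) a (vs ! i) (del_nth i vs)" for a i
  define Y where "Y i = blk ms u True False (blk ms v True False (X i)) xs" for i
  \<comment> \<open>The induction hypothesis is used behind one further \<open>B\<close>, hence at
    height e - 2 gamma, and for a equal to u, v and -v-gamma.\<close>
  have IH: "blk ms b True False (blk ms a True True (Bs ms vs \<phi>)) xs =
      \<Lambda> a * prod_list (map (al a) vs) * blk ms b True False (Bs ms vs \<phi>) xs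
      - (\<Sum>i<length vs. Cf a i * blk ms b True False (blk ms a True False (X i)) xs)"
    if "\<forall>w\<in>set vs. gen ms a w" for a b
  proof -
    have "blk ms b True False (blk ms a True True (Bs ms vs \<phi>)) xs =
       blk ms b True False (\<lambda>ys. \<Lambda> a * prod_list (map (al a) vs) * Bs ms vs \<phi> ys
     - (\<Sum>i<length vs. bethe_coef \<Lambda> (\<theta> - \<gamma> * of_int (wt ys + 2)) a (vs ! i) (del_nth i vs)
          * blk ms a True False (X i) ys)) xs"
      by (rule blk_cong) (use Cons.IH[OF that gv(5)] in \<open>simp add: X_def\<close>)
    also have "\<dots> = \<Lambda> a * prod_list (map (al a) vs) * blk ms b True False (Bs ms vs \<phi>) xs
      - (\<Sum>i<length vs. Cf a i * blk ms b True False (blk ms a True False (X i)) xs)"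
    proof -
      have "blk ms b True False (\<lambda>ys. bethe_coef \<Lambda> (\<theta> - \<gamma> * of_int (wt ys + 2)) a (vs ! i)
          (del_nth i vs)
          * blk ms a True False (X i) ys) xs = Cf a i *
              blk ms b True False (blk ms a True False (X i)) xs" for i
      proof -
        have "\<theta> - \<gamma> * of_int (wt xs + h True - h False + 2) = e - 2 * \<gamma>"
          by (simp add: e_def algebra_simps)
        then show ?thesis
          unfolding Cf_def using blk_weight[of ms b True False
            "\<lambda>w. bethe_coef \<Lambda> (\<theta> - \<gamma> * of_int (w + 2)) a (vs ! i) (del_nth i vs)"
                "blk ms a True False (X i)" xs] by simp
      qed
      then show ?thesis by (simp only: blk_diff blk_cmult blk_sum finite_lessThan)
    qed
    finally show ?thesis .
  qed
  have swap: "blk ms v True False (blk ms u True False (X i)) xs = Y i" for i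
    unfolding Y_def by (rule BB) (use gv n in auto)
  have cross: "blk ms u True False (blk ms (- v - \<gamma>) True False (X i)) xs = - (Kb v * Y i)" for i
  proof -
    have "blk ms u True False (blk ms (- v - \<gamma>) True False (X i)) xs =
      blk ms u True False (\<lambda>ys. (- Kb v) * blk ms v True False (X i) ys) xs"
      by (rule blk_cong) (use crossing_all[of ms v] nz gv(1) in \<open>simp add: gen_def\<close>)
    then show ?thesis by (simp only: blk_cmult Y_def) simp
  qed
  \<comment> \<open>By \<open>swap\<close> and \<open>cross\<close> the three contributions are
    multiples of one vector \<open>Y i\<close>. The parts with the eigenvalue at w are gathered by
    \<open>exch_1\<close>, those at -w-gamma by \<open>exch_2\<close>.\<close>
  have coef: "al u v * Cf u i - be1 e u v * Cf v i + Kb v * be2 e u v * Cf (- v - \<gamma>) i =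
      bethe_coef \<Lambda> e u (vs ! i) (v # del_nth i vs)" if "i < length vs" for i
  proof -
    define w where "w = vs ! i"
    have w: "gen ms u w" "gen ms v w" using gv that by (auto simp: w_def)
    have g: "f (2 * v + \<gamma>) \<noteq> 0" "f (2 * v) \<noteq> 0" "f (v + u + \<gamma>) \<noteq> 0" "f (v + w + \<gamma>) \<noteq> 0"
        "f (v - w) \<noteq> 0"
      "f (v - u) \<noteq> 0" "f (u - w) \<noteq> 0" "f (u + w + \<gamma>) \<noteq> 0" "f (2 * w + \<gamma>) \<noteq> 0"
      using w gv(1) f_cong_minus[of "v - w" "w - v"] f_cong_minus[of "u - w" "w - u"]
      by (auto simp: gen_def add.commute)
    have x: "al u v * be1 (e - 2 * \<gamma>) u w - be1 e u v * be1 (e - 2 * \<gamma>) v w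
        + Kb v * be2 e u v * be1 (e - 2 * \<gamma>) (- v - \<gamma>) w = be1 e u w * al w v"
      by (rule exch_1) (use g e0 in auto)
    have y: "al u v * be2 (e - 2 * \<gamma>) u w - be1 e u v * be2 (e - 2 * \<gamma>) v w
        + Kb v * be2 e u v * be2 (e - 2 * \<gamma>) (- v - \<gamma>) w = be2 e u w * al (- w - \<gamma>) v"
      by (rule exch_2) (use g e0 in auto)
    define p where "p = \<Lambda> w * prod_list (map (al w) (del_nth i vs))"
    define q where "q = \<Lambda> (- w - \<gamma>) * prod_list (map (al (- w - \<gamma>)) (del_nth i vs))"
    have C: "Cf a i = be1 (e - 2 * \<gamma>) a w * p + be2 (e - 2 * \<gamma>) a w * q" for a
      by (simp add: Cf_def bethe_coef_def p_def q_def w_def)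
    have "al u v * Cf u i - be1 e u v * Cf v i + Kb v * be2 e u v * Cf (- v - \<gamma>) i =
      (al u v * be1 (e - 2 * \<gamma>) u w - be1 e u v * be1 (e - 2 * \<gamma>) v w
        + Kb v * be2 e u v * be1 (e - 2 * \<gamma>) (- v - \<gamma>) w) * p +
      (al u v * be2 (e - 2 * \<gamma>) u w - be1 e u v * be2 (e - 2 * \<gamma>) v w
        + Kb v * be2 e u v * be2 (e - 2 * \<gamma>) (- v - \<gamma>) w) * q"
      unfolding C by (simp add: algebra_simps)
    also have "\<dots> = bethe_coef \<Lambda> e u w (v # del_nth i vs)"
      unfolding x y by (simp add: bethe_coef_def p_def q_def)
    finally show ?thesis by (simp add: w_def)
  qed
  have "blk ms u True True (Bs ms (v # vs) \<phi>) xs =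
    al u v * blk ms v True False (blk ms u True True (Bs ms vs \<phi>)) xs
    - be1 e u v * blk ms u True False (blk ms v True True (Bs ms vs \<phi>)) xs
    - be2 e u v * blk ms u True False (blk ms (- v - \<gamma>) True True (Bs ms vs \<phi>)) xs"
    unfolding Bs_simps e_def by (rule AB) (use gv n in auto)
  also have "\<dots> = \<Lambda> u * prod_list (map (al u) (v # vs)) * Bs ms (v # vs) \<phi> xs
     - bethe_coef \<Lambda> e u v vs * Bs ms (u # vs) \<phi> xs
     - (\<Sum>i<length vs. (al u v * Cf u i - be1 e u v * Cf v i + Kb v * be2 e u v * Cf (- v - \<gamma>) i) *
         Y i)"
    using gv(2-4) by (simp add: IH swap cross Y_def[symmetric] bethe_coef_def algebra_simps
        sum_distrib_left sum.distrib sum_subtractf sum_negf)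
  also have "(\<Sum>i<length vs. (al u v * Cf u i - be1 e u v * Cf v i + Kb v * be2 e u v *
      Cf (- v - \<gamma>) i) * Y i) =
    (\<Sum>i<length vs. bethe_coef \<Lambda> e u (vs ! i) (v # del_nth i vs) * Y i)"
    by (rule sum.cong) (use coef in auto)
  finally show ?case
    unfolding e_def[symmetric] by (simp add: sum.lessThan_Suc_shift Y_def X_def del:
        sum.lessThan_Suc)
qed

end

section \<open>The functional relation for generic parameters\<close>

text \<open>The outgoing total spin is already minimal, so with incoming auxiliary spin up the sites
  would have to be lower than all-down.\<close>

lemma blk_FT_down: "blk ms l False True \<phi> (replicate (length ms) False) = 0"
proof (induction ms arbitrary: \<phi>)
  case Nil
  then show ?case by (simp add: blk_Nil)
next
  case (Cons m ms)
  then show ?case by (simp add: blk_Cons UNIV_bool R_entries)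
qed

definition vac_eig :: "complex list \<Rightarrow> complex \<Rightarrow> complex" where
  "vac_eig ms l = (\<Prod>m\<leftarrow>ms. f (l - m + \<gamma>) * f (l + m + \<gamma>))"

lemma vac_eig_simps [simp]: "vac_eig [] l = 1" "vac_eig (m # ms) l = f (l - m + \<gamma>) *
    f (l + m + \<gamma>) * vac_eig ms l"
  by (simp_all add: vac_eig_def)

lemma blk_FF_down:
  "blk ms l False False \<phi> (replicate (length ms) False) = kk l False * vac_eig ms l *
      \<phi> (replicate (length ms) False)"
proof (induction ms arbitrary: \<phi>)
  case Nil
  then show ?case by (simp add: blk_Nil)
next
  case (Cons m ms)
  then show ?case by (simp add: blk_Cons UNIV_bool R_entries blk_FT_down Ra_def)
qed

definition vac :: "nat \<Rightarrow> bool list \<Rightarrow> complex" where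
  "vac n xs = (if xs = replicate n True then 1 else 0)"

lemma vac_Cons: "(\<lambda>ys. vac (Suc n) (y # ys)) = (if y then vac n else (\<lambda>_. 0))"
  by (auto simp: vac_def fun_eq_iff)

lemma blk_FT_vac: "length xs = length ms \<Longrightarrow> blk ms l False True (vac (length ms)) xs = 0"
proof (induction ms arbitrary: xs)
  case Nil
  then show ?case by (simp add: blk_Nil)
next
  case (Cons m ms)
  then obtain x ys where "xs = x # ys" by (cases xs) auto
  with Cons show ?case by (cases x) (simp_all add: blk_Cons UNIV_bool R_entries vac_Cons)
qed

lemma blk_TT_vac:
  "length xs = length ms \<Longrightarrow> blk ms l True True (vac (length ms)) xs = kk l True * vac_eig ms l *
      vac (length ms) xs"
proof (induction ms arbitrary: xs)
  case Nil
  then show ?case by (simp add: blk_Nil vac_def)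
next
  case (Cons m ms)
  then obtain x ys where xs: "xs = x # ys" "length ys = length ms" by (cases xs) auto
  have v: "vac (Suc (length ms)) (y # ys) = (if y then vac (length ms) ys else 0)" for y
    by (simp add: vac_def)
  show ?case using Cons.IH[OF xs(2)] blk_FT_vac[OF xs(2)] unfolding xs(1)
    by (cases x) (simp_all add: blk_Cons UNIV_bool R_entries vac_Cons v Ra_def)
qed

lemma wt_replicate_False: "wt (replicate n False) = - int n"
  by (induction n) auto

definition left_eig :: "complex list \<Rightarrow> complex \<Rightarrow> complex" where
  "left_eig ms l = (let L = of_nat (length ms) in
     f (\<theta> + (L - 1) * \<gamma> - 2 * l) * f \<gamma> / (f (2 * l + \<gamma>) * f (\<theta> + (L - 1) * \<gamma>)) *
         (kk l False * vac_eig ms l)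
     + f (2 * l) * f (\<theta> + L * \<gamma>) / (f (2 * l + \<gamma>) * f (\<theta> + (L - 1) * \<gamma>)) *
         (kk (- l - \<gamma>) False * vac_eig ms (- l - \<gamma>)))"

text \<open>On the all-down covector the recursion for A mixes in other blocks, whereas D has a
  single path. The eigenvalue of A(l) is therefore obtained by solving the crossing relation
  D(-l-gamma) = Kdm A(l) - Kam D(l) for A(l); this is the origin of the two summands.\<close>

lemma blk_TT_down:
  assumes nz: "\<And>k. \<bar>k\<bar> \<le> int (Suc (length ms)) \<Longrightarrow> f (\<theta> + of_int k * \<gamma>) \<noteq> 0"
    and l: "f (2 * l) \<noteq> 0" "f (2 * l + \<gamma>) \<noteq> 0"
  shows "blk ms l True True \<phi> (replicate (length ms) False) = left_eig ms l *
      \<phi> (replicate (length ms) False)"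
proof -
  define L :: complex where "L = of_nat (length ms)"
  define e where "e = \<theta> + L * \<gamma>"
  define xs where "xs = replicate (length ms) False"
  define X where "X = blk ms l True True \<phi> xs"
  have e: "\<theta> - \<gamma> * of_int (wt xs) = e"
    by (simp add: xs_def e_def wt_replicate_False L_def algebra_simps)
  have e': "\<theta> + (L - 1) * \<gamma> = e - \<gamma>" "e - \<gamma> - 2 * l = e - (2 * l + \<gamma>)"
      by (simp_all add: e_def algebra_simps)
  have nz': "f e \<noteq> 0" "f (e - \<gamma>) \<noteq> 0"
    using nz[of "int (length ms)"] nz[of "int (length ms) - 1"]
        by (auto simp: e_def L_def algebra_simps)
  have "blk ms (- l - \<gamma>) False False \<phi> xs = Kdm e l * X - Kam e l * blk ms l False False \<phi> xs"
    using crossing_all[OF nz l(1), where xs = xs and \<phi> = \<phi>] unfolding e X_def by (simp add: xs_def)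
  then have k: "Kdm e l * X = (kk (- l - \<gamma>) False * vac_eig ms (- l - \<gamma>) + Kam e l *
      (kk l False * vac_eig ms l)) * \<phi> xs"
    unfolding xs_def blk_FF_down by (simp add: algebra_simps)
  have K0: "Kdm e l \<noteq> 0" using nz' l by (simp add: Kdm_def)
  have 1: "f (2 * l) * f e / (f (2 * l + \<gamma>) * f (e - \<gamma>)) = 1 / Kdm e l"
    "f (e - (2 * l + \<gamma>)) * f \<gamma> / (f (2 * l + \<gamma>) * f (e - \<gamma>)) = Kam e l / Kdm e l"
    using nz' l by (simp_all add: Kdm_def Kam_def field_simps)
  have "left_eig ms l = Kam e l / Kdm e l * (kk l False * vac_eig ms l) + 1 / Kdm e l *
      (kk (- l - \<gamma>) False * vac_eig ms (- l - \<gamma>))"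
    unfolding left_eig_def Let_def L_def[symmetric] e' e_def[symmetric] 1 ..
  then have "left_eig ms l * \<phi> xs = Kdm e l * X / Kdm e l"
    unfolding k by (simp add: add_divide_distrib algebra_simps)
  then show ?thesis using K0 unfolding X_def xs_def by simp
qed

theorem functional_relation:
  assumes nz: "\<And>k. \<bar>k\<bar> \<le> int (length ms) + 5 \<Longrightarrow> f (\<theta> + of_int k * \<gamma>) \<noteq> 0"
    and u: "f (2 * u) \<noteq> 0" "f (2 * u + \<gamma>) \<noteq> 0"
    and g: "\<forall>w\<in>set vs. gen ms u w" "sorted_wrt (\<lambda>v w. gen ms v w \<and> gen ms (- v - \<gamma>) w) vs"
  defines "\<Lambda> \<equiv> \<lambda>l. kk l True * vac_eig ms l" and "Z \<equiv> \<lambda>vs. Bs ms vs (vac (length ms))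
      (replicate (length ms) False)"
  shows "(left_eig ms u - \<Lambda> u * prod_list (map (al u) vs)) * Z vs +
    (\<Sum>i<length vs. bethe_coef \<Lambda> (\<theta> + (of_nat (length ms) - 2) * \<gamma>) u (vs ! i) (del_nth i vs) *
        Z (u # del_nth i vs)) = 0"
proof -
  have w: "\<theta> - \<gamma> * of_int (wt (replicate (length ms) False) + 2) = \<theta> + (of_nat (length ms) - 2) * \<gamma>"
    by (simp add: wt_replicate_False algebra_simps)
  have "left_eig ms u * Z vs = blk ms u True True (Bs ms vs (vac (length ms)))
      (replicate (length ms) False)"
    unfolding Z_def by (rule blk_TT_down[symmetric]) (use nz u in auto)
  also have "\<dots> = \<Lambda> u * prod_list (map (al u) vs) * Z vs
    - (\<Sum>i<length vs. bethe_coef \<Lambda> (\<theta> + (of_nat (length ms) - 2) * \<gamma>) u (vs ! i) (del_nth i vs) *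
        Z (u # del_nth i vs))"
    unfolding Z_def w[symmetric] using nz g
    by (intro bethe_expansion) (auto simp: blk_TT_vac \<Lambda>_def)
  finally show ?thesis by (simp add: algebra_simps)
qed

section \<open>Comparison with the operators given by matrix entries\<close>

definition opapply :: "nat \<Rightarrow> fop \<Rightarrow> (bool \<Rightarrow> bool list \<Rightarrow> complex) \<Rightarrow> bool \<Rightarrow> bool list \<Rightarrow> complex" where
  "opapply L Op \<psi> a xs = (\<Sum>(b, ys)\<in>fstates L. Op (a, xs) (b, ys) * \<psi> b ys)"

lemma finite_lists_length: "finite {xs :: bool list. length xs = L}"
  using finite_lists_length_eq[of "UNIV :: bool set" L] by simp

lemma finite_fstates: "finite (fstates L)"
  using finite_lists_length by (simp add: fstates_def)

lemma opapply_opmul: "opapply L (opmul L O1 O2) \<psi> = opapply L O1 (opapply L O2 \<psi>)"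
proof (intro ext)
  fix a xs
  have "opapply L (opmul L O1 O2) \<psi> a xs =
     (\<Sum>s\<in>fstates L. \<Sum>mid\<in>fstates L. O1 (a, xs) mid * O2 mid s * (case s of (b, ys) \<Rightarrow> \<psi> b ys))"
    by (simp add: opapply_def opmul_def sum_distrib_right case_prod_beta')
  also have "\<dots> = (\<Sum>mid\<in>fstates L. \<Sum>s\<in>fstates L. O1 (a, xs) mid * O2 mid s *
      (case s of (b, ys) \<Rightarrow> \<psi> b ys))"
    by (rule sum.swap)
  also have "\<dots> = opapply L O1 (opapply L O2 \<psi>) a xs"
    by (simp add: opapply_def sum_distrib_left case_prod_beta' mult.assoc)
  finally show "opapply L (opmul L O1 O2) \<psi> a xs = opapply L O1 (opapply L O2 \<psi>) a xs" .
qed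

lemma opapply_opid:
  assumes "length xs = L"
  shows "opapply L opid \<psi> a xs = \<psi> a xs"
proof -
  have "opapply L opid \<psi> a xs = (\<Sum>s\<in>fstates L. if s = (a, xs) then \<psi> a xs else 0)"
    unfolding opapply_def by (rule sum.cong) (auto simp: opid_def split: if_splits)
  then show ?thesis using assms finite_fstates by (simp add: fstates_def)
qed

lemma opapply_cong:
  assumes "\<And>b ys. length ys = L \<Longrightarrow> \<psi> b ys = \<phi> b ys"
  shows "opapply L Op \<psi> a xs = opapply L Op \<phi> a xs"
  unfolding opapply_def using assms by (auto intro!: sum.cong simp: fstates_def)

lemma opapply_foldr:
  assumes "length xs = L"
  shows "opapply L (foldr (opmul L) Os opid) \<psi> a xs = foldr (opapply L) Os \<psi> a xs"
  using assms
proof (induction Os arbitrary: a xs)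
  case Nil
  then show ?case by (simp add: opapply_opid)
next
  case (Cons Op Os)
  then show ?case by (simp add: opapply_opmul) (rule opapply_cong)
qed

text \<open>Site j has list index j - 1, so the sum starting at list index j begins just behind the
  spin x of site j = Suc (length pre).\<close>

lemma spin_sum_append: "spin_sum (pre @ x # ys) (Suc (length pre)) = of_int (wt ys)"
proof -
  have "spin_sum (pre @ x # ys) (Suc (length pre)) = (\<Sum>k<length ys. if ys ! k then 1 else - 1)"
    unfolding spin_sum_def
    by (rule sum.reindex_bij_witness[where i = "\<lambda>k. k + Suc (length pre)" and j = "\<lambda>k. k -
        Suc (length pre)"])
       (auto simp: nth_append)
  also have "\<dots> = of_int (wt ys)"
  proof (induction ys)
    case (Cons y ys)
    then show ?case by (simp add: sum.lessThan_Suc_shift h_def del: sum.lessThan_Suc)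
  qed simp
  finally show ?thesis .
qed

text \<open>An operator on the auxiliary space and one site connects a state only to the four states
  that agree with it at all other sites.\<close>

lemma sum_fstates_site:
  fixes F :: "bool \<Rightarrow> bool \<Rightarrow> complex"
  assumes L: "length pre + Suc (length xs) = L"
    and G: "\<And>b y. G (b, pre @ y # xs) = F b y"
    and G0: "\<And>b ys. length ys = L \<Longrightarrow> \<not> (\<forall>k<L. k \<noteq> length pre \<longrightarrow> (pre @ x # xs) ! k = ys ! k) \<Longrightarrow> G
        (b, ys) = 0"
  shows "(\<Sum>s\<in>fstates L. G s) = (\<Sum>b\<in>UNIV. \<Sum>y\<in>UNIV. F b y)"
proof -
  define S where "S = (\<lambda>(b, y). (b, pre @ y # xs)) ` (UNIV :: (bool \<times> bool) set)"
  have S: "S \<subseteq> fstates L" using L by (auto simp: S_def fstates_def)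
  have "G s = 0" if "s \<in> fstates L - S" for s
  proof -
    obtain b ys where s: "s = (b, ys)" by (cases s)
    have n: "length ys = L" using that s by (auto simp: fstates_def)
    have "\<not> (\<forall>k<L. k \<noteq> length pre \<longrightarrow> (pre @ x # xs) ! k = ys ! k)"
    proof
      assume a: "\<forall>k<L. k \<noteq> length pre \<longrightarrow> (pre @ x # xs) ! k = ys ! k"
      have "ys = pre @ (ys ! length pre) # xs"
      proof (rule nth_equalityI)
        show "length ys = length (pre @ (ys ! length pre) # xs)" using L n by simp
        fix k assume "k < length ys"
        then show "ys ! k = (pre @ (ys ! length pre) # xs) ! k"
          using a n by (cases "k = length pre") (auto simp: nth_append nth_Cons split: nat.splits)
      qed
      then have "s \<in> S" unfolding S_def s by (metis (mono_tags, lifting) case_prod_conv image_eqI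
          UNIV_I)
      then show False using that by simp
    qed
    then show ?thesis using G0 s n by simp
  qed
  then have "(\<Sum>s\<in>fstates L. G s) = (\<Sum>s\<in>S. G s)"
    using S finite_fstates by (intro sum.mono_neutral_right) auto
  also have "\<dots> = (\<Sum>(b, y)\<in>UNIV. F b y)"
    unfolding S_def by (subst sum.reindex) (auto simp: inj_on_def G case_prod_beta' intro!:
        sum.cong)
  also have "\<dots> = (\<Sum>b\<in>UNIV. \<Sum>y\<in>UNIV. F b y)"
    by (simp add: sum.cartesian_product)
  finally show ?thesis .
qed

lemma opapply_R0j:
  assumes "length pre + Suc (length xs) = L"
  shows "opapply L (R0j L \<tau> \<gamma> l \<theta> (Suc (length pre))) \<psi> a (pre @ x # xs) =
     (\<Sum>c\<in>UNIV. \<Sum>u\<in>UNIV. R l (height xs) a x c u * \<psi> c (pre @ u # xs))"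
  unfolding opapply_def
proof (rule sum_fstates_site[OF assms, where x = x], goal_cases)
  case (1 b y)
  show ?case by (auto simp: R0j_def spin_sum_append nth_append)
next
  case (2 b ys)
  then show ?case by (auto simp: R0j_def)
qed

lemma opapply_Rj0:
  assumes "length pre + Suc (length xs) = L"
  shows "opapply L (Rj0 L \<tau> \<gamma> l \<theta> (Suc (length pre))) \<psi> a (pre @ x # xs) =
     (\<Sum>b\<in>UNIV. \<Sum>y\<in>UNIV. R l (height xs) x a y b * \<psi> b (pre @ y # xs))"
  unfolding opapply_def
proof (rule sum_fstates_site[OF assms, where x = x], goal_cases)
  case (1 b y)
  show ?case by (auto simp: Rj0_def spin_sum_append nth_append)
next
  case (2 b ys)
  then show ?case by (auto simp: Rj0_def)
qed

lemma opapply_Kop: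
  assumes "length xs = L" "f (\<theta> + \<zeta> + l) \<noteq> 0"
  shows "f (\<theta> + \<zeta> + l) * opapply L (Kop \<tau> \<zeta> l \<theta>) \<psi> a xs = kk l a * \<psi> a xs"
proof -
  have "opapply L (Kop \<tau> \<zeta> l \<theta>) \<psi> a xs = (\<Sum>s\<in>fstates L. if s = (a, xs) then
      (if a then f (\<zeta> + l) * f (\<theta> + \<zeta> - l) / f (\<theta> + \<zeta> + l) else f (\<zeta> - l)) * \<psi> a xs else 0)"
    unfolding opapply_def by (rule sum.cong) (auto simp: Kop_def split: if_splits)
  then show ?thesis using assms finite_fstates by (simp add: fstates_def kk_def)
qed

lemma mon_cong:
  assumes "\<And>b ys. length ys = length ms \<Longrightarrow> \<phi> b ys = \<xi> b ys"
  shows "mon ms l \<phi> a xs = mon ms l \<xi> a xs"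
  unfolding mon_blk using assms blk_cong by metis

text \<open>Stated for the last sites only, behind an untouched prefix, so that peeling the
  outermost pair of R-matrices becomes an induction. The factor f(theta+zeta+l) turns the boundary
  matrix into \<open>kk\<close>.\<close>

lemma opapply_chain:
  assumes "f (\<theta> + \<zeta> + l) \<noteq> 0" "length pre + length xs = L"
  shows "f (\<theta> + \<zeta> + l) * foldr (opapply L) (map (\<lambda>j. R0j L \<tau> \<gamma> (l - \<mu> j) \<theta> j)
      [Suc (length pre)..<Suc L])
      (opapply L (Kop \<tau> \<zeta> l \<theta>) (foldr (opapply L)
         (map (\<lambda>j. Rj0 L \<tau> \<gamma> (l + \<mu> j) \<theta> j) (rev [Suc (length pre)..<Suc L])) \<psi>)) a (pre @ xs) =
    mon (map \<mu> [Suc (length pre)..<Suc L]) l (\<lambda>d ys. \<psi> d (pre @ ys)) a xs"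
  using assms(2)
proof (induction xs arbitrary: pre \<psi> a)
  case Nil
  then show ?case using opapply_Kop[of pre L l \<psi> a] assms(1) by simp
next
  case (Cons x xs)
  define p where "p = Suc (length pre)"
  have p: "[p..<Suc L] = p # [Suc p..<Suc L]" using Cons.prems by (simp add: p_def upt_rec)
  let ?N = "f (\<theta> + \<zeta> + l)"
  let ?R = "map (\<lambda>j. R0j L \<tau> \<gamma> (l - \<mu> j) \<theta> j) [Suc p..<Suc L]"
  let ?S = "map (\<lambda>j. Rj0 L \<tau> \<gamma> (l + \<mu> j) \<theta> j) (rev [Suc p..<Suc L])"
  let ?\<psi> = "opapply L (Rj0 L \<tau> \<gamma> (l + \<mu> p) \<theta> p) \<psi>"
  have IH: "?N * foldr (opapply L) ?R (opapply L (Kop \<tau> \<zeta> l \<theta>) (foldr (opapply L) ?S ?\<psi>)) c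
      (pre @ u # xs) =
     mon (map \<mu> [Suc p..<Suc L]) l (\<lambda>d ys. ?\<psi> d (pre @ u # ys)) c xs" for c u
    using Cons.IH[of "pre @ [u]" ?\<psi> c] Cons.prems by (simp add: p_def del: upt_Suc)
  have in1: "mon (map \<mu> [Suc p..<Suc L]) l (\<lambda>d ys. ?\<psi> d (pre @ u # ys)) c xs =
     mon (map \<mu> [Suc p..<Suc L]) l (\<lambda>d ys. \<Sum>y\<in>UNIV. \<Sum>b\<in>UNIV.
       R (l + \<mu> p) (height ys) u d y b * \<psi> b (pre @ y # ys)) c xs" for c u
  proof (rule mon_cong)
    fix d :: bool and ys :: "bool list" assume "length ys = length (map \<mu> [Suc p..<Suc L])"
    then have "length pre + Suc (length ys) = L" using Cons.prems by (simp add: p_def del: upt_Suc)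
    then show "?\<psi> d (pre @ u # ys) = (\<Sum>y\<in>UNIV. \<Sum>b\<in>UNIV.
       R (l + \<mu> p) (height ys) u d y b * \<psi> b (pre @ y # ys))"
      unfolding p_def by (subst sum.swap) (rule opapply_Rj0)
  qed
  show ?case
    unfolding p_def[symmetric] p using Cons.prems opapply_R0j[of pre xs L]
    by (simp add: p_def[symmetric] sum_distrib_left mult.left_commute[of ?N] IH in1 del: upt_Suc)
qed

lemma opapply_dmon:
  assumes "f (\<theta> + \<zeta> + l) \<noteq> 0" "length xs = L"
  shows "f (\<theta> + \<zeta> + l) * opapply L (dmon L \<tau> \<gamma> \<theta> \<zeta> \<mu> l) \<psi> a xs = mon (map \<mu> [1..<Suc L]) l \<psi> a xs"
proof -
  have "opapply L (dmon L \<tau> \<gamma> \<theta> \<zeta> \<mu> l) \<psi> a xs =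
    foldr (opapply L) (map (\<lambda>j. R0j L \<tau> \<gamma> (l - \<mu> j) \<theta> j) [1..<Suc L])
      (opapply L (Kop \<tau> \<zeta> l \<theta>) (opapply L (Tbar L \<tau> \<gamma> \<mu> l \<theta>) \<psi>)) a xs"
    unfolding dmon_def opapply_opmul Tmon_def opapply_foldr[OF assms(2)] ..
  also have "opapply L (Kop \<tau> \<zeta> l \<theta>) (opapply L (Tbar L \<tau> \<gamma> \<mu> l \<theta>) \<psi>) =
     opapply L (Kop \<tau> \<zeta> l \<theta>) (foldr (opapply L)
         (map (\<lambda>j. Rj0 L \<tau> \<gamma> (l + \<mu> j) \<theta> j) (rev [1..<Suc L])) \<psi>)"
    by (intro ext opapply_cong) (simp only: Tbar_def opapply_foldr)
  finally show ?thesis using opapply_chain[OF assms(1), of "[]" xs L \<mu> \<psi> a] assms(2) by simp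
qed

lemma Bop_blk:
  assumes "f (\<theta> + \<zeta> + l) \<noteq> 0" "length xs = L"
  shows "f (\<theta> + \<zeta> + l) * (\<Sum>zs\<in>{zs. length zs = L}. Bop L \<tau> \<gamma> \<theta> \<zeta> \<mu> l xs zs * \<phi> zs) =
    blk (map \<mu> [1..<Suc L]) l True False \<phi> xs"
proof -
  have "(\<Sum>zs\<in>{zs. length zs = L}. Bop L \<tau> \<gamma> \<theta> \<zeta> \<mu> l xs zs * \<phi> zs) =
    opapply L (dmon L \<tau> \<gamma> \<theta> \<zeta> \<mu> l) (\<lambda>d ys. if d = False then \<phi> ys else 0) True xs"
    unfolding opapply_def fstates_def sum.cartesian_product[symmetric]
        by (simp add: UNIV_bool Bop_def)
  then show ?thesis unfolding blk_def using opapply_dmon[OF assms] by simp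
qed

lemma Zpf_Bs:
  assumes "\<forall>l\<in>set ls. f (\<theta> + \<zeta> + l) \<noteq> 0"
  shows "(\<Prod>l\<leftarrow>ls. f (\<theta> + \<zeta> + l)) * Zpf L \<tau> \<gamma> \<theta> \<zeta> \<mu> ls =
    Bs (map \<mu> [1..<Suc L]) ls (vac L) (replicate L False)"
proof -
  have "length xs = L \<Longrightarrow> (\<Prod>l\<leftarrow>ls. f (\<theta> + \<zeta> + l)) *
      foldr (wmul L) (map (Bop L \<tau> \<gamma> \<theta> \<zeta> \<mu>) ls) wid xs (replicate L True) =
    Bs (map \<mu> [1..<Suc L]) ls (vac L) xs" for xs
    using assms
  proof (induction ls arbitrary: xs)
    case Nil
    then show ?case by (simp add: wid_def vac_def)
  next
    case (Cons l ls)
    let ?X = "\<lambda>zs. foldr (wmul L) (map (Bop L \<tau> \<gamma> \<theta> \<zeta> \<mu>) ls) wid zs (replicate L True)"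
    let ?P = "\<Prod>l\<leftarrow>ls. f (\<theta> + \<zeta> + l)"
    have "(\<Prod>l\<leftarrow>l # ls. f (\<theta> + \<zeta> + l)) * foldr (wmul L) (map (Bop L \<tau> \<gamma> \<theta> \<zeta> \<mu>) (l # ls)) wid xs
        (replicate L True) =
      f (\<theta> + \<zeta> + l) * (\<Sum>zs\<in>{zs. length zs = L}. Bop L \<tau> \<gamma> \<theta> \<zeta> \<mu> l xs zs * (?P * ?X zs))"
      by (simp add: wmul_def sum_distrib_left mult_ac)
    also have "(\<Sum>zs\<in>{zs. length zs = L}. Bop L \<tau> \<gamma> \<theta> \<zeta> \<mu> l xs zs * (?P * ?X zs)) =
       (\<Sum>zs\<in>{zs. length zs = L}. Bop L \<tau> \<gamma> \<theta> \<zeta> \<mu> l xs zs * Bs (map \<mu> [1..<Suc L]) ls (vac L) zs)"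
      using Cons by (intro sum.cong refl) auto
    finally show ?case using Bop_blk[of l xs L] Cons.prems by simp
  qed
  then show ?thesis by (simp add: Zpf_def)
qed

section \<open>Omitted parameters and the coefficients of the relation\<close>

lemma del_nth_eq_filter:
  "distinct xs \<Longrightarrow> i < length xs \<Longrightarrow> del_nth i xs = filter (\<lambda>k. k \<noteq> xs ! i) xs"
proof (induction xs arbitrary: i)
  case (Cons x xs)
  show ?case
  proof (cases i)
    case 0
    have "filter (\<lambda>k. k \<noteq> x) xs = xs" using Cons.prems by (intro filter_True) auto
    then show ?thesis by (simp add: 0)
  next
    case (Suc j)
    then show ?thesis using Cons by auto
  qed
qed simp

lemma del_nth_map: "del_nth i (map g xs) = map g (del_nth i xs)"
  by (simp add: del_nth_def take_map drop_map)

lemma filter_sites_0: "filter (\<lambda>k. k \<noteq> 0) [0..<Suc L] = [1..<Suc L]"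
  by (simp add: upt_conv_Cons[of 0 "Suc L"] filter_id_conv del: upt_Suc)

lemma filter_sites_Suc:
  assumes "i < L"
  shows "filter (\<lambda>k. k \<noteq> Suc i) [0..<Suc L] = 0 # del_nth i [1..<Suc L]"
  using assms del_nth_eq_filter[of "[1..<Suc L]" i]
      by (simp add: upt_conv_Cons[of 0 "Suc L"] del: upt_Suc)

lemma prod_list_sites: "prod_list (map g [1..<Suc L]) = (\<Prod>j\<in>{1..L}. g j :: complex)"
  by (subst prod.distinct_set_conv_list[symmetric]) (auto intro!: prod.cong)

lemma prod_list_del_sites:
  assumes "i < L"
  shows "prod_list (map g (del_nth i [1..<Suc L])) = (\<Prod>j\<in>{1..L} - {Suc i}. g j :: complex)"
proof -
  have d: "del_nth i [1..<Suc L] = filter (\<lambda>k. k \<noteq> Suc i) [1..<Suc L]"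
    using assms del_nth_eq_filter[of "[1..<Suc L]" i] by (simp del: upt_Suc)
  show ?thesis unfolding d
    by (subst prod.distinct_set_conv_list[symmetric]) (auto intro!: prod.cong)
qed

lemma vac_eig_sites: "vac_eig (map \<mu> [1..<Suc L]) l =
    (\<Prod>j\<in>{1..L}. f (l - \<mu> j + \<gamma>) * f (l + \<mu> j + \<gamma>))"
  using prod_list_sites[of "\<lambda>j. f (l - \<mu> j + \<gamma>) * f (l + \<mu> j + \<gamma>)" L]
      by (simp add: vac_eig_def o_def del: upt_Suc)

text \<open>At the reflected point each pair of factors picks up two minus signs; this produces the
  site products of \<open>LamD\<close> and of the second summand of \<open>LamAbar\<close>.\<close>

lemma vac_eig_sites_crossed:
  "vac_eig (map \<mu> [1..<Suc L]) (- l - \<gamma>) = (\<Prod>j\<in>{1..L}. f (l - \<mu> j) * f (l + \<mu> j))"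
proof -
  have "f (- l - \<gamma> - m + \<gamma>) * f (- l - \<gamma> + m + \<gamma>) = f (l - m) * f (l + m)" for m
    using f_cong_minus[of "- l - \<gamma> - m + \<gamma>" "l + m"] f_cong_minus[of "- l - \<gamma> + m + \<gamma>" "l - m"]
    by (simp add: algebra_simps)
  then show ?thesis unfolding vac_eig_sites by simp
qed

lemma Mcoef_0:
  assumes "f (\<theta> + \<zeta> + lam 0) \<noteq> 0"
  shows "f (\<theta> + \<zeta> + lam 0) * Mcoef L \<tau> \<gamma> \<theta> \<zeta> \<mu> lam 0 =
     left_eig (map \<mu> [1..<Suc L]) (lam 0)
     - kk (lam 0) True * vac_eig (map \<mu> [1..<Suc L]) (lam 0) *
         prod_list (map (al (lam 0)) (map lam [1..<Suc L]))"
proof -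
  have 1: "prod_list (map (al (lam 0)) (map lam [1..<Suc L])) =
      (\<Prod>j\<in>{1..L}. f (lam j - lam 0 + \<gamma>) * f (lam j + lam 0) /
          (f (lam j - lam 0) * f (lam j + lam 0 + \<gamma>)))"
    using prod_list_sites[of "\<lambda>j. al (lam 0) (lam j)" L] by (simp add: al_def o_def del: upt_Suc)
  have 2: "f (\<theta> + \<zeta> + lam 0) * LamA L \<tau> \<gamma> \<theta> \<zeta> \<mu> (lam 0) = kk (lam 0) True *
      vac_eig (map \<mu> [1..<Suc L]) (lam 0)"
    using assms unfolding LamA_def vac_eig_sites kk_def by (simp add: field_simps)
  have 3: "kk (- lam 0 - \<gamma>) False = f (\<zeta> + lam 0 + \<gamma>) * f (\<theta> + \<zeta> - lam 0 - \<gamma>)"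
    by (simp add: kk_def algebra_simps)
  have 4: "f (\<theta> + \<zeta> + lam 0) * LamAbar L \<tau> \<gamma> \<theta> \<zeta> \<mu> (lam 0) = left_eig (map \<mu> [1..<Suc L]) (lam 0)"
    using assms unfolding LamAbar_def left_eig_def Let_def vac_eig_sites_crossed 3
    unfolding vac_eig_sites by (simp add: kk_def distrib_left mult_ac del: upt_Suc)
  show ?thesis
    unfolding Mcoef_def 1 2[symmetric] 4[symmetric] by (simp add: algebra_simps)
qed

text \<open>The quotient of f(theta - L gamma) and f(theta - (L-1) gamma) inside \<open>LamD\<close>
  cancels against the inverse quotient in \<open>Mcoef\<close>, leaving \<open>be2\<close> times the
  reflected eigenvalue.\<close>

lemma Mcoef_Suc:
  assumes i: "i < L" and N: "f (\<theta> + \<zeta> + lam (Suc i)) \<noteq> 0"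
    and nz: "f (\<theta> - (of_nat L - 1) * \<gamma>) \<noteq> 0" "f (\<theta> - of_nat L * \<gamma>) \<noteq> 0"
  shows "f (\<theta> + \<zeta> + lam (Suc i)) * Mcoef L \<tau> \<gamma> \<theta> \<zeta> \<mu> lam (Suc i) =
     bethe_coef (\<lambda>l. kk l True * vac_eig (map \<mu> [1..<Suc L]) l) (\<theta> + (of_nat L - 2) * \<gamma>) (lam 0)
       (lam (Suc i)) (map lam (del_nth i [1..<Suc L]))"
proof -
  define w where "w = lam (Suc i)"
  define e where "e = \<theta> + (of_nat L - 2) * \<gamma>"
  have e: "\<theta> + (of_nat L - 1) * \<gamma> = e + \<gamma>" by (simp add: e_def algebra_simps)
  define P1 where "P1 = (\<Prod>j\<in>{1..L} - {Suc i}. f (lam j - w + \<gamma>) *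
      f (lam j + w) / (f (lam j - w) * f (lam j + w + \<gamma>)))"
  define P2 where "P2 = (\<Prod>j\<in>{1..L} - {Suc i}. f (w - lam j + \<gamma>) *
      f (w + lam j + 2 * \<gamma>) / (f (w - lam j) * f (w + lam j + \<gamma>)))"
  have P1: "prod_list (map (al w) (map lam (del_nth i [1..<Suc L]))) = P1"
    using prod_list_del_sites[OF i, of "\<lambda>j. al w (lam j)"]
        by (simp add: P1_def al_def o_def del: upt_Suc)
  \<comment> \<open>The second product in \<open>Mcoef\<close> is the first one taken at the
    reflected parameter.\<close>
  have "al (- w - \<gamma>) v = f (w - v + \<gamma>) * f (w + v + 2 * \<gamma>) / (f (w - v) * f (w + v + \<gamma>))" for v
  proof -
    have "f (v - (- w - \<gamma>) + \<gamma>) = f (w + v + 2 * \<gamma>)" "f (v + (- w - \<gamma>)) = - f (w - v + \<gamma>)"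
      "f (v - (- w - \<gamma>)) = f (w + v + \<gamma>)" "f (v + (- w - \<gamma>) + \<gamma>) = - f (w - v)"
      by (rule f_cong f_cong_minus; simp)+
    then show ?thesis unfolding al_def by (simp add: mult.commute)
  qed
  then have P2: "prod_list (map (al (- w - \<gamma>)) (map lam (del_nth i [1..<Suc L]))) = P2"
    using prod_list_del_sites[OF i, of "\<lambda>j. al (- w - \<gamma>) (lam j)"]
        by (simp add: P2_def o_def del: upt_Suc)
  have A: "f (\<theta> + \<zeta> + w) * LamA L \<tau> \<gamma> \<theta> \<zeta> \<mu> w = kk w True * vac_eig (map \<mu> [1..<Suc L]) w"
    using N unfolding LamA_def vac_eig_sites kk_def w_def by (simp add: field_simps)
  have k: "kk (- w - \<gamma>) True = f (\<zeta> - w - \<gamma>) * f (\<theta> + \<zeta> + w + \<gamma>)"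
    by (simp add: kk_def algebra_simps)
  have D: "f (\<theta> + \<zeta> + w) * LamD L \<tau> \<gamma> \<theta> \<zeta> \<mu> w =
     f (2 * w) * f (\<theta> - of_nat L * \<gamma>) / (f (2 * w + \<gamma>) * f (\<theta> - (of_nat L - 1) * \<gamma>)) *
     (kk (- w - \<gamma>) True * vac_eig (map \<mu> [1..<Suc L]) (- w - \<gamma>))"
    using N nz unfolding w_def[symmetric] LamD_def vac_eig_sites_crossed k by (simp add: mult_ac)
  have "f (\<theta> + \<zeta> + w) * Mcoef L \<tau> \<gamma> \<theta> \<zeta> \<mu> lam (Suc i) =
     f (2 * w) * f \<gamma> * f (e + \<gamma> + w - lam 0) / (f (2 * w + \<gamma>) * f (w - lam 0) * f (e + \<gamma>)) *
       (f (\<theta> + \<zeta> + w) * LamA L \<tau> \<gamma> \<theta> \<zeta> \<mu> w) * P1 +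
     f \<gamma> * f (e - w - lam 0) * f (\<theta> - (of_nat L - 1) * \<gamma>) /
         (f (w + lam 0 + \<gamma>) * f (e + \<gamma>) * f (\<theta> - of_nat L * \<gamma>)) *
       (f (\<theta> + \<zeta> + w) * LamD L \<tau> \<gamma> \<theta> \<zeta> \<mu> w) * P2"
    unfolding Mcoef_def P1_def P2_def w_def[symmetric] e e_def[symmetric]
        by (simp add: distrib_left mult_ac)
  also have "\<dots> = be1 e (lam 0) w * (kk w True * vac_eig (map \<mu> [1..<Suc L]) w * P1) +
     be2 e (lam 0) w * (kk (- w - \<gamma>) True * vac_eig (map \<mu> [1..<Suc L]) (- w - \<gamma>) * P2)"
    unfolding A D be1_def be2_def using nz by (simp add: mult_ac)
  finally show ?thesis
    unfolding bethe_coef_def w_def[symmetric] e_def[symmetric] P1 P2 by (simp add: mult.assoc)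
qed

text \<open>The partition functions omit different parameters, so their normalisations differ: the
  term with index k lacks the factor \<open>Nn k\<close>, which is precisely the one that normalises
  its coefficient. Multiplying everything by the product P of all these factors restores
  both.\<close>

lemma generic_relation:
  fixes lam \<mu> :: "nat \<Rightarrow> complex" and L :: nat
  defines "ms \<equiv> map \<mu> [1..<Suc L]"
  assumes nz: "\<And>k. \<bar>k\<bar> \<le> int L + 5 \<Longrightarrow> f (\<theta> + of_int k * \<gamma>) \<noteq> 0"
    and N: "\<And>k. k \<le> L \<Longrightarrow> f (\<theta> + \<zeta> + lam k) \<noteq> 0"
    and u: "f (2 * lam 0) \<noteq> 0" "f (2 * lam 0 + \<gamma>) \<noteq> 0"
    and g: "\<And>i j. i < j \<Longrightarrow> j \<le> L \<Longrightarrow> gen ms (lam i) (lam j) \<and> gen ms (- lam i - \<gamma>) (lam j)"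
  shows "(\<Sum>\<nu>=0..L. Mcoef L \<tau> \<gamma> \<theta> \<zeta> \<mu> lam \<nu>
            * Zpf L \<tau> \<gamma> \<theta> \<zeta> \<mu> (map lam (filter (\<lambda>k. k \<noteq> \<nu>) [0..<Suc L]))) = 0"
proof -
  define vs where "vs = map lam [1..<Suc L]"
  define Nn where "Nn k = f (\<theta> + \<zeta> + lam k)" for k
  define P where "P = prod_list (map Nn [0..<Suc L])"
  define Z where "Z ls = Bs ms ls (vac L) (replicate L False)" for ls
  have len: "length ms = L" "length vs = L" by (simp_all add: ms_def vs_def del: upt_Suc)
  have P: "P \<noteq> 0" using N by (auto simp: P_def prod_list_zero_iff Nn_def less_Suc_eq_le simp del:
      upt_Suc)
  have PZ: "prod_list (map Nn ks) * Zpf L \<tau> \<gamma> \<theta> \<zeta> \<mu> (map lam ks) = Z (map lam ks)"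
      if "set ks \<subseteq> {..L}" for ks
  proof -
    have "\<forall>l\<in>set (map lam ks). f (\<theta> + \<zeta> + l) \<noteq> 0" using N that by auto
    from Zpf_Bs[OF this, of L \<mu>] show ?thesis
      unfolding Z_def ms_def Nn_def by (simp add: o_def del: upt_Suc)
  qed
  have P0: "P = Nn 0 * prod_list (map Nn [1..<Suc L])"
    unfolding P_def by (simp add: upt_conv_Cons[of 0 "Suc L"] del: upt_Suc)
  have PS: "P = Nn (Suc i) * prod_list (map Nn (0 # del_nth i [1..<Suc L]))" if "i < L" for i
  proof -
    have "prod_list (map Nn [1..<Suc L]) = (\<Prod>j\<in>{1..L}. Nn j)" by (rule prod_list_sites)
    also have "\<dots> = Nn (Suc i) * (\<Prod>j\<in>{1..L} - {Suc i}. Nn j)"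
      using that by (intro prod.remove) auto
    finally show ?thesis unfolding P0 using prod_list_del_sites[OF that, of Nn]
        by (simp del: upt_Suc)
  qed
  have sub: "set (del_nth i [1..<Suc L]) \<subseteq> {..L}" if "i < L" for i
    using that del_nth_eq_filter[of "[1..<Suc L]" i] by (auto simp del: upt_Suc)
  have "P * (\<Sum>\<nu>=0..L. Mcoef L \<tau> \<gamma> \<theta> \<zeta> \<mu> lam \<nu> *
      Zpf L \<tau> \<gamma> \<theta> \<zeta> \<mu> (map lam (filter (\<lambda>k. k \<noteq> \<nu>) [0..<Suc L])))
     = P * (Mcoef L \<tau> \<gamma> \<theta> \<zeta> \<mu> lam 0 * Zpf L \<tau> \<gamma> \<theta> \<zeta> \<mu> vs) +
       (\<Sum>i<L. P * (Mcoef L \<tau> \<gamma> \<theta> \<zeta> \<mu> lam (Suc i) *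
           Zpf L \<tau> \<gamma> \<theta> \<zeta> \<mu> (lam 0 # map lam (del_nth i [1..<Suc L]))))"
    unfolding atLeast0AtMost sum.atMost_shift filter_sites_0 distrib_left sum_distrib_left vs_def
    using filter_sites_Suc by (simp del: upt_Suc)
  also have "\<dots> = (Nn 0 * Mcoef L \<tau> \<gamma> \<theta> \<zeta> \<mu> lam 0) * Z vs +
       (\<Sum>i<L. (Nn (Suc i) * Mcoef L \<tau> \<gamma> \<theta> \<zeta> \<mu> lam (Suc i)) *
           Z (lam 0 # map lam (del_nth i [1..<Suc L])))"
  proof (intro arg_cong2[where f = "(+)"] sum.cong refl)
    show "P * (Mcoef L \<tau> \<gamma> \<theta> \<zeta> \<mu> lam 0 * Zpf L \<tau> \<gamma> \<theta> \<zeta> \<mu> vs) = Nn 0 * Mcoef L \<tau> \<gamma> \<theta> \<zeta> \<mu> lam 0 *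
        Z vs"
    proof -
      have "set [1..<Suc L] \<subseteq> {..L}" by auto
      from PZ[OF this] show ?thesis unfolding P0 by (simp add: vs_def mult_ac del: upt_Suc)
    qed
    fix i assume "i \<in> {..<L}"
    then show "P * (Mcoef L \<tau> \<gamma> \<theta> \<zeta> \<mu> lam (Suc i) *
        Zpf L \<tau> \<gamma> \<theta> \<zeta> \<mu> (lam 0 # map lam (del_nth i [1..<Suc L]))) =
      Nn (Suc i) * Mcoef L \<tau> \<gamma> \<theta> \<zeta> \<mu> lam (Suc i) * Z (lam 0 # map lam (del_nth i [1..<Suc L]))"
      using PS[of i] PZ[of "0 # del_nth i [1..<Suc L]"] sub[of i]
          by (simp add: mult_ac del: upt_Suc)
  qed
  also have "\<dots> = (left_eig ms (lam 0) - kk (lam 0) True * vac_eig ms (lam 0) *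
      prod_list (map (al (lam 0)) vs)) * Z vs +
    (\<Sum>i<L. bethe_coef (\<lambda>l. kk l True * vac_eig ms l) (\<theta> + (of_nat L - 2) * \<gamma>) (lam 0) (vs ! i)
        (del_nth i vs) * Z (lam 0 # del_nth i vs))"
  proof (intro arg_cong2[where f = "(+)"] sum.cong refl)
    show "Nn 0 * Mcoef L \<tau> \<gamma> \<theta> \<zeta> \<mu> lam 0 * Z vs =
      (left_eig ms (lam 0) - kk (lam 0) True * vac_eig ms (lam 0) *
          prod_list (map (al (lam 0)) vs)) * Z vs"
      using Mcoef_0[of lam L \<mu>] N[of 0] unfolding Nn_def ms_def vs_def by (simp del: upt_Suc)
    fix i assume "i \<in> {..<L}"
    then have i: "i < L" by simp
    have n: "f (\<theta> - (of_nat L - 1) * \<gamma>) \<noteq> 0" "f (\<theta> - of_nat L * \<gamma>) \<noteq> 0"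
      using nz[of "- (int L - 1)"] nz[of "- int L"] by (simp_all add: algebra_simps)
    have v: "vs ! i = lam (Suc i)" "del_nth i vs = map lam (del_nth i [1..<Suc L])"
      using i by (simp_all add: vs_def del_nth_map del: upt_Suc)
    show "Nn (Suc i) * Mcoef L \<tau> \<gamma> \<theta> \<zeta> \<mu> lam (Suc i) * Z (lam 0 # map lam (del_nth i [1..<Suc L])) =
      bethe_coef (\<lambda>l. kk l True * vac_eig ms l) (\<theta> + (of_nat L - 2) * \<gamma>) (lam 0) (vs ! i)
          (del_nth i vs) * Z (lam 0 # del_nth i vs)"
      using Mcoef_Suc[OF i _ n, of lam \<mu>] N[of "Suc i"] i unfolding v Nn_def ms_def by simp
  qed
  also have "\<dots> = 0"
  proof -
    have "\<forall>w\<in>set vs. gen ms (lam 0) w"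
      using g by (auto simp: vs_def less_Suc_eq_le simp del: upt_Suc)
    moreover have "sorted_wrt (\<lambda>v w. gen ms v w \<and> gen ms (- v - \<gamma>) w) vs"
      unfolding vs_def sorted_wrt_map
      by (rule sorted_wrt_mono_rel[OF _ sorted_wrt_upt]) (use g in \<open>auto simp del: upt_Suc\<close>)
    ultimately show ?thesis
      using functional_relation[of ms "lam 0" vs] nz u unfolding Z_def len by simp
  qed
  finally show ?thesis using P by simp
qed

text \<open>A line of nonzero slope passes through x0, so t -> f (g t) is entire and not identically
  zero. Its zeros are isolated, and it is nonzero near t = 0 even if it vanishes at 0.\<close>

lemma eventually_f_nonzero:
  assumes "f x0 \<noteq> 0" "d \<noteq> 0" "\<And>t. g t = c + d * t"
  shows "\<forall>\<^sub>F t in at 0. f (g t) \<noteq> 0"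
proof -
  have hol: "(\<lambda>t. f (g t)) holomorphic_on UNIV"
  proof -
    have "g = (\<lambda>t. c + d * t)" using assms(3) by auto
    then have "g holomorphic_on UNIV" by (auto intro!: holomorphic_intros)
    from holomorphic_on_compose[OF this holomorphic_on_subset[OF thf_holomorphic[OF Im_pos]]]
    show ?thesis by (simp add: o_def)
  qed
  have "g ((x0 - c) / d) = x0" using assms by simp
  then have "f (g ((x0 - c) / d)) \<noteq> 0" using assms by simp
  then have "\<forall>\<^sub>F t in at 0. f (g t) \<noteq> 0 \<and> t \<in> UNIV"
    using non_zero_neighbour_alt[OF hol _ _ _ UNIV_I] by auto
  then show ?thesis by simp
qed

lemma eventually_gen:
  assumes "f x0 \<noteq> 0" and cd: "c \<noteq> 0" "d \<noteq> 0" "d - c \<noteq> 0" "d + c \<noteq> 0"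
  shows "\<forall>\<^sub>F t in at 0. gen ms (a + c * t) (b + d * t)"
proof -
  note ev = eventually_f_nonzero[OF assms(1)]
  have nr: "\<forall>\<^sub>F t in at 0. nonres ms (a + c * t)" if "c \<noteq> 0" for a c
    unfolding nonres_def
  proof (intro eventually_ball_finite ballI eventually_conj)
    fix m
    show "\<forall>\<^sub>F t in at 0. f (\<gamma> + (a + c * t + m)) \<noteq> 0"
      by (rule ev[of c _ "\<gamma> + a + m"]) (use that in \<open>auto simp: algebra_simps\<close>)
    show "\<forall>\<^sub>F t in at 0. f (\<gamma> - (a + c * t + m)) \<noteq> 0"
      by (rule ev[of "- c" _ "\<gamma> - a - m"]) (use that in \<open>auto simp: algebra_simps\<close>)
  qed simp
  have "\<forall>\<^sub>F t in at 0. f ((b + d * t) - (a + c * t)) \<noteq> 0"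
    by (rule ev[of "d - c" _ "b - a"]) (use cd in \<open>auto simp: algebra_simps\<close>)
  moreover have "\<forall>\<^sub>F t in at 0. f ((b + d * t) + (a + c * t) + \<gamma>) \<noteq> 0"
    by (rule ev[of "d + c" _ "b + a + \<gamma>"]) (use cd in \<open>auto simp: algebra_simps\<close>)
  moreover have "\<forall>\<^sub>F t in at 0. f ((b + d * t) + (a + c * t)) \<noteq> 0"
    by (rule ev[of "d + c" _ "b + a"]) (use cd in \<open>auto simp: algebra_simps\<close>)
  moreover have "\<forall>\<^sub>F t in at 0. f ((b + d * t) - (a + c * t) + \<gamma>) \<noteq> 0"
    by (rule ev[of "d - c" _ "b - a + \<gamma>"]) (use cd in \<open>auto simp: algebra_simps\<close>)
  moreover have "\<forall>\<^sub>F t in at 0. f (2 * (b + d * t)) \<noteq> 0"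
    by (rule ev[of "2 * d" _ "2 * b"]) (use cd in \<open>auto simp: algebra_simps\<close>)
  moreover have "\<forall>\<^sub>F t in at 0. f (2 * (b + d * t) + \<gamma>) \<noteq> 0"
    by (rule ev[of "2 * d" _ "2 * b + \<gamma>"]) (use cd in \<open>auto simp: algebra_simps\<close>)
  ultimately show ?thesis
    using nr[OF cd(1), of a] nr[OF cd(2), of b] unfolding gen_def by eventually_elim blast
qed

end

section \<open>Removing the genericity assumptions\<close>

lemma tendsto_thf:
  assumes "Im \<tau> > 0" "(g \<longlongrightarrow> a) F"
  shows "((\<lambda>t. thf \<tau> (g t)) \<longlongrightarrow> thf \<tau> a) F"
proof -
  have "isCont (thf \<tau>) a"
    using holomorphic_on_imp_continuous_on[OF thf_holomorphic[OF assms(1)]]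
    by (simp add: continuous_on_eq_continuous_at)
  then show ?thesis using assms(2) by (rule isCont_tendsto_compose)
qed

lemma tendsto_Rent:
  assumes "Im \<tau> > 0" "(l \<longlongrightarrow> l0) F" "(th \<longlongrightarrow> th0) F" "thf \<tau> th0 \<noteq> 0"
  shows "((\<lambda>t. Rent \<tau> \<gamma> (l t) (th t) a b c d) \<longlongrightarrow> Rent \<tau> \<gamma> l0 th0 a b c d) F"
proof -
  note tendsto_thf[OF assms(1), tendsto_intros]
  show ?thesis
    unfolding Rent_def
    by (cases a; cases b; cases c; cases d) (auto intro!: tendsto_intros assms)
qed

lemma tendsto_if_const:
  "(c \<Longrightarrow> (g \<longlongrightarrow> g0) F) \<Longrightarrow> (\<not> c \<Longrightarrow> (k \<longlongrightarrow> k0) F) \<Longrightarrow>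
   ((\<lambda>t. if c then g t else k t) \<longlongrightarrow> (if c then g0 else k0)) F"
  by (cases c) auto

lemma spin_sum_int:
  obtains k :: int where "spin_sum xs j = of_int k" "\<bar>k\<bar> \<le> int (length xs)"
proof
  let ?k = "\<Sum>i\<in>{j..<length xs}. if xs ! i then 1 else - 1 :: int"
  show "spin_sum xs j = of_int ?k" by (auto simp: spin_sum_def intro!: sum.cong)
  have "\<bar>?k\<bar> \<le> (\<Sum>i\<in>{j..<length xs}. \<bar>if xs ! i then 1 else - 1\<bar>)" by (rule sum_abs)
  also have "\<dots> = (\<Sum>i\<in>{j..<length xs}. 1)" by (rule sum.cong) auto
  also have "\<dots> \<le> int (length xs)" by simp
  finally show "\<bar>?k\<bar> \<le> int (length xs)" .
qed

text \<open>Convergence is asked only between states of L sites, because the denominators are under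
  control only for their heights.\<close>

definition op_tendsto :: "nat \<Rightarrow> ('a \<Rightarrow> fop) \<Rightarrow> fop \<Rightarrow> 'a filter \<Rightarrow> bool" where
  "op_tendsto L Op Op0 F \<longleftrightarrow>
     (\<forall>out\<in>fstates L. \<forall>inp\<in>fstates L. ((\<lambda>t. Op t out inp) \<longlongrightarrow> Op0 out inp) F)"

lemma op_tendsto_opmul:
  "op_tendsto L O1 O1' F \<Longrightarrow> op_tendsto L O2 O2' F \<Longrightarrow>
   op_tendsto L (\<lambda>t. opmul L (O1 t) (O2 t)) (opmul L O1' O2') F"
  unfolding op_tendsto_def opmul_def by (auto intro!: tendsto_intros)

lemma op_tendsto_foldr:
  assumes "\<And>j. op_tendsto L (\<lambda>t. G t j) (G0 j) F"
  shows "op_tendsto L (\<lambda>t. foldr (opmul L) (map (G t) js) opid) (foldr (opmul L) (map G0 js) opid)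
      F"
proof (induction js)
  case Nil
  then show ?case by (simp add: op_tendsto_def)
next
  case (Cons j js)
  then show ?case using op_tendsto_opmul[OF assms] by simp
qed

text \<open>The only denominators are f at the heights theta + k gamma with |k| <= L and the
  f(theta+zeta+lambda) of the boundary matrices.\<close>

lemma tendsto_Zpf:
  assumes \<tau>: "Im \<tau> > 0" and th: "(th \<longlongrightarrow> \<theta>) F" and lm: "\<And>k. ((\<lambda>t. lm t k) \<longlongrightarrow> lam k) F"
    and nz: "\<forall>k::int. \<bar>k\<bar> \<le> int L \<longrightarrow> thf \<tau> (\<theta> + of_int k * \<gamma>) \<noteq> 0"
    and N: "\<forall>k\<in>set ks. thf \<tau> (\<theta> + \<zeta> + lam k) \<noteq> 0"
  shows "((\<lambda>t. Zpf L \<tau> \<gamma> (th t) \<zeta> \<mu> (map (lm t) ks)) \<longlongrightarrow> Zpf L \<tau> \<gamma> \<theta> \<zeta> \<mu> (map lam ks)) F"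
proof -
  have nz': "thf \<tau> (\<theta> - \<gamma> * spin_sum ys j) \<noteq> 0" if "length ys = L" for ys j
  proof -
    obtain k :: int where "spin_sum ys j = of_int k" "\<bar>k\<bar> \<le> int (length ys)" by (rule spin_sum_int)
    then show ?thesis using nz[rule_format, of "- k"] that by (simp add: algebra_simps)
  qed
  have R0: "op_tendsto L (\<lambda>t. R0j L \<tau> \<gamma> (l t) (th t) j) (R0j L \<tau> \<gamma> l0 \<theta> j) F" if "(l \<longlongrightarrow> l0) F"
      for l l0 j
    unfolding op_tendsto_def
  proof (intro ballI)
    fix out inp assume "out \<in> fstates L" "inp \<in> fstates L"
    then obtain a xs b ys where s: "out = (a, xs)" "inp = (b, ys)" "length ys = L"
      by (auto simp: fstates_def)
    show "((\<lambda>t. R0j L \<tau> \<gamma> (l t) (th t) j out inp) \<longlongrightarrow> R0j L \<tau> \<gamma> l0 \<theta> j out inp) F"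
      unfolding s R0j_def split_conv
      by (intro tendsto_if_const tendsto_Rent[OF \<tau>] tendsto_intros that th nz' s(3))
  qed
  have R1: "op_tendsto L (\<lambda>t. Rj0 L \<tau> \<gamma> (l t) (th t) j) (Rj0 L \<tau> \<gamma> l0 \<theta> j) F" if "(l \<longlongrightarrow> l0) F"
      for l l0 j
    unfolding op_tendsto_def
  proof (intro ballI)
    fix out inp assume "out \<in> fstates L" "inp \<in> fstates L"
    then obtain a xs b ys where s: "out = (a, xs)" "inp = (b, ys)" "length ys = L"
      by (auto simp: fstates_def)
    show "((\<lambda>t. Rj0 L \<tau> \<gamma> (l t) (th t) j out inp) \<longlongrightarrow> Rj0 L \<tau> \<gamma> l0 \<theta> j out inp) F"
      unfolding s Rj0_def split_conv
      by (intro tendsto_if_const tendsto_Rent[OF \<tau>] tendsto_intros that th nz' s(3))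
  qed
  have K: "op_tendsto L (\<lambda>t. Kop \<tau> \<zeta> (l t) (th t)) (Kop \<tau> \<zeta> l0 \<theta>) F"
    if "(l \<longlongrightarrow> l0) F" "thf \<tau> (\<theta> + \<zeta> + l0) \<noteq> 0" for l l0
    unfolding op_tendsto_def
  proof (intro ballI)
    fix out inp :: "bool \<times> bool list"
    obtain a xs b ys where s: "out = (a, xs)" "inp = (b, ys)" by (metis surj_pair)
    show "((\<lambda>t. Kop \<tau> \<zeta> (l t) (th t) out inp) \<longlongrightarrow> Kop \<tau> \<zeta> l0 \<theta> out inp) F"
      unfolding s Kop_def split_conv
      by (intro tendsto_if_const tendsto_thf[OF \<tau>] tendsto_intros that th)
  qed
  have B: "((\<lambda>t. Bop L \<tau> \<gamma> (th t) \<zeta> \<mu> (l t) xs ys) \<longlongrightarrow> Bop L \<tau> \<gamma> \<theta> \<zeta> \<mu> l0 xs ys) F"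
    if l: "(l \<longlongrightarrow> l0) F" "thf \<tau> (\<theta> + \<zeta> + l0) \<noteq> 0" and n: "length xs = L" "length ys = L"
        for l l0 xs ys
  proof -
    have "op_tendsto L (\<lambda>t. dmon L \<tau> \<gamma> (th t) \<zeta> \<mu> (l t)) (dmon L \<tau> \<gamma> \<theta> \<zeta> \<mu> l0) F"
      unfolding dmon_def Tmon_def Tbar_def
      by (intro op_tendsto_opmul op_tendsto_foldr K R0 R1 l tendsto_intros)
    then show ?thesis using n unfolding op_tendsto_def Bop_def fstates_def by auto
  qed
  have "length xs = L \<Longrightarrow> ((\<lambda>t. foldr (wmul L) (map (Bop L \<tau> \<gamma> (th t) \<zeta> \<mu>) (map (lm t) ks)) wid xs
      zs) \<longlongrightarrow>
     foldr (wmul L) (map (Bop L \<tau> \<gamma> \<theta> \<zeta> \<mu>) (map lam ks)) wid xs zs) F" for xs zs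
    using N
  proof (induction ks arbitrary: xs)
    case (Cons k ks)
    then show ?case unfolding list.map foldr.simps o_def wmul_def
      by (intro tendsto_sum tendsto_mult B lm) auto
  qed simp
  then show ?thesis unfolding Zpf_def by simp
qed

lemma tendsto_Mcoef:
  assumes \<tau>: "Im \<tau> > 0" and th: "(th \<longlongrightarrow> \<theta>) F" and lm: "\<And>k. ((\<lambda>t. lm t k) \<longlongrightarrow> lam k) F"
    and l1: "\<forall>k\<le>L. \<forall>l\<le>L. k \<noteq> l \<longrightarrow> thf \<tau> (lam k - lam l) \<noteq> 0"
    and l2: "\<forall>k\<le>L. \<forall>l\<le>L. thf \<tau> (lam k + lam l + \<gamma>) \<noteq> 0"
    and N: "\<forall>k\<le>L. thf \<tau> (\<theta> + \<zeta> + lam k) \<noteq> 0"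
    and nz: "\<forall>k::int. \<bar>k\<bar> \<le> int L \<longrightarrow> thf \<tau> (\<theta> + of_int k * \<gamma>) \<noteq> 0"
    and \<nu>: "\<nu> \<le> L" and L: "L \<ge> 1"
  shows "((\<lambda>t. Mcoef L \<tau> \<gamma> (th t) \<zeta> \<mu> (lm t) \<nu>) \<longlongrightarrow> Mcoef L \<tau> \<gamma> \<theta> \<zeta> \<mu> lam \<nu>) F"
proof -
  have n: "thf \<tau> (\<theta> + (of_nat L - 1) * \<gamma>) \<noteq> 0" "thf \<tau> (\<theta> - (of_nat L - 1) * \<gamma>) \<noteq> 0"
      "thf \<tau> (\<theta> - of_nat L * \<gamma>) \<noteq> 0"
    using nz[rule_format, of "int L - 1"] nz[rule_format, of "- (int L - 1)"]
        nz[rule_format, of "- int L"] L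
    by (auto simp: algebra_simps)
  have d: "thf \<tau> (2 * lam k + \<gamma>) \<noteq> 0" if "k \<le> L" for k
    using l2[rule_format, OF that that] by (simp only: mult_2 not_False_eq_True)
  show ?thesis
  proof (cases "\<nu> = 0")
    case True
    show ?thesis unfolding Mcoef_def if_P[OF True] LamAbar_def LamA_def
      using n d[of 0] N l1 l2
      by (intro tendsto_intros tendsto_thf[OF \<tau>] th lm) auto
  next
    case False
    show ?thesis unfolding Mcoef_def if_not_P[OF False] LamD_def LamA_def
      using n d[OF \<nu>] N l1 l2 \<nu> False
      by (intro tendsto_intros tendsto_thf[OF \<tau>] th lm) auto
  qed
qed

theorem theorem3p1:
  fixes \<tau> \<gamma> \<theta> \<zeta> :: complex and \<mu> lam :: "nat \<Rightarrow> complex" and L :: nat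
  assumes "Im \<tau> > 0" and "L \<ge> 1"
    and "\<forall>k\<le>L. \<forall>l\<le>L. k \<noteq> l \<longrightarrow> thf \<tau> (lam k - lam l) \<noteq> 0"
    and "\<forall>k\<le>L. \<forall>l\<le>L. thf \<tau> (lam k + lam l + \<gamma>) \<noteq> 0"
    and "\<forall>k\<le>L. thf \<tau> (\<theta> + \<zeta> + lam k) \<noteq> 0"
    and "\<forall>k::int. \<bar>k\<bar> \<le> int L \<longrightarrow> thf \<tau> (\<theta> + of_int k * \<gamma>) \<noteq> 0"
  shows "(\<Sum>\<nu>=0..L. Mcoef L \<tau> \<gamma> \<theta> \<zeta> \<mu> lam \<nu>
            * Zpf L \<tau> \<gamma> \<theta> \<zeta> \<mu> (map lam (filter (\<lambda>k. k \<noteq> \<nu>) [0..<Suc L]))) = 0"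
proof -
  interpret sos \<tau> \<gamma> \<theta> \<zeta> by unfold_locales (rule assms(1))
  \<comment> \<open>The point theta serves as witness that f is not identically zero.\<close>
  have f0: "f \<theta> \<noteq> 0" using assms(6)[rule_format, of 0] by simp
  note ev = eventually_f_nonzero[OF f0]
  define th where "th t = \<theta> + t" for t
  \<comment> \<open>The slopes are distinct positive integers, so every slope needed below is
    nonzero: differences and sums of two parameters, also after reflecting one of them to slope
    -(k+1), and theta + zeta + lambda_k, where theta adds one to give k + 2.\<close>
  define lm where "lm t k = lam k + of_nat (Suc k) * t" for t k
  define S where "S th lm = (\<Sum>\<nu>=0..L. Mcoef L \<tau> \<gamma> th \<zeta> \<mu> lm \<nu>
            * Zpf L \<tau> \<gamma> th \<zeta> \<mu> (map lm (filter (\<lambda>k. k \<noteq> \<nu>) [0..<Suc L])))" for th lm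
  define ms where "ms = map \<mu> [1..<Suc L]"
  have th: "(th \<longlongrightarrow> \<theta>) (at 0)" unfolding th_def by (auto intro!: tendsto_eq_intros)
  have lm: "((\<lambda>t. lm t k) \<longlongrightarrow> lam k) (at 0)" for k unfolding lm_def
      by (auto intro!: tendsto_eq_intros)
  have "((\<lambda>t. S (th t) (lm t)) \<longlongrightarrow> S \<theta> lam) (at 0)"
    unfolding S_def using assms
    by (intro tendsto_sum tendsto_mult tendsto_Mcoef tendsto_Zpf th lm)
        (auto simp: less_Suc_eq_le simp del: upt_Suc)
  moreover have "\<forall>\<^sub>F t in at 0. S (th t) (lm t) = 0"
  proof -
    have "\<forall>\<^sub>F t in at 0. \<forall>k\<in>{- (int L + 5)..int L + 5}. f (th t + of_int k * \<gamma>) \<noteq> 0"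
      by (intro eventually_ball_finite ballI)
          (auto intro!: ev[of 1 _ "\<theta> + of_int k * \<gamma>" for k] simp: th_def)
    moreover have "\<forall>\<^sub>F t in at 0. \<forall>k\<in>{..L}. f (th t + \<zeta> + lm t k) \<noteq> 0"
    proof (intro eventually_ball_finite ballI finite_atMost)
      fix k :: nat
      have "of_nat (k + 2) \<noteq> (0 :: complex)" unfolding of_nat_eq_0_iff by simp
      then show "\<forall>\<^sub>F t in at 0. f (th t + \<zeta> + lm t k) \<noteq> 0"
        by (rule ev[of "of_nat (k + 2)" _ "\<theta> + \<zeta> + lam k"]) (simp add: th_def lm_def algebra_simps)
    qed
    moreover have "\<forall>\<^sub>F t in at 0. f (2 * lm t 0) \<noteq> 0"
      by (rule ev[of 2 _ "2 * lam 0"]) (auto simp: lm_def algebra_simps)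
    moreover have "\<forall>\<^sub>F t in at 0. f (2 * lm t 0 + \<gamma>) \<noteq> 0"
      by (rule ev[of 2 _ "2 * lam 0 + \<gamma>"]) (auto simp: lm_def algebra_simps)
    moreover have "\<forall>\<^sub>F t in at 0. \<forall>j\<in>{..L}. \<forall>i\<in>{..<j}. gen ms (lm t i) (lm t j) \<and> gen ms
        (- lm t i - \<gamma>) (lm t j)"
    proof (intro eventually_ball_finite ballI finite_atMost finite_lessThan eventually_conj)
      fix i j :: nat assume "i \<in> {..<j}"
      then have "of_nat (Suc j) \<noteq> (of_nat (Suc i) :: complex)"
          "of_nat (Suc j + Suc i) \<noteq> (0 :: complex)"
        unfolding of_nat_eq_iff of_nat_eq_0_iff by auto
      then have ij: "of_nat (Suc j) - of_nat (Suc i) \<noteq> (0 :: complex)" "of_nat (Suc j) +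
          of_nat (Suc i) \<noteq> (0 :: complex)"
        unfolding of_nat_add right_minus_eq by blast+
      show "\<forall>\<^sub>F t in at 0. gen ms (lm t i) (lm t j)"
        unfolding lm_def using ij by (intro eventually_gen[OF f0]) (auto simp del: of_nat_Suc)
      have "\<forall>\<^sub>F t in at 0. gen ms ((- lam i - \<gamma>) + (- of_nat (Suc i)) * t) (lm t j)"
        unfolding lm_def using ij by (intro eventually_gen[OF f0]) (auto simp del: of_nat_Suc)
      then show "\<forall>\<^sub>F t in at 0. gen ms (- lm t i - \<gamma>) (lm t j)"
        by (simp add: lm_def algebra_simps)
    qed
    ultimately show ?thesis
    proof eventually_elim
      case (elim t)
      show ?case unfolding S_def
      proof (rule sos.generic_relation[OF sos_axioms], fold ms_def)
        show "f (th t + of_int k * \<gamma>) \<noteq> 0" if "\<bar>k\<bar> \<le> int L + 5" for k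
        proof -
          have "k \<in> {- (int L + 5)..int L + 5}" using that by auto
          then show ?thesis using elim(1) by blast
        qed
      qed (use elim in auto)
    qed
  qed
  ultimately have "((\<lambda>_. 0) \<longlongrightarrow> S \<theta> lam) (at (0 :: complex))"
    by (rule Lim_transform_eventually)
  then have "S \<theta> lam = 0" by (simp add: tendsto_const_iff)
  then show ?thesis unfolding S_def .
qed

end
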